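(* Let $p$ be a probability distribution on $\mathbb{R}$ with mean $0$, variance $1$ and finite higher moments. The ensemble of real symmetric palindromic Toeplitz matrices $A_N$ (normalized by dividing by $\sqrt{N}$) and the ensemble of symmetric Toeplitz matrices $S_N$, both with independent entries chosen from $p$, have the same limiting spectral distribution.
   Context: Let $b_0,b_1,b_2,\dots$ and $x_0,x_1,x_2,\dots$ be sequences of independent random variables with distribution $p$. Palindromic ensemble: for $N$ even, the $N\times N$ real symmetric palindromic Toeplitz matrix $A_N$ has entries $a_{ij}=b_{\min(|i-j|,\,N-1-|i-j|)}$, $1\le i,j\le N$ (first row the palindrome $(b_0,b_1,\dots,b_{N/2-1},b_{N/2-1},\dots,b_1,b_0)$). Symmetric Toeplitz (symmetric circulant) ensemble: $S_N$ is $N^{-1/2}$ times the $N\times N$ matrix whose $(i,j)$ entry is $x_{|i-j|}$, subject to $x_{N-j}=x_j$; that is, the $(i,j)$ entry of $S_N$ is $N^{-1/2}x_{\min(|i-j|,\,N-|i-j|)}$, with $x_0,\dots,x_{\lfloor N/2\rfloor}$ independent. For an $N\times N$ real symmetric matrix $B$ with eigenvalues $\mu_1,\dots,\mu_N$ put $F^{B}(x)=\frac1N\#\{i\le N:\mu_i\le x\}$. The empirical spectral distributions considered are $F^{A_N/\sqrt{N}}$ and $F^{S_N}$. A distribution function $F$ is the limiting spectral distribution of an ensemble if, as $N\to\infty$, these (random) empirical spectral distributions converge to $F$. The modes of convergence considered are weakly, in probability and almost surely: almost surely means that with probability $1$ the empirical distribution converges to $F(x)$ at every continuity point $x$ of $F$;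 in probability, respectively weakly, means that for every continuity point $x$ of $F$ the value at $x$ of the empirical distribution converges to $F(x)$ in probability, respectively in distribution. That the ensembles have the same limiting spectral distribution means that there is one distribution function $F$ to which both $F^{A_N/\sqrt{N}}$ and $F^{S_N}$ converge in these senses. "Finite higher moments" means all moments of $p$ are finite. *)

theory Defs
  imports
    "HOL-Probability.Probability"
    "Jordan_Normal_Form.Char_Poly"
begin

definition iid_sequence :: "'a measure \<Rightarrow> real measure \<Rightarrow> (nat \<Rightarrow> 'a \<Rightarrow> real) \<Rightarrow> bool" where
  "iid_sequence M p X \<longleftrightarrow>
     prob_space.indep_vars M (\<lambda>_. borel) X UNIV \<and> (\<forall>k. distr M borel (X k) = p)"

text \<open>Rows and columns are numbered from 0 to \<open>N - 1\<close>, which does not change the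
  difference of the indices. The matrix is only used for even \<open>N\<close>.\<close>

definition palindromic_toeplitz :: "(nat \<Rightarrow> real) \<Rightarrow> nat \<Rightarrow> real mat" where
  "palindromic_toeplitz b N =
     Matrix.mat N N (\<lambda>(i, j). let d = nat \<bar>int i - int j\<bar> in b (min d (N - 1 - d)))"

text \<open>The factor \<open>1 / sqrt N\<close> is part of this ensemble.\<close>

definition symmetric_toeplitz :: "(nat \<Rightarrow> real) \<Rightarrow> nat \<Rightarrow> real mat" where
  "symmetric_toeplitz x N =
     (1 / sqrt (real N)) \<cdot>\<^sub>m
       Matrix.mat N N (\<lambda>(i, j). let d = nat \<bar>int i - int j\<bar> in x (min d (N - d)))"

text \<open>Eigenvalues are counted with algebraic multiplicity, as roots of the characteristic
  polynomial; for a real symmetric matrix all of them are real.\<close>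

definition empirical_spectral_distribution :: "real mat \<Rightarrow> real \<Rightarrow> real" where
  "empirical_spectral_distribution B t =
     real (size (filter_mset (\<lambda>\<mu>. \<mu> \<le> t) (proots (char_poly B)))) / real (dim_row B)"

definition converges_in_distribution_to_const ::
    "'a measure \<Rightarrow> (nat \<Rightarrow> 'a \<Rightarrow> real) \<Rightarrow> real \<Rightarrow> bool" where
  "converges_in_distribution_to_const M Y c \<longleftrightarrow>
     (\<forall>n. Y n \<in> borel_measurable M) \<and>
     weak_conv_m (\<lambda>n. distr M borel (Y n)) (return borel c)"

definition converges_in_probability_to_const ::
    "'a measure \<Rightarrow> (nat \<Rightarrow> 'a \<Rightarrow> real) \<Rightarrow> real \<Rightarrow> bool" where
  "converges_in_probability_to_const M Y c \<longleftrightarrow>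
     (\<forall>n. Y n \<in> borel_measurable M) \<and>
     (\<forall>\<epsilon>>0. (\<lambda>n. measure M {\<omega> \<in> space M. \<bar>Y n \<omega> - c\<bar> > \<epsilon>}) \<longlonglongrightarrow> 0)"

text \<open>\<open>B n \<omega>\<close> is the \<open>n\<close>-th matrix of the ensemble at the sample point \<open>\<omega>\<close>; its size need not
  be \<open>n\<close>. The conjuncts after the first are the weak, in probability and almost sure
  convergence. In the last one the null set does not depend on the continuity point, since
  \<open>weak_conv\<close> is pointwise convergence at every continuity point of \<open>F\<close>.\<close>

definition limiting_spectral_distribution ::
    "'a measure \<Rightarrow> (nat \<Rightarrow> 'a \<Rightarrow> real mat) \<Rightarrow> (real \<Rightarrow> real) \<Rightarrow> bool" where
  "limiting_spectral_distribution M B F \<longleftrightarrow>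
     (\<exists>\<nu>. real_distribution \<nu> \<and> F = cdf \<nu>) \<and>
     (\<forall>t. isCont F t \<longrightarrow> converges_in_distribution_to_const M
        (\<lambda>n \<omega>. empirical_spectral_distribution (B n \<omega>) t) (F t)) \<and>
     (\<forall>t. isCont F t \<longrightarrow> converges_in_probability_to_const M
        (\<lambda>n \<omega>. empirical_spectral_distribution (B n \<omega>) t) (F t)) \<and>
     (AE \<omega> in M. weak_conv (\<lambda>n. empirical_spectral_distribution (B n \<omega>)) F)"

end

(* With n = N - 1, the leading n x n block of the palindromic matrix A_N is the symmetric circulant
   matrix C of order n built from the same sequence, and the last row of A_N repeats its first row.
   Hence n char(A_N) = X (2 n p - X p') with p = char(C). Since 2 n p - X p' vanishes at the
   critical points of p / X^(2n), Rolle's theorem shows that the numbers of eigenvalues of A_N and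
   of C in any half-line differ by at most 3, so that both ensembles reduce to circulants.

   The eigenvalues of a symmetric circulant matrix are the discrete cosine transforms l_k of its
   first row, and the limit is the standard normal law. By Levy's theorem it suffices that the means
   of cos (s l_k / sqrt n) and sin (s l_k / sqrt n) over k < n converge almost surely for every s.
   Their expectations are means of products of characteristic functions of p, and are computed as in
   the central limit theorem. Their fourth central moments are O(n^(-3/2)), hence summable: apply the
   Efron-Stein inequality to the squared fluctuation. Resampling the j-th entry changes the mean, up
   to O(1/n), by O(n^(-1/2)) times its j-th Fourier coefficient, and Bessel's inequality bounds the
   sum over j of the squared coefficients. *)

theory Submission
  imports Defs "Jordan_Normal_Form.Column_Operations"
begin

section \<open>The characteristic polynomials of the two ensembles\<close>

text \<open>Rolle's theorem does the work of Cauchy interlacing for the principal block; a bounded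
  error in the counts vanishes after division by \<open>n\<close>. Fourth moments are taken because
  the second moment of the fluctuation comes out only as O(n^(-3/4)), which is not summable;
  Efron-Stein for the square lets this factor enter twice. The exponent has one cause: Bessel bounds
  a sum over j, but each summand carries an unbounded random weight that depends on the j-th entry.
  Bessel becomes available only after the weights are cut at the level n^(1/4), and the tail is paid
  for with high moments of \<open>p\<close>. Almost sure convergence at a frequency s comes with a
  null set depending on s. It is arranged for rational s and carried to real s by a Lipschitz bound
  whose random constant bounds the normalized sums of squared entries. The notions of convergence
  also ask that the empirical distribution be measurable in the sample point. Eigenvalues are chosen
  pointwise, without measurability, so only symmetric functions of them are used.\<close>

lemma sum_roots_of_unity:
  fixes m :: int
  assumes "n > 0"
  shows "(\<Sum>k<n. cis (2 * pi * real_of_int m * real k / real n)) = (if int n dvd m then of_nat n else 0)"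
proof -
  define z where "z = cis (2 * pi * real_of_int m / real n)"
  have pow: "cis (2 * pi * real_of_int m * real k / real n) = z ^ k" for k
    unfolding z_def Complex.DeMoivre by (simp add: mult_ac)
  have zn: "z ^ n = 1"
  proof -
    have "z ^ n = cis (2 * pi * real_of_int m)"
      using assms unfolding z_def Complex.DeMoivre by simp
    also have "\<dots> = 1"
      by (metis cis_multiple_2pi Ints_of_int)
    finally show ?thesis .
  qed
  show ?thesis
  proof (cases "int n dvd m")
    case True
    then obtain q where q: "m = int n * q" by auto
    have "z = cis (2 * pi * real_of_int q)" using assms unfolding z_def q by (simp add: mult_ac)
    also have "\<dots> = 1" by (metis cis_multiple_2pi Ints_of_int)
    finally show ?thesis using True by (simp add: pow)
  next
    case False
    have "z \<noteq> 1"
    proof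
      assume "z = 1"
      then have "cos (2 * pi * real_of_int m / real n) = 1"
        by (simp add: z_def complex_eq_iff)
      then obtain q :: int where "2 * pi * real_of_int m / real n = q * 2 * pi"
        by (auto simp: cos_one_2pi_int)
      then have "real_of_int m = real_of_int (q * int n)"
        using assms by (simp add: field_simps)
      then have "m = q * int n" by (simp only: of_int_eq_iff)
      with False show False by simp
    qed
    then show ?thesis using False zn by (simp add: pow geometric_sum)
  qed
qed

lemma sum_cos_roots_of_unity:
  fixes m :: int
  assumes "n > 0"
  shows "(\<Sum>k<n. cos (2 * pi * real_of_int m * real k / real n)) = (if int n dvd m then real n else 0)"
  using arg_cong[OF sum_roots_of_unity[OF assms, of m], of Re] by simp

lemma sum_sin_roots_of_unity:
  fixes m :: int
  assumes "n > 0"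
  shows "(\<Sum>k<n. sin (2 * pi * real_of_int m * real k / real n)) = 0"
  using arg_cong[OF sum_roots_of_unity[OF assms, of m], of Im] by simp

definition angle :: "nat \<Rightarrow> nat \<Rightarrow> nat \<Rightarrow> real" where
  "angle n j k = 2 * pi * real j * real k / real n"

lemma angle_commute: "angle n j k = angle n k j"
  by (simp add: angle_def)

lemma angle_mod:
  assumes "n > 0"
  shows "cos (angle n (j mod n) k) = cos (angle n j k)"
    and "sin (angle n (j mod n) k) = sin (angle n j k)"
proof -
  have "real j = real (j mod n) + real n * real (j div n)"
    by (metis mod_mult_div_eq of_nat_add of_nat_mult)
  then have eq: "angle n j k = angle n (j mod n) k + 2 * pi * real (j div n * k)"
    using assms by (simp add: angle_def field_simps)
  have "cis (angle n j k) = cis (angle n (j mod n) k) * cis (2 * pi * real (j div n * k))"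
    by (simp only: eq cis_mult)
  also have "cis (2 * pi * real (j div n * k)) = 1"
    by (intro cis_multiple_2pi Ints_of_nat)
  finally have "cis (angle n j k) = cis (angle n (j mod n) k)" by simp
  then show "cos (angle n (j mod n) k) = cos (angle n j k)"
    and "sin (angle n (j mod n) k) = sin (angle n j k)"
    by (simp_all add: complex_eq_iff)
qed

lemma angle_complement:
  assumes "0 < n" "d \<le> n"
  shows "cos (angle n (n - d) k) = cos (angle n d k)"
    and "sin (angle n (n - d) k) = - sin (angle n d k)"
proof -
  have eq: "angle n (n - d) k = 2 * pi * real k - angle n d k"
    using assms by (simp add: angle_def field_simps of_nat_diff)
  have "cis (angle n (n - d) k) = cis (2 * pi * real k) * cis (- angle n d k)"
    by (simp only: eq cis_mult) simp
  also have "cis (2 * pi * real k) = 1"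
    by (intro cis_multiple_2pi Ints_of_nat)
  finally have "cis (angle n (n - d) k) = cis (- angle n d k)" by simp
  then show "cos (angle n (n - d) k) = cos (angle n d k)"
    and "sin (angle n (n - d) k) = - sin (angle n d k)"
    by (simp_all add: complex_eq_iff)
qed

section \<open>Diagonalisation of symmetric circulant matrices\<close>

definition sym_circulant :: "(nat \<Rightarrow> real) \<Rightarrow> nat \<Rightarrow> real mat" where
  "sym_circulant x n = Matrix.mat n n (\<lambda>(i, j). let d = nat \<bar>int i - int j\<bar> in x (min d (n - d)))"

definition circ_eig :: "(nat \<Rightarrow> real) \<Rightarrow> nat \<Rightarrow> nat \<Rightarrow> real" where
  "circ_eig x n k = (\<Sum>d<n. x (min d (n - d)) * cos (angle n d k))"

text \<open>The matrix of the discrete Hartley transform. It plays the role of the Fourier matrix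
  but is real and self-inverse, so the whole diagonalisation stays over the reals.\<close>

definition hartley :: "nat \<Rightarrow> real mat" where
  "hartley n = Matrix.mat n n (\<lambda>(j, k). (cos (angle n j k) + sin (angle n j k)) / sqrt (real n))"

lemma sym_circulant_carrier [simp]: "sym_circulant x n \<in> carrier_mat n n"
  and hartley_carrier [simp]: "hartley n \<in> carrier_mat n n"
  by (auto simp: sym_circulant_def hartley_def)

lemma cas_mult_cas: "(cos a + sin a) * (cos b + sin b) = cos (a - b) + sin (a + (b :: real))"
  by (simp add: cos_diff sin_add algebra_simps)

text \<open>By \<open>cas_mult_cas\<close> an entry of the square splits into a cosine sum at
  frequency \<open>i - j\<close>, which vanishes off the diagonal, and a sine sum at frequency
  \<open>i + j\<close>, which always vanishes.\<close>

lemma hartley_involution: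
  assumes "n > 0"
  shows "hartley n * hartley n = 1\<^sub>m n"
proof (rule eq_matI)
  fix i j assume "i < dim_row (1\<^sub>m n :: real mat)" "j < dim_col (1\<^sub>m n :: real mat)"
  then have ij: "i < n" "j < n" by auto
  have "(hartley n * hartley n) $$ (i, j)
      = (\<Sum>k<n. (cos (angle n i k) + sin (angle n i k)) / sqrt (real n) * ((cos (angle n k j) + sin (angle n k j)) / sqrt (real n)))"
    using ij by (simp add: hartley_def scalar_prod_def lessThan_atLeast0)
  also have "\<dots> = (\<Sum>k<n. (cos (angle n i k) + sin (angle n i k)) * (cos (angle n j k) + sin (angle n j k))) / real n"
    using assms by (simp add: sum_divide_distrib angle_commute[of n _ j])
  also have "(\<Sum>k<n. (cos (angle n i k) + sin (angle n i k)) * (cos (angle n j k) + sin (angle n j k)))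
      = (\<Sum>k<n. cos (2 * pi * real_of_int (int i - int j) * real k / real n))
        + (\<Sum>k<n. sin (2 * pi * real_of_int (int i + int j) * real k / real n))"
    unfolding cas_mult_cas sum.distrib
    by (intro arg_cong2[of _ _ _ _ "(+)"] sum.cong refl arg_cong[of _ _ cos] arg_cong[of _ _ sin])
       (simp_all add: angle_def algebra_simps add_divide_distrib diff_divide_distrib)
  also have "\<dots> = (if i = j then real n else 0)"
  proof -
    have "int n dvd int i - int j \<longleftrightarrow> i = j"
      using ij zdvd_imp_le[of "int n" "int i - int j"] zdvd_imp_le[of "int n" "int j - int i"]
      by (metis diff_0 diff_self dvd_0_right dvd_diff_commute minus_diff_eq mod_less of_nat_eq_iff of_nat_mod mod_eq_dvd_iff)
    then show ?thesis
      unfolding sum_cos_roots_of_unity[OF assms] sum_sin_roots_of_unity[OF assms] by simp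
  qed
  also have "\<dots> / real n = (1\<^sub>m n) $$ (i, j)" using ij assms by simp
  finally show "(hartley n * hartley n) $$ (i, j) = (1\<^sub>m n) $$ (i, j)" .
qed (auto simp: hartley_def)

lemma inj_on_add_mod:
  fixes i n :: nat
  assumes "i < n"
  shows "inj_on (\<lambda>d. (d + i) mod n) {..<n}"
proof (rule inj_onI)
  fix a b assume ab: "a \<in> {..<n}" "b \<in> {..<n}" "(a + i) mod n = (b + i) mod n"
  have "(c + i) mod n = (if c + i < n then c + i else c + i - n)" if "c < n" for c
    using that assms by (simp add: le_mod_geq)
  with ab show "a = b" by (auto split: if_splits)
qed

text \<open>The distance from \<open>m\<close> to the nearest multiple of \<open>n\<close>. It
  depends only on the residue of \<open>m\<close>, so invariance of the circulant under cyclic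
  shifts becomes rewriting modulo \<open>n\<close>.\<close>

definition cyclic_dist :: "nat \<Rightarrow> int \<Rightarrow> nat" where
  "cyclic_dist n m = nat (min (m mod int n) (int n - m mod int n))"

lemma cyclic_dist_mod [simp]: "cyclic_dist n (m mod int n) = cyclic_dist n m"
  by (simp add: cyclic_dist_def)

lemma sym_circulant_index:
  assumes "i < n" "j < n"
  shows "sym_circulant x n $$ (i, j) = x (cyclic_dist n (int j - int i))"
proof (cases "i \<le> j")
  case True
  then have "(int j - int i) mod int n = int j - int i" using assms by simp
  then show ?thesis using assms True
    by (auto simp: sym_circulant_def cyclic_dist_def Let_def intro!: arg_cong[of _ _ x])
next
  case False
  have "(int j - int i) mod int n = (int j - int i + int n) mod int n" by simp
  also have "\<dots> = int j - int i + int n" using assms False by (intro mod_pos_pos_trivial) auto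
  finally have "(int j - int i) mod int n = int j - int i + int n" .
  then show ?thesis using assms False
    by (auto simp: sym_circulant_def cyclic_dist_def Let_def intro!: arg_cong[of _ _ x])
qed

lemma cyclic_dist_of_nat: "d < n \<Longrightarrow> cyclic_dist n (int d) = min d (n - d)"
  by (auto simp: cyclic_dist_def)

text \<open>Translating the summation index by the row index leaves a sum over cyclic distances
  \<open>d\<close>. The addition formula for cos + sin separates a cosine part, which is the
  eigenvalue, from a sine part, which cancels under replacing \<open>d\<close> by
  \<open>n - d\<close>.\<close>

lemma sym_circulant_hartley:
  assumes "n > 0"
  shows "sym_circulant x n * hartley n = hartley n * mat_diag n (circ_eig x n)"
proof (rule eq_matI)
  fix i k assume "i < dim_row (hartley n * mat_diag n (circ_eig x n))" "k < dim_col (hartley n * mat_diag n (circ_eig x n))"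
  then have ik: "i < n" "k < n" by (auto simp: hartley_def mat_diag_def)
  define cas where "cas t = cos t + sin t" for t :: real
  have bij: "bij_betw (\<lambda>d. (i + d) mod n) {..<n} {..<n}"
  proof -
    have inj: "inj_on (\<lambda>d. (i + d) mod n) {..<n}"
      using inj_on_add_mod[OF ik(1)] by (simp add: add.commute)
    moreover have "(\<lambda>d. (i + d) mod n) ` {..<n} \<subseteq> {..<n}" using assms by auto
    ultimately show ?thesis
      by (simp add: bij_betw_def endo_inj_surj)
  qed
  have odd: "(\<Sum>d<n. x (min d (n - d)) * sin (angle n d k)) = 0"
  proof -
    let ?f = "\<lambda>d. x (min d (n - d)) * sin (angle n d k)"
    have "sum ?f {..<n} = sum ?f ({..<n} - {0})"
      using assms by (subst sum.remove[of _ 0]) (auto simp: angle_def)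
    also have "{..<n} - {0} = {0<..<n}" by auto
    finally have e: "sum ?f {..<n} = sum ?f {0<..<n}" .
    have "sum ?f {0<..<n} = sum (\<lambda>d. - ?f d) {0<..<n}"
      by (rule sum.reindex_bij_witness[of _ "\<lambda>d. n - d" "\<lambda>d. n - d"])
         (use assms in \<open>auto simp: angle_complement min.commute\<close>)
    then show ?thesis by (simp add: e sum_negf)
  qed
  have "(sym_circulant x n * hartley n) $$ (i, k) = (\<Sum>j<n. x (cyclic_dist n (int j - int i)) * (cas (angle n j k) / sqrt (real n)))"
    using ik by (simp add: scalar_prod_def lessThan_atLeast0 sym_circulant_index[symmetric] hartley_def sym_circulant_def cas_def)
  also have "\<dots> = (\<Sum>d<n. x (cyclic_dist n (int ((i + d) mod n) - int i)) * (cas (angle n ((i + d) mod n) k) / sqrt (real n)))"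
    by (rule sum.reindex_bij_betw[OF bij, symmetric])
  also have "\<dots> = (\<Sum>d<n. x (min d (n - d)) * (cas (angle n i k + angle n d k) / sqrt (real n)))"
  proof (rule sum.cong[OF refl])
    fix d assume d: "d \<in> {..<n}"
    have "cyclic_dist n (int ((i + d) mod n) - int i) = cyclic_dist n ((int ((i + d) mod n) - int i) mod int n)" by simp
    also have "(int ((i + d) mod n) - int i) mod int n = int d mod int n"
      by (simp add: zmod_int mod_diff_left_eq)
    finally have "cyclic_dist n (int ((i + d) mod n) - int i) = min d (n - d)"
      using d by (simp add: cyclic_dist_of_nat)
    moreover have "cas (angle n ((i + d) mod n) k) = cas (angle n i k + angle n d k)"
      unfolding cas_def angle_mod[OF assms] by (simp add: angle_def algebra_simps add_divide_distrib)
    ultimately show "x (cyclic_dist n (int ((i + d) mod n) - int i)) * (cas (angle n ((i + d) mod n) k) / sqrt (real n))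
      = x (min d (n - d)) * (cas (angle n i k + angle n d k) / sqrt (real n))" by simp
  qed
  also have "\<dots> = (\<Sum>d<n. (cas (angle n i k) * (x (min d (n - d)) * cos (angle n d k))
      + (cos (angle n i k) - sin (angle n i k)) * (x (min d (n - d)) * sin (angle n d k))) / sqrt (real n))"
    by (intro sum.cong refl) (simp add: cas_def cos_add sin_add field_simps)
  also have "\<dots> = cas (angle n i k) * circ_eig x n k / sqrt (real n)"
    unfolding circ_eig_def sum_divide_distrib[symmetric] sum.distrib sum_distrib_left[symmetric] odd by simp
  also have "\<dots> = (hartley n * mat_diag n (circ_eig x n)) $$ (i, k)"
    using ik by (subst mat_diag_mult_right[of _ n n]) (auto simp: hartley_def cas_def)
  finally show "(sym_circulant x n * hartley n) $$ (i, k) = (hartley n * mat_diag n (circ_eig x n)) $$ (i, k)" .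
qed (auto simp: hartley_def sym_circulant_def mat_diag_def)

lemma char_poly_sym_circulant:
  assumes "n > 0"
  shows "char_poly (sym_circulant x n) = (\<Prod>k<n. [:- circ_eig x n k, 1:])"
proof -
  let ?H = "hartley n" and ?D = "mat_diag n (circ_eig x n)"
  have D: "?D \<in> carrier_mat n n" by (simp add: mat_diag_def)
  have "sym_circulant x n = sym_circulant x n * (?H * ?H)" by (simp add: hartley_involution[OF assms] right_mult_one_mat[of _ n n])
  also have "\<dots> = sym_circulant x n * ?H * ?H" by (simp add: assoc_mult_mat[of _ n n _ n _ n])
  also have "\<dots> = ?H * ?D * ?H" by (simp add: sym_circulant_hartley[OF assms])
  finally have eq: "sym_circulant x n = ?H * ?D * ?H" .
  have "{sym_circulant x n, ?D, ?H, ?H} \<subseteq> carrier_mat n n" by (simp add: D)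
  then have "similar_mat (sym_circulant x n) ?D"
    by (rule similar_matI) (rule hartley_involution[OF assms] eq)+
  then have "char_poly (sym_circulant x n) = char_poly ?D" by (rule char_poly_similar)
  also have "\<dots> = (\<Prod>a\<leftarrow>diag_mat ?D. [:- a, 1:])"
    by (rule char_poly_upper_triangular[OF D]) (auto simp: mat_diag_def)
  also have "\<dots> = (\<Prod>k<n. [:- circ_eig x n k, 1:])"
    by (auto intro!: prod.cong simp add: diag_mat_def mat_diag_def lessThan_atLeast0 prod.list_conv_set_nth)
  finally show ?thesis .
qed

section \<open>The characteristic polynomial of the palindromic matrix\<close>

text \<open>Simultaneous permutation of rows and columns is carried out as two row permutations with
  a matrix transpose in between; the two signs multiply to 1.\<close>

lemma char_poly_permute:
  fixes A :: "'a :: comm_ring_1 mat"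
  assumes A: "A \<in> carrier_mat n n" and p: "p permutes {0..<n}"
  shows "char_poly (Matrix.mat n n (\<lambda>(i, j). A $$ (p i, p j))) = char_poly A"
proof -
  let ?M = "char_poly_matrix A"
  have M: "?M \<in> carrier_mat n n" using A by simp
  have pl: "p i < n \<longleftrightarrow> i < n" for i using permutes_in_image[OF p, of i] by simp
  have pi: "p i = p j \<longleftrightarrow> i = j" for i j using permutes_inj[OF p] by (auto dest: injD)
  define R where "R = Matrix.mat n n (\<lambda>(i, j). ?M $$ (p i, j))"
  have R: "R \<in> carrier_mat n n" by (simp add: R_def)
  have "char_poly_matrix (Matrix.mat n n (\<lambda>(i, j). A $$ (p i, p j)))
      = transpose_mat (Matrix.mat n n (\<lambda>(i, j). transpose_mat R $$ (p i, j)))"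
    by (rule eq_matI) (use A in \<open>auto simp: char_poly_matrix_def R_def pl pi\<close>)
  then have "char_poly (Matrix.mat n n (\<lambda>(i, j). A $$ (p i, p j)))
      = Determinant.det (Matrix.mat n n (\<lambda>(i, j). transpose_mat R $$ (p i, j)))"
    by (simp add: char_poly_def Determinant.det_transpose[of _ n])
  also have "\<dots> = signof p * Determinant.det (transpose_mat R)"
    by (rule Determinant.det_permute_rows) (use R p in auto)
  also have "Determinant.det (transpose_mat R) = Determinant.det R"
    using R by (rule Determinant.det_transpose)
  also have "Determinant.det R = signof p * Determinant.det ?M"
    unfolding R_def by (rule Determinant.det_permute_rows[OF M p])
  finally show ?thesis
    by (simp add: char_poly_def mult.assoc[symmetric] sign_def split: if_splits)
qed

text \<open>The cyclic shift by \<open>i\<close> preserves the circulant and carries the index 0 to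
  \<open>i\<close>. The derivative of the characteristic polynomial, a sum of all these minors, is
  thereby a multiple of a single one.\<close>

lemma char_poly_sym_circulant_minor:
  assumes i: "i < n"
  shows "char_poly (mat_delete (sym_circulant x n) i i) = char_poly (mat_delete (sym_circulant x n) 0 0)"
proof -
  define p where "p a = (if a < n then (a + i) mod n else a)" for a
  have n: "n > 0" using i by simp
  have inj: "inj_on p {0..<n}"
  proof -
    have "inj_on p {0..<n} \<longleftrightarrow> inj_on (\<lambda>d. (d + i) mod n) {0..<n}"
      by (rule inj_on_cong) (simp add: p_def)
    then show ?thesis using inj_on_add_mod[OF i] by (simp only: lessThan_atLeast0)
  qed
  have p: "p permutes {0..<n}"
  proof (rule bij_imp_permutes)
    have "p ` {0..<n} \<subseteq> {0..<n}" using n by (auto simp: p_def)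
    then have "p ` {0..<n} = {0..<n}" using inj by (intro endo_inj_surj) auto
    then show "bij_betw p {0..<n} {0..<n}" using inj by (simp add: bij_betw_def)
  qed (simp add: p_def)
  have p0: "p a = i \<longleftrightarrow> a = 0" if "a < n" for a
  proof -
    have "p a = i \<longleftrightarrow> p a = p 0" using i by (simp add: p_def)
    also have "\<dots> \<longleftrightarrow> a = 0" by (rule inj_on_eq_iff[OF inj]) (use that n in auto)
    finally show ?thesis .
  qed
  \<comment> \<open>Erasing instead of deleting keeps the size \<open>n\<close>, so that the shift
    acts on the full index set. The price is a factor X, which cancels at the end.\<close>
  have erase: "char_poly (mat_erase (sym_circulant x n) j j) = monom 1 1 * char_poly (mat_delete (sym_circulant x n) j j)" if "j < n" for j
  proof -
    have "char_poly (mat_erase (sym_circulant x n) j j) = monom 1 1 * char_poly (mat_delete (mat_erase (sym_circulant x n) j j) j j)"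
      by (rule char_poly_0_column) (use that in \<open>auto simp: mat_erase_def sym_circulant_def\<close>)
    also have "mat_delete (mat_erase (sym_circulant x n) j j) j j = mat_delete (sym_circulant x n) j j"
      by (auto simp: mat_delete_def mat_erase_def sym_circulant_def)
    finally show ?thesis .
  qed
  have inv: "sym_circulant x n $$ (p a, p b) = sym_circulant x n $$ (a, b)" if "a < n" "b < n" for a b
  proof -
    have "cyclic_dist n (int (p b) - int (p a)) = cyclic_dist n ((int (p b) - int (p a)) mod int n)" by simp
    also have "(int (p b) - int (p a)) mod int n = (int b - int a) mod int n"
      using that by (simp add: p_def zmod_int mod_diff_eq)
    finally show ?thesis using that n by (simp add: sym_circulant_index p_def)
  qed
  have "mat_erase (sym_circulant x n) 0 0 = Matrix.mat n n (\<lambda>(a, b). mat_erase (sym_circulant x n) i i $$ (p a, p b))"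
  proof (rule eq_matI)
    fix a b assume "a < dim_row (Matrix.mat n n (\<lambda>(a, b). mat_erase (sym_circulant x n) i i $$ (p a, p b)))"
      "b < dim_col (Matrix.mat n n (\<lambda>(a, b). mat_erase (sym_circulant x n) i i $$ (p a, p b)))"
    then have ab: "a < n" "b < n" by auto
    then have "p a < n" "p b < n" using n by (auto simp: p_def)
    moreover have "dim_row (sym_circulant x n) = n" "dim_col (sym_circulant x n) = n" by (auto simp: sym_circulant_def)
    ultimately show "mat_erase (sym_circulant x n) 0 0 $$ (a, b)
        = Matrix.mat n n (\<lambda>(a, b). mat_erase (sym_circulant x n) i i $$ (p a, p b)) $$ (a, b)"
      using ab by (simp add: mat_erase_def p0 inv)
  qed (auto simp: mat_erase_def sym_circulant_def)
  then have "char_poly (mat_erase (sym_circulant x n) 0 0) = char_poly (mat_erase (sym_circulant x n) i i)"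
    using char_poly_permute[OF _ p, of "mat_erase (sym_circulant x n) i i"] by simp
  then show ?thesis using i n by (simp add: erase)
qed

text \<open>The similarity \<open>add_col_sub_row\<close> subtracts row 0 from the equal row
  \<open>n\<close>, which becomes zero, and adds column \<open>n\<close> to column 0. What remains
  is X times the characteristic polynomial of \<open>D\<close>, the circulant with its first column
  doubled. Expansion along that column gives 2 p - X m with a principal minor polynomial m, and p' =
  n m.\<close>

lemma char_poly_palindromic:
  assumes n: "n > 0"
  shows "of_nat n * char_poly (palindromic_toeplitz b (Suc n))
    = [:0, 1:] * (2 * of_nat n * char_poly (sym_circulant b n) - [:0, 1:] * pderiv (char_poly (sym_circulant b n)))"
proof -
  let ?A = "palindromic_toeplitz b (Suc n)" and ?C = "sym_circulant b n"
  let ?B = "add_col_sub_row 1 n 0 ?A"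
  define D where "D = Matrix.mat n n (\<lambda>(i, j). (if j = 0 then 2 else 1) * ?C $$ (i, j))"
  have A: "?A \<in> carrier_mat (Suc n) (Suc n)" by (simp add: palindromic_toeplitz_def)
  have B: "?B \<in> carrier_mat (Suc n) (Suc n)" using A by simp
  have D: "D \<in> carrier_mat n n" by (simp add: D_def)
  have dims: "dim_row ?A = Suc n" "dim_col ?A = Suc n" using A by auto
  have Aij: "?A $$ (i, j) = b (min (nat \<bar>int i - int j\<bar>) (n - nat \<bar>int i - int j\<bar>))" if "i < Suc n" "j < Suc n" for i j
    using that by (simp add: palindromic_toeplitz_def Let_def)
  have Cij: "?C $$ (i, j) = b (min (nat \<bar>int i - int j\<bar>) (n - nat \<bar>int i - int j\<bar>))" if "i < n" "j < n" for i j
    using that by (simp add: sym_circulant_def Let_def)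
  have last_row: "?B $$ (n, j) = 0" if "j < Suc n" for j
  proof -
    have "?A $$ (n, j) = ?A $$ (0, j)" if "j < Suc n" for j
      using that by (simp add: Aij nat_diff_distrib min.commute)
    from this[OF that] this[of n] show ?thesis
      using that n by (subst add_col_sub_index_row) (auto simp: dims Aij)
  qed
  have "char_poly ?A = char_poly ?B"
    by (rule char_poly_similar[OF add_col_sub_row_similar[OF A], symmetric]) (use n in auto)
  also have "\<dots> = char_poly (transpose_mat ?B)"
    using B by simp
  also have "\<dots> = monom 1 1 * char_poly (mat_delete (transpose_mat ?B) n n)"
    by (rule char_poly_0_column[of "Suc n"]) (use B last_row dims in auto)
  also have "mat_delete (transpose_mat ?B) n n = transpose_mat D"
  proof (rule eq_matI)
    fix i j assume "i < dim_row (transpose_mat D)" "j < dim_col (transpose_mat D)"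
    then have ij: "i < n" "j < n" by (auto simp: D_def)
    have "mat_delete (transpose_mat ?B) n n $$ (i, j) = ?B $$ (j, i)"
      using ij dims by (simp add: mat_delete_def)
    also have "\<dots> = ?A $$ (j, i) + (if i = 0 then ?A $$ (j, n) else 0)"
      using ij dims by (subst add_col_sub_index_row) auto
    also have "?A $$ (j, n) = ?C $$ (j, 0)"
      using ij n by (simp add: Aij Cij nat_diff_distrib min.commute)
    also have "?A $$ (j, i) = ?C $$ (j, i)"
      using ij by (simp add: Aij Cij)
    finally show "mat_delete (transpose_mat ?B) n n $$ (i, j) = transpose_mat D $$ (i, j)"
      using ij by (auto simp: D_def)
  qed (use dims in \<open>auto simp: D_def mat_delete_def\<close>)
  also have "char_poly (transpose_mat D) = char_poly D"
    using D by simp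
  finally have cA: "char_poly ?A = [:0, 1:] * char_poly D" by (simp add: x_as_monom)
  let ?MD = "char_poly_matrix D" and ?MC = "char_poly_matrix ?C"
  have "char_poly D = (\<Sum>j<n. ?MD $$ (j, 0) * cofactor ?MD j 0)"
    unfolding char_poly_def by (rule laplace_expansion_column) (use D n in auto)
  also have "\<dots> = (\<Sum>j<n. 2 * (?MC $$ (j, 0) * cofactor ?MC j 0) - (if j = 0 then [:0, 1:] * cofactor ?MC 0 0 else 0))"
  proof (rule sum.cong[OF refl])
    fix j assume "j \<in> {..<n}"
    then have j: "j < n" by simp
    have "mat_delete ?MD j 0 = mat_delete ?MC j 0"
      by (rule eq_matI) (auto simp: mat_delete_def char_poly_matrix_def D_def sym_circulant_def)
    then have cof: "cofactor ?MD j 0 = cofactor ?MC j 0" by (simp add: cofactor_def)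
    \<comment> \<open>Doubling the column of the circulant does not double the diagonal X of the
      characteristic matrix; this is the correction at \<open>j = 0\<close>.\<close>
    have entry: "?MD $$ (j, 0) = 2 * ?MC $$ (j, 0) - (if j = 0 then [:0, 1:] else 0)"
      using j n by (auto simp: char_poly_matrix_def D_def sym_circulant_def numeral_poly)
    show "?MD $$ (j, 0) * cofactor ?MD j 0
      = 2 * (?MC $$ (j, 0) * cofactor ?MC j 0) - (if j = 0 then [:0, 1:] * cofactor ?MC 0 0 else 0)"
    proof (cases "j = 0")
      case True
      have "(2 * a - X) * r = 2 * (a * r) - X * r" for a X r :: "real poly"
        by (simp add: algebra_simps)
      then show ?thesis unfolding cof entry using True by simp
    next
      case False
      then show ?thesis unfolding cof entry by simp
    qed
  qed
  also have "\<dots> = 2 * (\<Sum>j<n. ?MC $$ (j, 0) * cofactor ?MC j 0) - [:0, 1:] * cofactor ?MC 0 0"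
    using n by (simp add: sum_subtractf sum_distrib_left)
  also have "(\<Sum>j<n. ?MC $$ (j, 0) * cofactor ?MC j 0) = char_poly ?C"
    unfolding char_poly_def by (rule laplace_expansion_column[symmetric]) (use n in auto)
  also have "cofactor ?MC 0 0 = char_poly (mat_delete ?C 0 0)"
  proof -
    have "mat_delete ?MC 0 0 = char_poly_matrix (mat_delete ?C 0 0)"
      by (rule eq_matI) (use n in \<open>auto simp: mat_delete_def char_poly_matrix_def sym_circulant_def\<close>)
    then show ?thesis by (simp add: cofactor_def char_poly_def)
  qed
  finally have cD: "char_poly D = 2 * char_poly ?C - [:0, 1:] * char_poly (mat_delete ?C 0 0)" .
  have "pderiv (char_poly ?C) = (\<Sum>i<n. char_poly (mat_delete ?C i i))"
    by (rule pderiv_char_poly) simp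
  also have "\<dots> = (\<Sum>i<n. char_poly (mat_delete ?C 0 0))"
    by (intro sum.cong refl char_poly_sym_circulant_minor) simp
  also have "\<dots> = of_nat n * char_poly (mat_delete ?C 0 0)"
    by simp
  finally have pd: "pderiv (char_poly ?C) = of_nat n * char_poly (mat_delete ?C 0 0)" .
  have "k * (X * (2 * r - X * m)) = X * (2 * k * r - X * (k * m))" for k X r m :: "real poly"
    by (simp add: algebra_simps)
  then show ?thesis unfolding cA cD pd .
qed

section \<open>Counting roots by Rolle's theorem\<close>

lemma sum_count_le_size_filter:
  assumes "finite T" "\<And>x. x \<in> T \<Longrightarrow> P x"
  shows "sum (count M) T \<le> size (filter_mset P M)"
proof -
  let ?M = "filter_mset P M"
  have "sum (count M) T = sum (count ?M) T"
    using assms by (intro sum.cong) auto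
  also have "\<dots> = sum (count ?M) (T \<inter> set_mset ?M)"
    using assms(1) by (intro sum.mono_neutral_right) (auto simp: not_in_iff)
  also have "\<dots> \<le> sum (count ?M) (set_mset ?M)"
    by (intro sum_mono2) auto
  also have "\<dots> = size ?M" by (simp add: size_multiset_overloaded_eq)
  finally show ?thesis .
qed

text \<open>Each root of \<open>p\<close> in the interval except the largest is matched with a root
  of \<open>q\<close> in the gap above it, and this root makes up for the multiplicity that
  \<open>q\<close> may lack at the root of \<open>p\<close>. The largest root has no gap above it,
  which costs the additional 1.\<close>

lemma rolle_count_roots:
  fixes p q :: "real poly"
  assumes "is_interval I" "p \<noteq> 0" "q \<noteq> 0"
    and order: "\<And>a. a \<in> I \<Longrightarrow> poly p a = 0 \<Longrightarrow> order a p \<le> Suc (order a q)"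
    and rolle: "\<And>a b. a \<in> I \<Longrightarrow> b \<in> I \<Longrightarrow> a < b \<Longrightarrow> poly p a = 0 \<Longrightarrow> poly p b = 0 \<Longrightarrow>
                  \<exists>c. a < c \<and> c < b \<and> poly q c = 0"
  shows "size (filter_mset (\<lambda>x. x \<in> I) (proots p)) \<le> Suc (size (filter_mset (\<lambda>x. x \<in> I) (proots q)))"
proof -
  define R where "R = {x \<in> I. poly p x = 0}"
  have R: "finite R" using poly_roots_finite[OF assms(2)] by (simp add: R_def)
  have "size (filter_mset (\<lambda>x. x \<in> I) (proots p)) = sum (count (filter_mset (\<lambda>x. x \<in> I) (proots p))) R"
    using assms(2) by (subst size_multiset_overloaded_eq) (auto simp: R_def intro!: sum.cong)
  also have "\<dots> = (\<Sum>a\<in>R. order a p)"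
    using assms(2) by (intro sum.cong) (auto simp: R_def)
  finally have size_p: "size (filter_mset (\<lambda>x. x \<in> I) (proots p)) = (\<Sum>a\<in>R. order a p)" .
  show ?thesis
  proof (cases "R = {}")
    case True
    then show ?thesis by (simp add: size_p)
  next
    case False
    define R' where "R' = R - {Max R}"
    have MaxR: "Max R \<in> R" using R False by simp
    \<comment> \<open>The point is required to lie below every later root of \<open>p\<close>; this
      yields both the injectivity of \<open>g\<close> and the disjointness of its image from
      \<open>R\<close>.\<close>
    have "\<exists>c. a < c \<and> c \<in> I \<and> poly q c = 0 \<and> (\<forall>b\<in>R. a < b \<longrightarrow> c < b)" if a: "a \<in> R'" for a
    proof -
      let ?S = "{b \<in> R. a < b}"
      have "Max R \<in> ?S" using a R MaxR by (auto simp: R'_def less_le)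
      then have ne: "?S \<noteq> {}" by auto
      have "Min ?S \<in> ?S" using R ne by (intro Min_in) auto
      then have m: "Min ?S \<in> R" "a < Min ?S" by auto
      then obtain c where c: "a < c" "c < Min ?S" "poly q c = 0"
        using rolle[of a "Min ?S"] a by (auto simp: R_def R'_def)
      have "c \<in> I"
        using mem_is_interval_1_I[OF assms(1), of a "Min ?S" c] m c a by (auto simp: R_def R'_def)
      moreover have "c < b" if "b \<in> R" "a < b" for b
      proof -
        have "Min ?S \<le> b" using that R by (intro Min_le) auto
        then show ?thesis using c by simp
      qed
      ultimately show ?thesis using c by blast
    qed
    then obtain g where g: "\<And>a. a \<in> R' \<Longrightarrow> a < g a" "\<And>a. a \<in> R' \<Longrightarrow> g a \<in> I"
      "\<And>a. a \<in> R' \<Longrightarrow> poly q (g a) = 0" "\<And>a b. a \<in> R' \<Longrightarrow> b \<in> R \<Longrightarrow> a < b \<Longrightarrow> g a < b"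
      by metis
    have sub: "R' \<subseteq> R" by (auto simp: R'_def)
    have inj: "inj_on g R'"
    proof (rule linorder_inj_onI')
      fix a b assume "a \<in> R'" "b \<in> R'" "a < b"
      then have "g a < b" "b < g b" using g sub by auto
      then show "g a \<noteq> g b" by simp
    qed
    have disj: "R \<inter> g ` R' = {}"
    proof -
      have False if "a \<in> R'" "g a \<in> R" for a
        using g(1)[OF that(1)] g(4)[OF that(1,2)] by simp
      then show ?thesis by auto
    qed
    have R': "finite R'" using R sub finite_subset by blast
    have "sum (count (proots q)) R + sum (count (proots q)) (g ` R')
        = sum (count (proots q)) (R \<union> g ` R')"
      using R R' disj by (simp add: sum.union_disjoint)
    also have "\<dots> \<le> size (filter_mset (\<lambda>x. x \<in> I) (proots q))"
      using R R' g(2) by (intro sum_count_le_size_filter) (auto simp: R_def)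
    finally have le: "sum (count (proots q)) R + sum (count (proots q)) (g ` R')
      \<le> size (filter_mset (\<lambda>x. x \<in> I) (proots q))" .
    have "card R' = (\<Sum>x\<in>g ` R'. 1)" using inj by (simp add: card_image)
    also have "\<dots> \<le> sum (count (proots q)) (g ` R')"
      using assms(3) g(3) by (intro sum_mono) (auto simp: Suc_le_eq order_gt_0_iff)
    finally have c1: "card R' \<le> sum (count (proots q)) (g ` R')" .
    have "(\<Sum>a\<in>R. order a p) \<le> (\<Sum>a\<in>R. count (proots q) a + 1)"
      using order assms(3) by (intro sum_mono) (auto simp: R_def)
    also have "\<dots> = sum (count (proots q)) R + card R"
      by (simp only: sum.distrib card_eq_sum)
    also have "card R = Suc (card R')"
      unfolding R'_def by (rule card.remove[OF R MaxR])
    finally show ?thesis using le c1 size_p by linarith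
  qed
qed

text \<open>The pole of \<open>p / x^(2n)\<close> at 0 forces a splitting of the interval: Rolle's
  theorem on the negative and on the positive part loses one root each, and at 0 the order of
  \<open>Q\<close> is at least that of \<open>p\<close>. The bound is one-sided; the reverse
  inequality comes later from the complementary half-line.\<close>

lemma count_roots_le_interlace:
  fixes p Q :: "real poly" and c :: real
  assumes "p \<noteq> 0" "Q \<noteq> 0" and c: "c \<noteq> 0"
    and Q: "Polynomial.smult c Q = [:0, 1:] * (of_nat (2 * n) * p - [:0, 1:] * pderiv p)"
    and I: "is_interval I"
  shows "size (filter_mset (\<lambda>x. x \<in> I) (proots p)) \<le> size (filter_mset (\<lambda>x. x \<in> I) (proots Q)) + 2"
proof -
  let ?N = "\<lambda>J r. size (filter_mset (\<lambda>x. x \<in> J) (proots (r :: real poly)))"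
  \<comment> \<open>Differentiation lowers the order of a root by at most one. Truncated subtraction
    covers the points that are not roots.\<close>
  have dvd: "[:- a, 1:] ^ (order a p - 1) dvd Polynomial.smult c Q" for a
  proof -
    let ?u = "[:- a, 1:]"
    have "?u ^ (order a p - 1) dvd p"
      by (rule dvd_trans[OF le_imp_power_dvd[OF diff_le_self] order_1])
    moreover have "?u ^ (order a p - 1) dvd pderiv p"
    proof (cases "pderiv p = 0 \<or> order a p = 0")
      case False
      then have "order a p = Suc (order a (pderiv p))" by (intro order_pderiv) (auto simp: order_root assms(1))
      then show ?thesis by (metis diff_Suc_1 order_1)
    qed auto
    ultimately show ?thesis unfolding Q by (intro dvd_mult dvd_diff)
  qed
  have part: "?N J p \<le> Suc (?N J Q)" if J: "is_interval J" "0 \<notin> J" for J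
  proof (rule rolle_count_roots[OF J(1) assms(1,2)])
    fix a assume "poly p a = 0"
    have "order a p - 1 \<le> order a (Polynomial.smult c Q)"
      using dvd[of a] assms(2) c by (subst (asm) order_divides) auto
    then show "order a p \<le> Suc (order a Q)" using c by (simp add: order_smult)
  next
    fix a b assume ab: "a \<in> J" "b \<in> J" "a < b" "poly p a = 0" "poly p b = 0"
    have nz: "x \<noteq> 0" if "x \<in> {a..b}" for x
      using mem_is_interval_1_I[OF J(1) ab(1,2), of x] that J(2) by auto
    define f where "f x = poly p x / x ^ (2 * n)" for x
    define f' where "f' x = (poly (pderiv p) x * x ^ (2 * n) - poly p x * (real (2 * n) * x ^ (2 * n - 1))) / (x ^ (2 * n) * x ^ (2 * n))" for x
    have der: "(f has_real_derivative f' x) (at x)" if "x \<in> {a..b}" for x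
      unfolding f_def[abs_def] f'_def using nz[OF that]
      by (auto intro!: derivative_eq_intros simp: power2_eq_square)
    have "\<exists>z. a < z \<and> z < b \<and> (f has_real_derivative 0) (at z)"
    proof (rule Rolle[OF ab(3)])
      show "f a = f b" by (simp add: f_def ab)
      show "continuous_on {a..b} f"
        using der by (intro continuous_at_imp_continuous_on ballI DERIV_isCont) blast
      show "f differentiable at x" if "a < x" "x < b" for x
        using der[of x] that real_differentiable_def by auto
    qed
    then obtain z where z: "a < z" "z < b" "(f has_real_derivative 0) (at z)" by blast
    have z0: "z \<noteq> 0" using nz[of z] z by simp
    have "f' z = 0" using DERIV_unique[OF der[of z] z(3)] z by simp
    then have e: "poly (pderiv p) z * z ^ (2 * n) = poly p z * (real (2 * n) * z ^ (2 * n - 1))"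
      using z0 by (simp add: f'_def)
    have "poly (Polynomial.smult c Q) z = 0"
    \<comment> \<open>The exponent \<open>2 * n - 1\<close> is truncated at \<open>n = 0\<close>, so
      this case is separate.\<close>
    proof (cases n)
      case 0
      then show ?thesis using e unfolding Q by simp
    next
      case (Suc k)
      have "z ^ (2 * n - 1) * (real (2 * n) * poly p z - z * poly (pderiv p) z) = 0"
        using e Suc by (simp add: algebra_simps)
      then show ?thesis using z0 unfolding Q by (simp add: poly_of_nat[symmetric] of_nat_poly)
    qed
    then show "\<exists>z. a < z \<and> z < b \<and> poly Q z = 0" using z c by auto
  qed
    have split: "?N I r = ?N (I \<inter> {..<0}) r + ?N (I \<inter> {0}) r + ?N (I \<inter> {0<..}) r" for r
    proof -
      have "filter_mset (\<lambda>x. x \<in> I) (proots r) = filter_mset (\<lambda>x. x \<in> I \<inter> {..<0}) (proots r)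
        + filter_mset (\<lambda>x. x \<in> I \<inter> {0}) (proots r) + filter_mset (\<lambda>x. x \<in> I \<inter> {0<..}) (proots r)"
        by (rule multiset_eqI) auto
      then show ?thesis by simp
    qed
    have z: "?N (I \<inter> {0}) r = (if 0 \<in> I then order 0 r else 0)" if "r \<noteq> 0" for r
    proof -
      have "filter_mset (\<lambda>x. x \<in> I \<inter> {0}) (proots r) = replicate_mset (if 0 \<in> I then order 0 r else 0) 0"
        using that by (intro multiset_eqI) auto
      then show ?thesis by simp
    qed
    \<comment> \<open>The factor X in front of \<open>pderiv p\<close> restores the order lost by
      differentiation, so nothing is lost at 0.\<close>
    have "[:- 0, 1:] ^ order 0 p dvd Polynomial.smult c Q"
    proof (cases "order 0 p")
      case (Suc r)
      have "[:- 0, 1:] ^ r dvd pderiv p"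
      proof (cases "pderiv p = 0")
        case False
        then have "order 0 p = Suc (order 0 (pderiv p))" using Suc by (intro order_pderiv) (auto simp: order_root assms(1))
        then show ?thesis by (metis Suc Suc_inject order_1)
      qed simp
      then have d: "[:- 0, 1:] ^ Suc r dvd [:0, 1:] * pderiv p"
        unfolding power_Suc by (intro mult_dvd_mono) simp_all
      have "[:- 0, 1:] ^ Suc r dvd p" using order_1[of 0 p] Suc by simp
      then show ?thesis unfolding Q Suc using d by (metis dvd_mult dvd_diff)
    qed simp
    then have "order 0 p \<le> order 0 Q"
      using assms(2) c by (subst (asm) order_divides) (auto simp: order_smult)
    then have "?N (I \<inter> {0}) p \<le> ?N (I \<inter> {0}) Q" unfolding z[OF assms(1)] z[OF assms(2)] by simp
    moreover have "?N (I \<inter> {..<0}) p \<le> Suc (?N (I \<inter> {..<0}) Q)"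
      using I by (intro part is_interval_Int) auto
    moreover have "?N (I \<inter> {0<..}) p \<le> Suc (?N (I \<inter> {0<..}) Q)"
      using I by (intro part is_interval_Int) auto
    ultimately show ?thesis unfolding split[of p] split[of Q] by linarith
qed

section \<open>Empirical spectral distributions\<close>

lemma proots_linear_factors: "proots (\<Prod>a\<leftarrow>as. [:- a, 1:]) = mset as"
  for as :: "'a :: idom list"
proof (induction as)
  case (Cons a as)
  have "(\<Prod>a\<leftarrow>as. [:- a, 1:]) \<noteq> 0" by (auto simp: prod_list_zero_iff)
  then have "proots ([:- a, 1:] * (\<Prod>a\<leftarrow>as. [:- a, 1:])) = proots [:- a, 1:] + proots (\<Prod>a\<leftarrow>as. [:- a, 1:])"
    by (intro proots_mult) auto
  then show ?case using Cons by (simp del: mult_pCons_left)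
qed simp

text \<open>\<open>S\<close> is the Hermitian form of the matrix at an eigenvector. Symmetry makes
  it real, while it also equals the eigenvalue \<open>z\<close> times a positive number.\<close>

lemma char_poly_symmetric_real_rooted:
  fixes A :: "real mat"
  assumes A: "A \<in> carrier_mat n n"
    and sym: "\<And>i j. i < n \<Longrightarrow> j < n \<Longrightarrow> A $$ (i, j) = A $$ (j, i)"
  obtains as where "char_poly A = (\<Prod>a\<leftarrow>as. [:- a, 1:])" "length as = n"
proof -
  interpret of_real_poly: map_poly_comm_ring_hom complex_of_real ..
  define B where "B = map_mat complex_of_real A"
  have B: "B \<in> carrier_mat n n" using A by (simp add: B_def)
  obtain zs where zs: "char_poly B = (\<Prod>z\<leftarrow>zs. [:- z, 1:])" "length zs = n"
    using char_poly_factorized[OF B] by blast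
  have real: "Im z = 0" if z: "z \<in> set zs" for z
  proof -
    have "poly (char_poly B) z = 0"
      using z by (auto simp: zs(1) poly_prod_list prod_list_zero_iff)
    then obtain v where v: "v \<in> carrier_vec n" "v \<noteq> 0\<^sub>v n" "B *\<^sub>v v = z \<cdot>\<^sub>v v"
      using B by (auto simp: eigenvalue_root_char_poly[OF B, symmetric] eigenvalue_def eigenvector_def)
    define V where "V i = vec_index v i" for i
    have Bv: "(\<Sum>j<n. complex_of_real (A $$ (i, j)) * V j) = z * V i" if i: "i < n" for i
    proof -
      have "vec_index (B *\<^sub>v v) i = (\<Sum>j<n. complex_of_real (A $$ (i, j)) * V j)"
        using i A v(1) by (simp add: B_def V_def scalar_prod_def lessThan_atLeast0)
      then show ?thesis using v i by (simp add: V_def)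
    qed
    define S where "S = (\<Sum>i<n. (\<Sum>j<n. complex_of_real (A $$ (i, j)) * V j) * cnj (V i))"
    have "cnj S = (\<Sum>i<n. \<Sum>j<n. complex_of_real (A $$ (i, j)) * cnj (V j) * V i)"
      by (simp add: S_def sum_distrib_right)
    also have "\<dots> = (\<Sum>j<n. \<Sum>i<n. complex_of_real (A $$ (i, j)) * cnj (V j) * V i)"
      by (rule sum.swap)
    also have "\<dots> = S"
      unfolding S_def sum_distrib_right by (intro sum.cong refl) (auto simp: sym mult_ac)
    finally have "Im S = 0" by (metis complex_cnj_cancel_iff complex_is_Real_iff Reals_cnj_iff)
    moreover have "S = z * complex_of_real (\<Sum>i<n. (cmod (V i))\<^sup>2)"
      by (simp add: S_def Bv sum_distrib_left mult.assoc complex_norm_square[symmetric])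
    moreover have "(\<Sum>i<n. (cmod (V i))\<^sup>2) \<noteq> 0"
    proof -
      obtain i where "i < n" "V i \<noteq> 0"
        using v(1,2) unfolding V_def by (metis carrier_vecD eq_vecI index_zero_vec(1) index_zero_vec(2))
      then show ?thesis by (subst sum_nonneg_eq_0_iff) auto
    qed
    ultimately show ?thesis by simp
  qed
  define as where "as = map Re zs"
  have zs_as: "zs = map complex_of_real as"
    unfolding as_def map_map by (rule map_idI[symmetric]) (simp add: real complex_eq_iff)
  have "map_poly complex_of_real (\<Prod>a\<leftarrow>as. [:- a, 1:]) = char_poly B"
    unfolding zs(1) zs_as by (induction as) (simp_all add: of_real_poly.hom_mult hom_distribs del: mult_pCons_left)
  also have "\<dots> = map_poly complex_of_real (char_poly A)"
    unfolding B_def by (rule of_real_hom.char_poly_hom[OF A])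
  finally have "char_poly A = (\<Prod>a\<leftarrow>as. [:- a, 1:])"
    by (simp add: poly_eq_iff coeff_map_poly)
  moreover have "length as = n" using zs(2) by (simp add: as_def)
  ultimately show ?thesis using that by blast
qed

section \<open>Measurability of eigenvalue counts\<close>

text \<open>Since \<open>\<bar>x - t - 1\<bar> \<ge> \<bar>x - t + 1\<bar>\<close> exactly when
  \<open>x \<le> t\<close>, one of the two powers dominates except for a tie at
  \<open>x = t\<close>. The factor \<open>m\<close> decides the tie in favour of the limit 1 and is
  too small to disturb the geometric decay for \<open>x > t\<close>.\<close>

lemma tendsto_rational_step:
  fixes t x :: real
  shows "(\<lambda>m. (real m * (x - t - 1) ^ (2 * m) + 2 * (x - t + 1) ^ (2 * m))
            / (real m * (x - t - 1) ^ (2 * m) + (x - t + 1) ^ (2 * m)))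
         \<longlonglongrightarrow> (if x \<le> t then 1 else 2)"
proof (cases "x \<le> t")
  case True
  define q where "q = ((x - t + 1) / (x - t - 1))\<^sup>2"
  have u: "x - t - 1 \<noteq> 0" using True by simp
  have "(x - t + 1)\<^sup>2 \<le> (x - t - 1)\<^sup>2" using True by (simp add: power2_eq_square algebra_simps)
  then have q: "0 \<le> q" "q \<le> 1" using u by (simp_all add: q_def power_divide divide_le_eq)
  have pow: "(x - t + 1) ^ (2 * m) = q ^ m * (x - t - 1) ^ (2 * m)" for m
    using u by (simp add: q_def power_divide power_mult[symmetric])
  have aux: "U \<noteq> 0 \<Longrightarrow> M + Q \<noteq> 0 \<Longrightarrow> (M * U + 2 * (Q * U)) / (M * U + Q * U) = 1 + Q / (M + Q)" for M Q U :: real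
    by (simp add: add_divide_distrib[symmetric] distrib_right[symmetric] mult.assoc[symmetric]) (simp add: field_simps)
  have eq: "(real m * (x - t - 1) ^ (2 * m) + 2 * (x - t + 1) ^ (2 * m))
            / (real m * (x - t - 1) ^ (2 * m) + (x - t + 1) ^ (2 * m)) = 1 + q ^ m / (real m + q ^ m)"
    if m: "m > 0" for m
  proof -
    have "real m + q ^ m > 0" using m q by (simp add: add_pos_nonneg)
    moreover have "(x - t - 1) ^ (2 * m) \<noteq> 0" using u by simp
    ultimately show ?thesis
      unfolding pow by (intro aux) auto
  qed
  have "(\<lambda>m. q ^ m / (real m + q ^ m)) \<longlonglongrightarrow> 0"
  proof (rule tendsto_sandwich)
    show "\<forall>\<^sub>F m in sequentially. 0 \<le> q ^ m / (real m + q ^ m)" using q by simp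
    show "\<forall>\<^sub>F m in sequentially. q ^ m / (real m + q ^ m) \<le> 1 / real m"
      using eventually_gt_at_top[of 0]
    proof eventually_elim
      case (elim m)
      have "q ^ m \<le> 1" using q by (simp add: power_le_one)
      then show ?case using elim q by (intro frac_le) auto
    qed
  qed (simp_all add: lim_1_over_n)
  then have "(\<lambda>m. 1 + q ^ m / (real m + q ^ m)) \<longlonglongrightarrow> 1 + 0" by (intro tendsto_intros)
  then show ?thesis using True
    by (subst tendsto_cong[OF eventually_mono[OF eventually_gt_at_top[of 0] eq]]) auto
next
  case False
  define q where "q = ((x - t - 1) / (x - t + 1))\<^sup>2"
  have v: "x - t + 1 > 0" using False by simp
  have "(x - t - 1)\<^sup>2 < (x - t + 1)\<^sup>2" using False by (simp add: power2_eq_square algebra_simps)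
  then have q: "0 \<le> q" "q < 1" using v by (simp_all add: q_def power_divide divide_less_eq)
  have pow: "(x - t - 1) ^ (2 * m) = q ^ m * (x - t + 1) ^ (2 * m)" for m
    using v by (simp add: q_def power_divide power_mult[symmetric])
  have eq: "(real m * (x - t - 1) ^ (2 * m) + 2 * (x - t + 1) ^ (2 * m))
            / (real m * (x - t - 1) ^ (2 * m) + (x - t + 1) ^ (2 * m)) = (real m * q ^ m + 2) / (real m * q ^ m + 1)" for m
  proof -
    have "real m * q ^ m + 1 > 0" using q by (simp add: add_nonneg_pos)
    moreover have "(x - t + 1) ^ (2 * m) \<noteq> 0" using v by simp
    ultimately show ?thesis
      unfolding pow mult.assoc[symmetric] using mult_divide_mult_cancel_right[of "(x - t + 1) ^ (2 * m)" "real m * q ^ m + 2" "real m * q ^ m + 1"]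
      by (simp add: distrib_right)
  qed
  have "(\<lambda>m. real m * q ^ m) \<longlonglongrightarrow> 0" using q by (intro powser_times_n_limit_0) simp
  then have "(\<lambda>m. (real m * q ^ m + 2) / (real m * q ^ m + 1)) \<longlonglongrightarrow> (0 + 2) / (0 + 1)"
    by (intro tendsto_intros) auto
  then show ?thesis using False unfolding eq by simp
qed

text \<open>The number of eigenvalues above \<open>t\<close> is the exponent of the limit of products
  \<open>\<Prod>\<^sub>i h\<^sub>m (\<mu>\<^sub>i)\<close> with rational \<open>h\<^sub>m\<close> tending to \<open>1\<close> on \<open>{..t}\<close> and to \<open>2\<close> elsewhere;
  such a product is a product of values of the characteristic polynomial at the complex
  roots of numerator and denominator.\<close>

lemma borel_measurable_empirical_spectral_distribution:
  fixes A :: "'a \<Rightarrow> real mat"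
  assumes A: "\<And>\<omega>. A \<omega> \<in> carrier_mat n n"
    and sym: "\<And>\<omega> i j. i < n \<Longrightarrow> j < n \<Longrightarrow> A \<omega> $$ (i, j) = A \<omega> $$ (j, i)"
    and meas: "\<And>i j. i < n \<Longrightarrow> j < n \<Longrightarrow> (\<lambda>\<omega>. A \<omega> $$ (i, j)) \<in> borel_measurable M"
  shows "(\<lambda>\<omega>. empirical_spectral_distribution (A \<omega>) t) \<in> borel_measurable M"
proof -
  interpret of_real_poly: map_poly_comm_ring_hom complex_of_real ..
  have "\<forall>\<omega>. \<exists>as. char_poly (A \<omega>) = (\<Prod>a\<leftarrow>as. [:- a, 1:]) \<and> length as = n"
    using char_poly_symmetric_real_rooted[OF A sym] by metis
  \<comment> \<open>The list of eigenvalues is chosen separately for each \<open>\<omega>\<close>,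
    without any measurability. Only symmetric functions of its entries are shown to be measurable
    below.\<close>
  then obtain as where as: "\<And>\<omega>. char_poly (A \<omega>) = (\<Prod>a\<leftarrow>as \<omega>. [:- a, 1:])" "\<And>\<omega>. length (as \<omega>) = n"
    by metis
  have chi: "(\<Prod>i<n. z - complex_of_real (as \<omega> ! i)) =
      Determinant.det (Matrix.mat n n (\<lambda>(i, j). (if i = j then z else 0) - complex_of_real (A \<omega> $$ (i, j))))" for z \<omega>
  proof -
    have "(\<Prod>i<n. z - complex_of_real (as \<omega> ! i)) = poly (map_poly complex_of_real (char_poly (A \<omega>))) z"
    proof -
      have "poly (map_poly complex_of_real (\<Prod>a\<leftarrow>l. [:- a, 1:])) z = (\<Prod>a\<leftarrow>l. z - complex_of_real a)" for l
        by (induction l) (simp_all add: of_real_poly.hom_mult del: mult_pCons_left)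
      note this[of "as \<omega>"]
      also have "(\<Prod>a\<leftarrow>as \<omega>. z - complex_of_real a) = (\<Prod>i<n. z - complex_of_real (as \<omega> ! i))"
        by (simp add: prod.list_conv_set_nth as(2) lessThan_atLeast0)
      finally show ?thesis unfolding as(1) by simp
    qed
    also have "\<dots> = poly (char_poly (map_mat complex_of_real (A \<omega>))) z"
      by (simp add: of_real_hom.char_poly_hom[OF A])
    also have "\<dots> = Determinant.det (- (char_matrix (map_mat complex_of_real (A \<omega>)) z))"
      by (rule char_poly_matrix[of _ n]) (use A in simp)
    also have "- (char_matrix (map_mat complex_of_real (A \<omega>)) z)
        = Matrix.mat n n (\<lambda>(i, j). (if i = j then z else 0) - complex_of_real (A \<omega> $$ (i, j)))"
      using A[of \<omega>] by (intro eq_matI) (auto simp: char_matrix_def)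
    finally show ?thesis .
  qed
  \<comment> \<open>By the Leibniz formula the determinant is a polynomial in the measurable
    entries.\<close>
  have chi_meas [measurable]: "(\<lambda>\<omega>. \<Prod>i<n. z - complex_of_real (as \<omega> ! i)) \<in> borel_measurable M" for z
  proof -
    have perm: "\<sigma> i < n" if "\<sigma> permutes {0..<n}" "i < n" for \<sigma> i
      using permutes_in_image[OF that(1), of i] that(2) by simp
    have "(\<lambda>\<omega>. \<Sum>\<sigma>\<in>{\<sigma>. \<sigma> permutes {0..<n}}. signof \<sigma> *
        (\<Prod>i=0..<n. (if i = \<sigma> i then z else 0) - complex_of_real (A \<omega> $$ (i, \<sigma> i)))) \<in> borel_measurable M"
    proof (intro borel_measurable_sum borel_measurable_times borel_measurable_const borel_measurable_prod borel_measurable_diff)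
      fix \<sigma> i assume "\<sigma> \<in> {\<sigma>. \<sigma> permutes {0..<n}}" "i \<in> {0..<n}"
      then show "(\<lambda>\<omega>. complex_of_real (A \<omega> $$ (i, \<sigma> i))) \<in> borel_measurable M"
        using meas[of i "\<sigma> i"] perm by simp
    qed
    also have "(\<lambda>\<omega>. \<Sum>\<sigma>\<in>{\<sigma>. \<sigma> permutes {0..<n}}. signof \<sigma> *
        (\<Prod>i=0..<n. (if i = \<sigma> i then z else 0) - complex_of_real (A \<omega> $$ (i, \<sigma> i))))
      = (\<lambda>\<omega>. \<Prod>i<n. z - complex_of_real (as \<omega> ! i))"
      unfolding chi
      by (subst Determinant.det_def', rule mat_carrier)
         (intro ext sum.cong prod.cong arg_cong2[of _ _ _ _ times] refl, simp add: perm)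
    finally show ?thesis .
  qed
  have prod_meas: "(\<lambda>\<omega>. \<Prod>i<n. poly Q (as \<omega> ! i)) \<in> borel_measurable M" for Q :: "real poly"
  proof -
    define Qc where "Qc = map_poly complex_of_real Q"
    obtain zs where "Polynomial.smult (lead_coeff Qc) (\<Prod>z\<leftarrow>zs. [:- z, 1:]) = Qc"
      using fundamental_theorem_algebra_factorized[of Qc] by blast
    then obtain c where c: "Qc = Polynomial.smult c (\<Prod>z\<leftarrow>zs. [:- z, 1:])" by metis
    have "complex_of_real (poly Q x) = c * (\<Prod>z\<leftarrow>zs. complex_of_real x - z)" for x
    proof -
      have "complex_of_real (poly Q x) = poly Qc (complex_of_real x)"
        by (simp add: Qc_def of_real_hom.poly_map_poly)
      also have "\<dots> = c * (\<Prod>z\<leftarrow>zs. complex_of_real x - z)"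
        unfolding c by (simp add: poly_prod_list o_def)
      finally show ?thesis .
    qed
    then have "complex_of_real (\<Prod>i<n. poly Q (as \<omega> ! i)) = (\<Prod>i<n. c * (\<Prod>z\<leftarrow>zs. complex_of_real (as \<omega> ! i) - z))" for \<omega>
      by simp
    also have "(\<Prod>i<n. c * (\<Prod>z\<leftarrow>zs. complex_of_real (as \<omega> ! i) - z))
        = c ^ n * (\<Prod>z\<leftarrow>zs. (-1) ^ n * (\<Prod>i<n. z - complex_of_real (as \<omega> ! i)))" for \<omega>
    proof -
      have "(\<Prod>i<n. (\<Prod>z\<leftarrow>zs. complex_of_real (as \<omega> ! i) - z))
        = (\<Prod>z\<leftarrow>zs. (-1) ^ n * (\<Prod>i<n. z - complex_of_real (as \<omega> ! i)))"
      proof (induction zs)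
        case (Cons z zs)
        have "(\<Prod>i<n. complex_of_real (as \<omega> ! i) - z) = (\<Prod>i<n. (-1) * (z - complex_of_real (as \<omega> ! i)))"
          by simp
        also have "\<dots> = (-1) ^ n * (\<Prod>i<n. z - complex_of_real (as \<omega> ! i))"
          by (subst prod.distrib) simp
        finally show ?case using Cons by (simp add: prod.distrib)
      qed simp
      then show ?thesis by (simp add: prod.distrib)
    qed
    finally have eq: "complex_of_real (\<Prod>i<n. poly Q (as \<omega> ! i))
        = c ^ n * (\<Prod>z\<leftarrow>zs. (-1) ^ n * (\<Prod>i<n. z - complex_of_real (as \<omega> ! i)))" for \<omega> .
    have "(\<lambda>\<omega>. \<Prod>z\<leftarrow>zs. (-1) ^ n * (\<Prod>i<n. z - complex_of_real (as \<omega> ! i))) \<in> borel_measurable M"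
      by (induction zs) (simp_all del: of_real_prod)
    then have "(\<lambda>\<omega>. Re (c ^ n * (\<Prod>z\<leftarrow>zs. (-1) ^ n * (\<Prod>i<n. z - complex_of_real (as \<omega> ! i))))) \<in> borel_measurable M"
      by simp
    then show ?thesis by (simp only: eq[symmetric] Re_complex_of_real)
  qed
  define u v where "u = [:- t - 1, 1:]" and "v = [:- t + 1, 1:]"
  define Q where "Q c m = Polynomial.smult (real m) (u ^ (2 * m)) + Polynomial.smult c (v ^ (2 * m))" for c m
  define L where "L m \<omega> = (\<Prod>i<n. poly (Q 2 m) (as \<omega> ! i)) / (\<Prod>i<n. poly (Q 1 m) (as \<omega> ! i))" for m \<omega>
  define l where "l \<omega> = (\<Prod>i<n. if as \<omega> ! i \<le> t then 1 else 2 :: real)" for \<omega>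
  have "(\<lambda>m. L m \<omega>) \<longlonglongrightarrow> l \<omega>" for \<omega>
    unfolding L_def l_def prod_dividef[symmetric]
  proof (rule tendsto_prod)
    fix i
    show "(\<lambda>m. poly (Q 2 m) (as \<omega> ! i) / poly (Q 1 m) (as \<omega> ! i)) \<longlonglongrightarrow> (if as \<omega> ! i \<le> t then 1 else 2)"
      using tendsto_rational_step[of "as \<omega> ! i" t] by (simp add: Q_def u_def v_def algebra_simps)
  qed
  moreover have "L m \<in> borel_measurable M" for m
    unfolding L_def[abs_def] using prod_meas by measurable
  ultimately have l_meas [measurable]: "l \<in> borel_measurable M"
    by (rule borel_measurable_LIMSEQ_real)
  have "empirical_spectral_distribution (A \<omega>) t = (real n - log 2 (l \<omega>)) / real n" for \<omega>
  proof -
    have "l \<omega> = (\<Prod>i\<in>{i. i < n \<and> \<not> as \<omega> ! i \<le> t}. 2)"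
      unfolding l_def by (rule prod.mono_neutral_cong_right) auto
    also have "\<dots> = 2 ^ card {i. i < n \<and> \<not> as \<omega> ! i \<le> t}" by simp
    finally have "log 2 (l \<omega>) = real (card {i. i < n \<and> \<not> as \<omega> ! i \<le> t})" by simp
    moreover have "card {i. i < n \<and> as \<omega> ! i \<le> t} + card {i. i < n \<and> \<not> as \<omega> ! i \<le> t} = n"
    proof -
      have "{i. i < n \<and> as \<omega> ! i \<le> t} \<union> {i. i < n \<and> \<not> as \<omega> ! i \<le> t} = {..<n}" by auto
      moreover have "card ({i. i < n \<and> as \<omega> ! i \<le> t} \<union> {i. i < n \<and> \<not> as \<omega> ! i \<le> t})
        = card {i. i < n \<and> as \<omega> ! i \<le> t} + card {i. i < n \<and> \<not> as \<omega> ! i \<le> t}"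
        by (rule card_Un_disjoint) auto
      ultimately show ?thesis by simp
    qed
    moreover have "size (filter_mset (\<lambda>\<mu>. \<mu> \<le> t) (proots (char_poly (A \<omega>)))) = card {i. i < n \<and> as \<omega> ! i \<le> t}"
      unfolding as(1) proots_linear_factors
      by (simp add: mset_filter[symmetric] length_filter_conv_card as(2) del: mset_filter)
    ultimately show ?thesis
      using A[of \<omega>] by (simp add: empirical_spectral_distribution_def carrier_matD)
  qed
  then show ?thesis by simp
qed

section \<open>Eigenvalue counts of the two ensembles\<close>

lemma smult_sym_circulant: "c \<cdot>\<^sub>m sym_circulant x n = sym_circulant (\<lambda>k. c * x k) n"
  by (rule eq_matI) (auto simp: sym_circulant_def Let_def)

lemma smult_palindromic_toeplitz:
  "c \<cdot>\<^sub>m palindromic_toeplitz b n = palindromic_toeplitz (\<lambda>k. c * b k) n"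
  by (rule eq_matI) (auto simp: palindromic_toeplitz_def Let_def)

lemma circ_eig_scale: "circ_eig (\<lambda>k. c * x k) n k = c * circ_eig x n k"
  by (simp add: circ_eig_def sum_distrib_left mult.assoc)

lemma symmetric_toeplitz_eq_circulant: "symmetric_toeplitz x n = sym_circulant (\<lambda>k. 1 / sqrt (real n) * x k) n"
  unfolding smult_sym_circulant[symmetric] by (simp add: symmetric_toeplitz_def sym_circulant_def)

lemma size_filter_proots_sym_circulant:
  assumes "n > 0"
  shows "size (filter_mset P (proots (char_poly (sym_circulant x n)))) = card {k. k < n \<and> P (circ_eig x n k)}"
proof -
  have "char_poly (sym_circulant x n) = (\<Prod>a\<leftarrow>map (circ_eig x n) [0..<n]. [:- a, 1:])"
    unfolding char_poly_sym_circulant[OF assms]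
    by (simp only: map_map interv_sum_list_conv_sum_set_nat[symmetric] prod.distinct_set_conv_list[symmetric, OF distinct_upt] set_upt lessThan_atLeast0 o_def)
  then have "proots (char_poly (sym_circulant x n)) = mset (map (circ_eig x n) [0..<n])"
    by (simp only: proots_linear_factors)
  then have "size (filter_mset P (proots (char_poly (sym_circulant x n)))) = length (filter P (map (circ_eig x n) [0..<n]))"
    by (simp only: mset_filter[symmetric] size_mset)
  also have "\<dots> = card {k. k < n \<and> P (circ_eig x n k)}"
    unfolding length_filter_conv_card by (intro arg_cong[of _ _ card]) auto
  finally show ?thesis .
qed

text \<open>The root count comparison on \<open>{..t}\<close> gives one inequality with error 2. On
  \<open>{t<..}\<close> it gives the other one by taking complements, where the larger size
  \<open>Suc n\<close> of the palindromic matrix turns 2 into 3.\<close>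

lemma size_filter_proots_palindromic:
  assumes n: "n > 0"
  shows "\<bar>real (size (filter_mset (\<lambda>\<mu>. \<mu> \<le> t) (proots (char_poly (palindromic_toeplitz b (Suc n))))))
    - real (card {k. k < n \<and> circ_eig b n k \<le> t})\<bar> \<le> 3"
proof -
  let ?p = "char_poly (sym_circulant b n)" and ?Q = "char_poly (palindromic_toeplitz b (Suc n))"
  let ?N = "\<lambda>P r. size (filter_mset P (proots (r :: real poly)))"
  have Q: "degree ?Q = Suc n" "coeff ?Q (Suc n) = 1"
    using degree_monic_char_poly[of "palindromic_toeplitz b (Suc n)" "Suc n"]
    by (auto simp: palindromic_toeplitz_def)
  have p: "degree ?p = n" "coeff ?p n = 1"
    using degree_monic_char_poly[of "sym_circulant b n" n] by auto
  have nz: "?p \<noteq> 0" "?Q \<noteq> 0" using p(2) Q(2) by auto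
  have rel: "Polynomial.smult (real n) ?Q = [:0, 1:] * (of_nat (2 * n) * ?p - [:0, 1:] * pderiv ?p)"
  proof -
    have "Polynomial.smult (real n) ?Q = of_nat n * ?Q" by (simp add: of_nat_poly)
    also have "\<dots> = [:0, 1:] * (2 * of_nat n * ?p - [:0, 1:] * pderiv ?p)"
      by (rule char_poly_palindromic[OF n])
    also have "2 * of_nat n = (of_nat (2 * n) :: real poly)" by simp
    finally show ?thesis .
  qed
  have split: "?N (\<lambda>x. x \<le> t) r + ?N (\<lambda>x. t < x) r = size (proots r)" for r
  proof -
    have "proots r = filter_mset (\<lambda>x. x \<le> t) (proots r) + filter_mset (\<lambda>x. t < x) (proots r)"
      by (rule multiset_eqI) auto
    from arg_cong[OF this, of size] show ?thesis by simp
  qed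
  have "?N (\<lambda>x. x \<in> {..t}) ?p \<le> ?N (\<lambda>x. x \<in> {..t}) ?Q + 2"
    using nz n by (intro count_roots_le_interlace[OF _ _ _ rel]) (auto simp: is_interval_ic)
  then have le: "?N (\<lambda>x. x \<le> t) ?p \<le> ?N (\<lambda>x. x \<le> t) ?Q + 2" by simp
  have "?N (\<lambda>x. x \<in> {t<..}) ?p \<le> ?N (\<lambda>x. x \<in> {t<..}) ?Q + 2"
    using nz n by (intro count_roots_le_interlace[OF _ _ _ rel]) (auto simp: is_interval_oi)
  then have gr: "?N (\<lambda>x. t < x) ?p \<le> ?N (\<lambda>x. t < x) ?Q + 2" by simp
  have "size (proots ?Q) \<le> Suc n" using size_proots_le[of ?Q] Q by simp
  moreover have "size (proots ?p) = n"
    using size_filter_proots_sym_circulant[OF n, of "\<lambda>_. True" b] by simp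
  moreover have "?N (\<lambda>x. x \<le> t) ?p = card {k. k < n \<and> circ_eig b n k \<le> t}"
    by (rule size_filter_proots_sym_circulant[OF n])
  ultimately show ?thesis using le gr split[of ?p] split[of ?Q] by linarith
qed

section \<open>The Efron-Stein inequality\<close>

lemma (in prob_space) integrable_bounded:
  fixes g :: "'a \<Rightarrow> real"
  assumes "g \<in> borel_measurable M" "\<And>x. \<bar>g x\<bar> \<le> B"
  shows "integrable M g"
  using assms by (intro integrable_const_bound[of _ B]) auto

lemma (in prob_space) abs_integral_le_bound:
  fixes g :: "'a \<Rightarrow> real"
  assumes "g \<in> borel_measurable M" "\<And>x. \<bar>g x\<bar> \<le> B"
  shows "\<bar>\<integral>x. g x \<partial>M\<bar> \<le> B"
proof -
  have "\<bar>\<integral>x. g x \<partial>M\<bar> \<le> (\<integral>x. \<bar>g x\<bar> \<partial>M)" by (rule integral_abs_bound)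
  also have "\<dots> \<le> (\<integral>x. B \<partial>M)"
    using assms by (intro integral_mono integrable_abs integrable_bounded[of _ B] integrable_const) auto
  finally show ?thesis by (simp add: prob_space)
qed

lemma (in prob_space) square_integral_le:
  fixes g :: "'a \<Rightarrow> real"
  assumes "g \<in> borel_measurable M" "\<And>x. \<bar>g x\<bar> \<le> B"
  shows "(\<integral>x. g x \<partial>M)\<^sup>2 \<le> (\<integral>x. (g x)\<^sup>2 \<partial>M)"
proof -
  have "\<bar>(g x)\<^sup>2\<bar> \<le> B\<^sup>2" for x using power_mono[OF assms(2)[of x], of 2] by simp
  then have "integrable M (\<lambda>x. (g x)\<^sup>2)" using assms(1) by (intro integrable_bounded) auto
  then have "variance g = (\<integral>x. (g x)\<^sup>2 \<partial>M) - (\<integral>x. g x \<partial>M)\<^sup>2"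
    using integrable_bounded[OF assms] by (intro variance_eq)
  then show ?thesis using variance_positive[of g] by simp
qed

lemma (in prob_space) integral_square_diff:
  fixes g :: "'a \<Rightarrow> real"
  assumes "g \<in> borel_measurable M" "\<And>x. \<bar>g x\<bar> \<le> B"
  shows "(\<integral>y. \<integral>z. (g y - g z)\<^sup>2 \<partial>M \<partial>M) = 2 * ((\<integral>x. (g x)\<^sup>2 \<partial>M) - (\<integral>x. g x \<partial>M)\<^sup>2)"
proof -
  have "\<bar>(g x)\<^sup>2\<bar> \<le> B\<^sup>2" for x using power_mono[OF assms(2)[of x], of 2] by simp
  then have i2 [simp]: "integrable M (\<lambda>x. (g x)\<^sup>2)" using assms(1) by (intro integrable_bounded) auto
  have i1 [simp]: "integrable M g" using integrable_bounded[OF assms] .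
  have "(\<integral>z. (g y - g z)\<^sup>2 \<partial>M) = (g y)\<^sup>2 - 2 * g y * (\<integral>z. g z \<partial>M) + (\<integral>z. (g z)\<^sup>2 \<partial>M)" for y
  proof -
    have "(\<integral>z. (g y - g z)\<^sup>2 \<partial>M) = (\<integral>z. (g y)\<^sup>2 - 2 * g y * g z + (g z)\<^sup>2 \<partial>M)"
      by (simp add: power2_eq_square algebra_simps)
    then show ?thesis by (simp add: prob_space)
  qed
  then have "(\<integral>y. \<integral>z. (g y - g z)\<^sup>2 \<partial>M \<partial>M)
      = (\<integral>y. (g y)\<^sup>2 - 2 * (\<integral>z. g z \<partial>M) * g y + (\<integral>z. (g z)\<^sup>2 \<partial>M) \<partial>M)"
    by (simp add: mult_ac)
  also have "\<dots> = 2 * ((\<integral>x. (g x)\<^sup>2 \<partial>M) - (\<integral>x. g x \<partial>M)\<^sup>2)"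
    using i1 i2 by (simp add: prob_space) (simp add: power2_eq_square)
  finally show ?thesis .
qed

lemma abs_square_diff_le:
  fixes a b :: real
  assumes "\<bar>a\<bar> \<le> B" "\<bar>b\<bar> \<le> B"
  shows "\<bar>(a - b)\<^sup>2\<bar> \<le> (2 * B)\<^sup>2"
proof -
  have "\<bar>a - b\<bar> \<le> 2 * B" using assms by linarith
  then show ?thesis using power_mono[of "\<bar>a - b\<bar>" "2 * B" 2] by simp
qed

text \<open>Induction by the decomposition of total variance. The mean conditional variance given
  the old coordinates is half the resampling term of the new coordinate \<open>i\<close>. The
  variance of the conditional mean \<open>m\<close> falls under the induction hypothesis, and
  Jensen's inequality bounds the resampling terms of \<open>m\<close> by those of \<open>f\<close>.
  The bound on \<open>f\<close> is assumed at every point so that \<open>m\<close> inherits it in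
  the same form.\<close>

lemma efron_stein:
  fixes f :: "('i \<Rightarrow> 'b) \<Rightarrow> real"
  assumes "prob_space p" "finite I"
    and f: "f \<in> borel_measurable (Pi\<^sub>M I (\<lambda>_. p))" "\<And>x. \<bar>f x\<bar> \<le> B"
  shows "(\<integral>x. (f x)\<^sup>2 \<partial>Pi\<^sub>M I (\<lambda>_. p)) - (\<integral>x. f x \<partial>Pi\<^sub>M I (\<lambda>_. p))\<^sup>2
    \<le> (\<Sum>j\<in>I. \<integral>x. \<integral>y. (f x - f (x(j := y)))\<^sup>2 \<partial>p \<partial>Pi\<^sub>M I (\<lambda>_. p)) / 2"
  using assms(2) f
proof (induction I arbitrary: f rule: finite_induct)
  case empty
  interpret p: prob_space p by fact
  interpret product_prob_space "\<lambda>_. p" by standard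
  show ?case by (simp add: PiM_empty lebesgue_integral_count_space_finite)
next
  case (insert i I)
  interpret p: prob_space p by fact
  interpret product_prob_space "\<lambda>_. p" by standard
  define P where "P = Pi\<^sub>M I (\<lambda>_. p)"
  define P' where "P' = Pi\<^sub>M (insert i I) (\<lambda>_. p)"
  interpret K: prob_space P unfolding P_def by (rule prob_space_PiM) (rule p.prob_space_axioms)
  interpret K': prob_space P' unfolding P'_def by (rule prob_space_PiM) (rule p.prob_space_axioms)
  interpret pp: pair_prob_space p p ..
  have f_meas [measurable]: "f \<in> borel_measurable P'" using insert.prems by (simp add: P'_def)
  have f_bd: "\<bar>f x\<bar> \<le> B" for x by fact
  \<comment> \<open>Coordinate updates come in three kinds: within the old index set, within the new
    one, and from the old to the new.\<close>
  have upd [measurable (raw)]: "(\<lambda>w. (g w)(j := h w)) \<in> measurable N P"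
    if "g \<in> measurable N P" "h \<in> measurable N p" "j \<in> I" for g h j and N :: "'c measure"
    using that unfolding P_def by (intro measurable_fun_upd[of I I]) auto
  have upd' [measurable (raw)]: "(\<lambda>w. (g w)(j := h w)) \<in> measurable N P'"
    if "g \<in> measurable N P'" "h \<in> measurable N p" "j \<in> insert i I" for g h j and N :: "'c measure"
    using that unfolding P'_def by (intro measurable_fun_upd[of "insert i I" "insert i I"]) auto
  have ins [measurable (raw)]: "(\<lambda>w. (g w)(i := h w)) \<in> measurable N P'"
    if "g \<in> measurable N P" "h \<in> measurable N p" for g h and N :: "'c measure"
    using that unfolding P_def P'_def by (intro measurable_fun_upd[of "insert i I" I]) auto
  have fold: "(\<integral>z. g z \<partial>P') = (\<integral>x. \<integral>y. g (x(i := y)) \<partial>p \<partial>P)"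
    if "g \<in> borel_measurable P'" "\<And>z. \<bar>g z\<bar> \<le> C" for g :: "_ \<Rightarrow> real" and C
    using product_integral_insert[OF insert.hyps(1,2), of g] K'.integrable_bounded[OF that]
    by (simp add: P_def P'_def)
  define F where "F x y = f (x(i := y))" for x y
  define m where "m x = (\<integral>y. F x y \<partial>p)" for x
  have F_meas [measurable (raw)]: "(\<lambda>w. F (g w) (h w)) \<in> borel_measurable N"
    if "g \<in> measurable N P" "h \<in> measurable N p" for g h and N :: "'c measure"
    unfolding F_def using measurable_compose[OF ins[OF that] f_meas] .
  have F_bd: "\<bar>F x y\<bar> \<le> B" for x y by (simp add: F_def f_bd)
  have Fx_meas [measurable]: "F x \<in> borel_measurable p" if "x \<in> space P" for x
    using that by (intro F_meas) auto
  have m_meas [measurable]: "m \<in> borel_measurable P" unfolding m_def[abs_def] by measurable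
  \<comment> \<open>Outside the space of \<open>P\<close> a section of \<open>f\<close> may fail to
    be measurable; its integral is then 0 by convention, so the bound holds at every
    \<open>x\<close>.\<close>
  have m_bd: "\<bar>m x\<bar> \<le> B" for x
  proof (cases "F x \<in> borel_measurable p")
    case True
    then show ?thesis unfolding m_def using F_bd by (rule p.abs_integral_le_bound)
  next
    case False
    then have "m x = 0" unfolding m_def using borel_measurable_integrable not_integrable_integral_eq by blast
    then show ?thesis using F_bd[of x undefined] by simp
  qed
  have sq_bd: "\<bar>(f z)\<^sup>2\<bar> \<le> B\<^sup>2" for z using power_mono[OF f_bd[of z], of 2] by simp
  have F2_bd: "\<bar>(F x y)\<^sup>2\<bar> \<le> B\<^sup>2" for x y by (simp only: F_def sq_bd)
  have m2_bd: "\<bar>(m x)\<^sup>2\<bar> \<le> B\<^sup>2" for x using power_mono[OF m_bd[of x], of 2] by simp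
  have ind_bd: "\<bar>\<integral>y. g y \<partial>p\<bar> \<le> C" if "\<And>y. \<bar>g y\<bar> \<le> C" for g and C :: real
  proof (cases "g \<in> borel_measurable p")
    case True
    then show ?thesis using that by (rule p.abs_integral_le_bound)
  next
    case False
    then have "(\<integral>y. g y \<partial>p) = 0" using borel_measurable_integrable not_integrable_integral_eq by blast
    then show ?thesis using that[of undefined] by simp
  qed
  have term_i: "(\<integral>z. \<integral>y. (f z - f (z(i := y)))\<^sup>2 \<partial>p \<partial>P')
      = 2 * (\<integral>x. (\<integral>y. (F x y)\<^sup>2 \<partial>p) - (m x)\<^sup>2 \<partial>P)"
  proof -
    have "(\<integral>z. \<integral>y. (f z - f (z(i := y)))\<^sup>2 \<partial>p \<partial>P') = (\<integral>x. \<integral>y. \<integral>y'. (F x y - F x y')\<^sup>2 \<partial>p \<partial>p \<partial>P)"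
    proof -
      have "(\<lambda>z. \<integral>y. (f z - f (z(i := y)))\<^sup>2 \<partial>p) \<in> borel_measurable P'" by measurable
      moreover have "\<bar>\<integral>y. (f z - f (z(i := y)))\<^sup>2 \<partial>p\<bar> \<le> (2 * B)\<^sup>2" for z
        using f_bd by (intro ind_bd abs_square_diff_le)
      ultimately show ?thesis by (subst fold) (auto simp: F_def)
    qed
    also have "\<dots> = (\<integral>x. 2 * ((\<integral>y. (F x y)\<^sup>2 \<partial>p) - (m x)\<^sup>2) \<partial>P)"
      unfolding m_def using F_bd by (intro Bochner_Integration.integral_cong refl p.integral_square_diff) auto
    also have "\<dots> = 2 * (\<integral>x. (\<integral>y. (F x y)\<^sup>2 \<partial>p) - (m x)\<^sup>2 \<partial>P)"
      by (rule integral_mult_right_zero)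
    finally show ?thesis .
  qed
  \<comment> \<open>Fubini's theorem moves the integral over coordinate \<open>i\<close> innermost,
    where Jensen's inequality for the square applies.\<close>
  have term_j: "(\<integral>x. \<integral>z. (m x - m (x(j := z)))\<^sup>2 \<partial>p \<partial>P) \<le> (\<integral>z. \<integral>y. (f z - f (z(j := y)))\<^sup>2 \<partial>p \<partial>P')"
    if j: "j \<in> I" for j
  proof -
    have ij: "i \<noteq> j" using j insert.hyps(2) by auto
    have [measurable]: "j \<in> insert i I" "j \<in> I" using j by auto
    define G where "G x y z = (F x y - F (x(j := z)) y)\<^sup>2" for x y z
    have G_bd: "\<bar>G x y z\<bar> \<le> (2 * B)\<^sup>2" for x y z
      unfolding G_def using F_bd by (intro abs_square_diff_le)
    have "(\<integral>z. \<integral>y. (f z - f (z(j := y)))\<^sup>2 \<partial>p \<partial>P') = (\<integral>x. \<integral>y. \<integral>z. G x y z \<partial>p \<partial>p \<partial>P)"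
    proof -
      have "(\<lambda>z. \<integral>y. (f z - f (z(j := y)))\<^sup>2 \<partial>p) \<in> borel_measurable P'" by measurable
      moreover have "\<bar>\<integral>y. (f z - f (z(j := y)))\<^sup>2 \<partial>p\<bar> \<le> (2 * B)\<^sup>2" for z
        using f_bd by (intro ind_bd abs_square_diff_le)
      ultimately show ?thesis by (subst fold) (auto simp: F_def G_def[abs_def] fun_upd_twist[OF ij])
    qed
    also have "\<dots> = (\<integral>x. \<integral>z. \<integral>y. G x y z \<partial>p \<partial>p \<partial>P)"
    proof (rule Bochner_Integration.integral_cong[OF refl])
      fix x assume x [measurable]: "x \<in> space P"
      have "(\<lambda>(y, z). G x y z) \<in> borel_measurable (p \<Otimes>\<^sub>M p)"
        unfolding G_def by measurable
      then have "integrable (p \<Otimes>\<^sub>M p) (\<lambda>(y, z). G x y z)"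
        using G_bd by (intro pp.integrable_bounded[of _ "(2 * B)\<^sup>2"]) auto
      then show "(\<integral>y. \<integral>z. G x y z \<partial>p \<partial>p) = (\<integral>z. \<integral>y. G x y z \<partial>p \<partial>p)"
        by (rule pp.Fubini_integral[symmetric])
    qed
    finally have eq: "(\<integral>z. \<integral>y. (f z - f (z(j := y)))\<^sup>2 \<partial>p \<partial>P') = (\<integral>x. \<integral>z. \<integral>y. G x y z \<partial>p \<partial>p \<partial>P)" .
    have jensen: "(m x - m (x(j := z)))\<^sup>2 \<le> (\<integral>y. G x y z \<partial>p)" if x: "x \<in> space P" and z: "z \<in> space p" for x z
    proof -
      have xz: "x(j := z) \<in> space P"
        using x z j by (auto simp: P_def space_PiM PiE_iff extensional_def)
      have "m x - m (x(j := z)) = (\<integral>y. F x y - F (x(j := z)) y \<partial>p)"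
        unfolding m_def using x xz F_bd
        by (intro Bochner_Integration.integral_diff[symmetric] p.integrable_bounded[of _ B]) auto
      moreover have "\<bar>F x y - F (x(j := z)) y\<bar> \<le> 2 * B" for y
        using F_bd[of x y] F_bd[of "x(j := z)" y] by linarith
      ultimately show ?thesis
        unfolding G_def using x xz by (simp only:) (intro p.square_integral_le[of _ "2 * B"]; measurable)
    qed
    show ?thesis unfolding eq
    proof (rule integral_mono)
      have "(\<lambda>x. \<integral>z. (m x - m (x(j := z)))\<^sup>2 \<partial>p) \<in> borel_measurable P" by measurable
      then show "integrable P (\<lambda>x. \<integral>z. (m x - m (x(j := z)))\<^sup>2 \<partial>p)"
        using m_bd by (intro K.integrable_bounded[of _ "(2 * B)\<^sup>2"] ind_bd abs_square_diff_le)
      have "(\<lambda>x. \<integral>z. \<integral>y. G x y z \<partial>p \<partial>p) \<in> borel_measurable P" unfolding G_def by measurable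
      then show "integrable P (\<lambda>x. \<integral>z. \<integral>y. G x y z \<partial>p \<partial>p)"
        using G_bd by (intro K.integrable_bounded[of _ "(2 * B)\<^sup>2"] ind_bd)
      fix x assume x [measurable]: "x \<in> space P"
      show "(\<integral>z. (m x - m (x(j := z)))\<^sup>2 \<partial>p) \<le> (\<integral>z. \<integral>y. G x y z \<partial>p \<partial>p)"
      proof (rule integral_mono)
        have "(\<lambda>z. (m x - m (x(j := z)))\<^sup>2) \<in> borel_measurable p" by measurable
        then show "integrable p (\<lambda>z. (m x - m (x(j := z)))\<^sup>2)"
          using m_bd by (intro p.integrable_bounded[of _ "(2 * B)\<^sup>2"] abs_square_diff_le)
        have "(\<lambda>z. \<integral>y. G x y z \<partial>p) \<in> borel_measurable p" unfolding G_def by measurable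
        then show "integrable p (\<lambda>z. \<integral>y. G x y z \<partial>p)"
          using G_bd by (intro p.integrable_bounded[of _ "(2 * B)\<^sup>2"] ind_bd)
      qed (rule jensen[OF x])
    qed
  qed
  have IH: "(\<integral>x. (m x)\<^sup>2 \<partial>P) - (\<integral>x. m x \<partial>P)\<^sup>2 \<le> (\<Sum>j\<in>I. \<integral>x. \<integral>z. (m x - m (x(j := z)))\<^sup>2 \<partial>p \<partial>P) / 2"
    unfolding P_def using m_meas m_bd by (intro insert.IH) (auto simp: P_def)
  have "(\<lambda>x. \<integral>y. (F x y)\<^sup>2 \<partial>p) \<in> borel_measurable P" by measurable
  then have intF2: "integrable P (\<lambda>x. \<integral>y. (F x y)\<^sup>2 \<partial>p)"
    using F2_bd by (intro K.integrable_bounded[of _ "B\<^sup>2"] ind_bd)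
  have intm2: "integrable P (\<lambda>x. (m x)\<^sup>2)"
    using m2_bd by (intro K.integrable_bounded[of _ "B\<^sup>2"]) auto
  have "(\<integral>z. (f z)\<^sup>2 \<partial>P') = (\<integral>x. \<integral>y. (F x y)\<^sup>2 \<partial>p \<partial>P)"
    unfolding F_def using sq_bd by (intro fold[of _ "B\<^sup>2"]) auto
  moreover have "(\<integral>z. f z \<partial>P') = (\<integral>x. m x \<partial>P)"
    unfolding m_def F_def using f_bd by (intro fold[of _ B]) auto
  ultimately have "(\<integral>z. (f z)\<^sup>2 \<partial>P') - (\<integral>z. f z \<partial>P')\<^sup>2
      = (\<integral>x. (\<integral>y. (F x y)\<^sup>2 \<partial>p) - (m x)\<^sup>2 \<partial>P) + ((\<integral>x. (m x)\<^sup>2 \<partial>P) - (\<integral>x. m x \<partial>P)\<^sup>2)"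
    using intF2 intm2 by simp
  also have "\<dots> \<le> (\<integral>z. \<integral>y. (f z - f (z(i := y)))\<^sup>2 \<partial>p \<partial>P') / 2
      + (\<Sum>j\<in>I. \<integral>x. \<integral>z. (m x - m (x(j := z)))\<^sup>2 \<partial>p \<partial>P) / 2"
    using IH term_i by simp
  also have "\<dots> \<le> (\<integral>z. \<integral>y. (f z - f (z(i := y)))\<^sup>2 \<partial>p \<partial>P') / 2
      + (\<Sum>j\<in>I. \<integral>z. \<integral>y. (f z - f (z(j := y)))\<^sup>2 \<partial>p \<partial>P') / 2"
    using term_j by (intro add_left_mono divide_right_mono sum_mono) auto
  also have "\<dots> = (\<Sum>j\<in>insert i I. \<integral>z. \<integral>y. (f z - f (z(j := y)))\<^sup>2 \<partial>p \<partial>P') / 2"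
    using insert.hyps by (simp add: add_divide_distrib)
  finally show ?case by (simp only: P'_def)
qed

text \<open>The resampled value becomes the second component of a product space, so that bounds on
  increments can be integrated in one step. The fourth moment bound is the Efron-Stein inequality
  for the square of \<open>f\<close>.\<close>

lemma
  fixes f :: "('i \<Rightarrow> 'b) \<Rightarrow> real"
  assumes "prob_space p" "finite I"
    and f: "f \<in> borel_measurable (Pi\<^sub>M I (\<lambda>_. p))" "\<And>x. \<bar>f x\<bar> \<le> B"
  defines "P \<equiv> Pi\<^sub>M I (\<lambda>_. p)"
  defines "\<Delta> j w \<equiv> f (fst w) - f ((fst w)(j := snd w))"
  shows measurable_resample: "j \<in> I \<Longrightarrow> \<Delta> j \<in> borel_measurable (P \<Otimes>\<^sub>M p)"
    and efron_stein_pair: "(\<integral>x. (f x)\<^sup>2 \<partial>P) - (\<integral>x. f x \<partial>P)\<^sup>2 \<le> (\<Sum>j\<in>I. \<integral>w. (\<Delta> j w)\<^sup>2 \<partial>(P \<Otimes>\<^sub>M p)) / 2"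
    and efron_stein_fourth: "(\<integral>x. (f x) ^ 4 \<partial>P) \<le> (\<integral>x. (f x)\<^sup>2 \<partial>P)\<^sup>2
      + (\<Sum>j\<in>I. \<integral>w. 4 * (f (fst w))\<^sup>2 * (\<Delta> j w)\<^sup>2 + (\<Delta> j w) ^ 4 \<partial>(P \<Otimes>\<^sub>M p))"
proof -
  interpret p: prob_space p by fact
  interpret K: prob_space P unfolding P_def by (rule prob_space_PiM) (rule p.prob_space_axioms)
  interpret Kp: pair_prob_space P p ..
  have f_meas [measurable]: "f \<in> borel_measurable P" using f by (simp add: P_def)
  have upd [measurable]: "(\<lambda>w. (fst w)(j := snd w)) \<in> measurable (P \<Otimes>\<^sub>M p) P" if "j \<in> I" for j
    using that unfolding P_def by (intro measurable_fun_upd[of I I]) auto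
  have meas: "\<Delta> j \<in> borel_measurable (P \<Otimes>\<^sub>M p)" if [measurable]: "j \<in> I" for j
    unfolding \<Delta>_def by measurable
  then show "j \<in> I \<Longrightarrow> \<Delta> j \<in> borel_measurable (P \<Otimes>\<^sub>M p)" .
  have es: "(\<integral>x. (g x)\<^sup>2 \<partial>P) - (\<integral>x. g x \<partial>P)\<^sup>2 \<le> (\<Sum>j\<in>I. \<integral>w. (g (fst w) - g ((fst w)(j := snd w)))\<^sup>2 \<partial>(P \<Otimes>\<^sub>M p)) / 2"
    if g [measurable]: "g \<in> borel_measurable P" and bd: "\<And>x. \<bar>g x\<bar> \<le> C" for g :: "('i \<Rightarrow> 'b) \<Rightarrow> real" and C
  proof -
    have "(\<integral>x. \<integral>y. (g x - g (x(j := y)))\<^sup>2 \<partial>p \<partial>P) = (\<integral>w. (g (fst w) - g ((fst w)(j := snd w)))\<^sup>2 \<partial>(P \<Otimes>\<^sub>M p))"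
      if [measurable]: "j \<in> I" for j
    proof -
      have "(\<lambda>w. g ((fst w)(j := snd w))) \<in> borel_measurable (P \<Otimes>\<^sub>M p)"
        by (rule measurable_compose[OF upd[OF that] g])
      then have "(\<lambda>w. (g (fst w) - g ((fst w)(j := snd w)))\<^sup>2) \<in> borel_measurable (P \<Otimes>\<^sub>M p)"
        using measurable_compose[OF measurable_fst[of P p] g]
        by (auto intro!: borel_measurable_power borel_measurable_diff)
      then have "integrable (P \<Otimes>\<^sub>M p) (\<lambda>w. (g (fst w) - g ((fst w)(j := snd w)))\<^sup>2)"
        using bd by (intro Kp.integrable_bounded[of _ "(2 * C)\<^sup>2"] abs_square_diff_le)
      from Kp.integral_fst'[OF this] show ?thesis by simp
    qed
    then show ?thesis
      using efron_stein[OF assms(1,2), of g C] that by (simp add: P_def)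
  qed
  show "(\<integral>x. (f x)\<^sup>2 \<partial>P) - (\<integral>x. f x \<partial>P)\<^sup>2 \<le> (\<Sum>j\<in>I. \<integral>w. (\<Delta> j w)\<^sup>2 \<partial>(P \<Otimes>\<^sub>M p)) / 2"
    unfolding \<Delta>_def using f(2) by (intro es) auto
  have "\<bar>(f x)\<^sup>2\<bar> \<le> B\<^sup>2" for x using power_mono[OF f(2)[of x], of 2] by simp
  then have "(\<integral>x. ((f x)\<^sup>2)\<^sup>2 \<partial>P) - (\<integral>x. (f x)\<^sup>2 \<partial>P)\<^sup>2
      \<le> (\<Sum>j\<in>I. \<integral>w. ((f (fst w))\<^sup>2 - (f ((fst w)(j := snd w)))\<^sup>2)\<^sup>2 \<partial>(P \<Otimes>\<^sub>M p)) / 2"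
    by (intro es[of _ "B\<^sup>2"]) auto
  also have "\<dots> \<le> (\<Sum>j\<in>I. \<integral>w. 8 * (f (fst w))\<^sup>2 * (\<Delta> j w)\<^sup>2 + 2 * (\<Delta> j w) ^ 4 \<partial>(P \<Otimes>\<^sub>M p)) / 2"
  proof (intro divide_right_mono sum_mono)
    fix j assume j [measurable]: "j \<in> I"
    note [measurable] = meas[OF j]
    have f_abs: "\<bar>(f x)\<^sup>2\<bar> \<le> B\<^sup>2" for x using power_mono[OF f(2)[of x], of 2] by simp
    have d_abs: "\<bar>\<Delta> j w\<bar> \<le> 2 * B" for w
      using f(2)[of "fst w"] f(2)[of "(fst w)(j := snd w)"] unfolding \<Delta>_def by linarith
    have d2: "(\<Delta> j w)\<^sup>2 \<le> (2 * B)\<^sup>2" and d4: "(\<Delta> j w) ^ 4 \<le> (2 * B) ^ 4" for w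
      using power_mono[OF d_abs[of w], of 2] power_mono[OF d_abs[of w], of 4] by simp_all
    show "(\<integral>w. ((f (fst w))\<^sup>2 - (f ((fst w)(j := snd w)))\<^sup>2)\<^sup>2 \<partial>(P \<Otimes>\<^sub>M p))
      \<le> (\<integral>w. 8 * (f (fst w))\<^sup>2 * (\<Delta> j w)\<^sup>2 + 2 * (\<Delta> j w) ^ 4 \<partial>(P \<Otimes>\<^sub>M p))"
    proof (rule integral_mono)
      show "integrable (P \<Otimes>\<^sub>M p) (\<lambda>w. ((f (fst w))\<^sup>2 - (f ((fst w)(j := snd w)))\<^sup>2)\<^sup>2)"
        by (intro Kp.integrable_bounded[of _ "(2 * B\<^sup>2)\<^sup>2"] abs_square_diff_le f_abs) measurable
      show "integrable (P \<Otimes>\<^sub>M p) (\<lambda>w. 8 * (f (fst w))\<^sup>2 * (\<Delta> j w)\<^sup>2 + 2 * (\<Delta> j w) ^ 4)"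
      proof (rule Kp.integrable_bounded)
        show "(\<lambda>w. 8 * (f (fst w))\<^sup>2 * (\<Delta> j w)\<^sup>2 + 2 * (\<Delta> j w) ^ 4) \<in> borel_measurable (P \<Otimes>\<^sub>M p)" by measurable
        fix w
        have "(f (fst w))\<^sup>2 * (\<Delta> j w)\<^sup>2 \<le> B\<^sup>2 * (2 * B)\<^sup>2"
          using f_abs[of "fst w"] d2[of w] by (intro mult_mono) auto
        then have "8 * (f (fst w))\<^sup>2 * (\<Delta> j w)\<^sup>2 + 2 * (\<Delta> j w) ^ 4 \<le> 8 * (B\<^sup>2 * (2 * B)\<^sup>2) + 2 * (2 * B) ^ 4"
          using d4[of w] by linarith
        moreover have "0 \<le> 8 * (f (fst w))\<^sup>2 * (\<Delta> j w)\<^sup>2 + 2 * (\<Delta> j w) ^ 4" by simp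
        ultimately show "\<bar>8 * (f (fst w))\<^sup>2 * (\<Delta> j w)\<^sup>2 + 2 * (\<Delta> j w) ^ 4\<bar> \<le> 8 * (B\<^sup>2 * (2 * B)\<^sup>2) + 2 * (2 * B) ^ 4"
          by (simp only: abs_of_nonneg)
      qed
      fix w
      define a b where "a = f (fst w)" and "b = \<Delta> j w"
      have fb: "f ((fst w)(j := snd w)) = a - b" by (simp add: a_def b_def \<Delta>_def)
      \<comment> \<open>The square on the left is b^2 (2 a - b)^2, and (2 a - b)^2 + (2 a + b)^2 = 8
        a^2 + 2 b^2.\<close>
      have "8 * a\<^sup>2 * b\<^sup>2 + 2 * b ^ 4 - (a\<^sup>2 - (a - b)\<^sup>2)\<^sup>2 = (b * (2 * a + b))\<^sup>2"
        by (simp add: power2_eq_square power4_eq_xxxx algebra_simps)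
      then have "(a\<^sup>2 - (a - b)\<^sup>2)\<^sup>2 \<le> 8 * a\<^sup>2 * b\<^sup>2 + 2 * b ^ 4"
        by (smt (verit) zero_le_power2)
      then show "((f (fst w))\<^sup>2 - (f ((fst w)(j := snd w)))\<^sup>2)\<^sup>2 \<le> 8 * (f (fst w))\<^sup>2 * (\<Delta> j w)\<^sup>2 + 2 * (\<Delta> j w) ^ 4"
        unfolding fb by (simp only: a_def b_def)
    qed
  qed simp
  also have "\<dots> = (\<Sum>j\<in>I. \<integral>w. 4 * (f (fst w))\<^sup>2 * (\<Delta> j w)\<^sup>2 + (\<Delta> j w) ^ 4 \<partial>(P \<Otimes>\<^sub>M p))"
    unfolding sum_divide_distrib integral_divide_zero[symmetric] by (simp add: add_divide_distrib mult_ac)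
  finally show "(\<integral>x. (f x) ^ 4 \<partial>P) \<le> (\<integral>x. (f x)\<^sup>2 \<partial>P)\<^sup>2
      + (\<Sum>j\<in>I. \<integral>w. 4 * (f (fst w))\<^sup>2 * (\<Delta> j w)\<^sup>2 + (\<Delta> j w) ^ 4 \<partial>(P \<Otimes>\<^sub>M p))"
    by (simp add: power_mult[symmetric])
qed

section \<open>Discrete cosine transforms\<close>

text \<open>Product-to-sum reduces this to sums over roots of unity at the frequencies
  \<open>k - l\<close> and \<open>k + l\<close>. Both indicators hold at once if
  \<open>k = l\<close> and \<open>n\<close> divides \<open>2 * k\<close>; these frequencies are
  exceptional again in the computation of expectations.\<close>

lemma sum_cos_mult_cos:
  assumes "k < n" "l < n"
  shows "(\<Sum>j<n. cos (angle n j k) * cos (angle n j l)) =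
    real n / 2 * ((if k = l then 1 else 0) + (if n dvd k + l then 1 else 0))"
proof -
  have n: "n > 0" using assms by simp
  have e: "cos (angle n j k) * cos (angle n j l) = cos (2 * pi * real_of_int (int k - int l) * real j / real n) / 2
    + cos (2 * pi * real_of_int (int k + int l) * real j / real n) / 2" for j
  proof -
    have "2 * pi * real_of_int (int k - int l) * real j / real n = angle n j k - angle n j l"
      "2 * pi * real_of_int (int k + int l) * real j / real n = angle n j k + angle n j l"
      by (simp_all add: angle_def algebra_simps add_divide_distrib diff_divide_distrib)
    then show ?thesis by (simp only: cos_times_cos add_divide_distrib)
  qed
  have "int n dvd int k - int l \<longleftrightarrow> k = l"
  proof
    assume "int n dvd int k - int l"
    then have "int k mod int n = int l mod int n" by (simp add: mod_eq_dvd_iff)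
    then show "k = l" using assms by simp
  qed simp
  moreover have "int n dvd int k + int l \<longleftrightarrow> n dvd k + l"
    by (metis of_nat_add of_nat_dvd_iff)
  ultimately show ?thesis
    unfolding e sum.distrib sum_divide_distrib[symmetric] sum_cos_roots_of_unity[OF n] by simp
qed

text \<open>Bessel's inequality by a Schur test: the Gram matrix \<open>K\<close> of the cosine
  vectors has nonnegative entries and row sums at most \<open>n\<close>, since in row
  \<open>k\<close> only the column \<open>k\<close> and the one congruent to \<open>- k\<close>
  modulo \<open>n\<close> contribute, each at most \<open>n / 2\<close> (their contributions add if
  the columns coincide).\<close>

lemma sum_square_cos_transform_le:
  fixes a :: "nat \<Rightarrow> real"
  shows "(\<Sum>j<n. (\<Sum>k<n. a k * cos (angle n j k))\<^sup>2) \<le> real n * (\<Sum>k<n. (a k)\<^sup>2)"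
proof (cases "n = 0")
  case False
  define K where "K k l = (\<Sum>j<n. cos (angle n j k) * cos (angle n j l))" for k l
  have K_sym: "K k l = K l k" for k l by (simp add: K_def mult.commute)
  have K_nonneg: "K k l \<ge> 0" if "k < n" "l < n" for k l
    unfolding K_def sum_cos_mult_cos[OF that] by simp
  have K_sum: "(\<Sum>l<n. K k l) \<le> real n" if k: "k < n" for k
  proof -
    have "(\<Sum>l<n. K k l) = (\<Sum>l<n. real n / 2 * ((if k = l then 1 else 0) + (if n dvd k + l then 1 else 0)))"
      unfolding K_def by (intro sum.cong refl) (simp add: sum_cos_mult_cos k)
    also have "\<dots> = real n / 2 * (1 + real (card {l. l < n \<and> n dvd k + l}))"
    proof -
      have "(\<Sum>l<n. (if k = l then 1 else 0) + (if n dvd k + l then 1 else 0 :: real)) = 1 + real (card {l. l < n \<and> n dvd k + l})"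
        using k by (simp add: sum.distrib sum.If_cases Int_def)
      then show ?thesis by (simp only: sum_distrib_left[symmetric])
    qed
    also have "card {l. l < n \<and> n dvd k + l} \<le> Suc 0"
    proof (subst card_le_Suc0_iff_eq)
      show "\<forall>x\<in>{l. l < n \<and> n dvd k + l}. \<forall>y\<in>{l. l < n \<and> n dvd k + l}. x = y"
      proof clarify
        fix x y assume xy: "x < n" "n dvd k + x" "y < n" "n dvd k + y"
        then have "int n dvd (int k + int x) - (int k + int y)"
          by (intro dvd_diff) (metis of_nat_add of_nat_dvd_iff)+
        then have "int x mod int n = int y mod int n" by (simp add: mod_eq_dvd_iff)
        then show "x = y" using xy by simp
      qed
    qed simp
    then have "real n / 2 * (1 + real (card {l. l < n \<and> n dvd k + l})) \<le> real n / 2 * (1 + 1)"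
      by (intro mult_left_mono add_left_mono) auto
    finally show ?thesis by simp
  qed
  have "(\<Sum>j<n. (\<Sum>k<n. a k * cos (angle n j k))\<^sup>2)
      = (\<Sum>j<n. \<Sum>k<n. \<Sum>l<n. a k * a l * (cos (angle n j k) * cos (angle n j l)))"
    unfolding power2_eq_square sum_product by (simp add: mult_ac)
  also have "\<dots> = (\<Sum>k<n. \<Sum>j<n. \<Sum>l<n. a k * a l * (cos (angle n j k) * cos (angle n j l)))"
    by (rule sum.swap)
  also have "\<dots> = (\<Sum>k<n. \<Sum>l<n. a k * a l * K k l)"
    unfolding K_def sum_distrib_left by (intro sum.cong refl sum.swap)
  also have "\<dots> \<le> (\<Sum>k<n. \<Sum>l<n. ((a k)\<^sup>2 + (a l)\<^sup>2) / 2 * K k l)"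
  proof (intro sum_mono mult_right_mono)
    fix k l
    show "a k * a l \<le> ((a k)\<^sup>2 + (a l)\<^sup>2) / 2"
      using sum_squares_bound[of "a k" "a l"] by simp
  qed (auto intro: K_nonneg)
  also have "\<dots> = (\<Sum>k<n. \<Sum>l<n. (a k)\<^sup>2 * K k l) / 2 + (\<Sum>k<n. \<Sum>l<n. (a l)\<^sup>2 * K k l) / 2"
    by (simp add: sum.distrib sum_divide_distrib algebra_simps add_divide_distrib)
  also have "(\<Sum>k<n. \<Sum>l<n. (a l)\<^sup>2 * K k l) = (\<Sum>k<n. \<Sum>l<n. (a k)\<^sup>2 * K k l)"
    by (subst sum.swap) (simp add: K_sym)
  also have "(\<Sum>k<n. \<Sum>l<n. (a k)\<^sup>2 * K k l) / 2 + (\<Sum>k<n. \<Sum>l<n. (a k)\<^sup>2 * K k l) / 2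
      = (\<Sum>k<n. (a k)\<^sup>2 * (\<Sum>l<n. K k l))"
    by (simp add: sum_distrib_left)
  also have "\<dots> \<le> (\<Sum>k<n. (a k)\<^sup>2 * real n)"
    by (intro sum_mono mult_left_mono K_sum) auto
  finally show ?thesis by (simp add: sum_distrib_left mult.commute)
qed simp

section \<open>Folding onto the independent entries\<close>

text \<open>The multiplicity of the independent entry with index \<open>j\<close> in the first row
  of the circulant: 2 for all \<open>j \<le> n div 2\<close> apart from possibly the two end points,
  and 0 beyond.\<close>

definition fold_weight :: "nat \<Rightarrow> nat \<Rightarrow> real" where
  "fold_weight n j = real (card {d. d < n \<and> min d (n - d) = j})"

lemma fold_weight_bounds: "0 \<le> fold_weight n j" "fold_weight n j \<le> 2"
proof -
  have "{d. d < n \<and> min d (n - d) = j} \<subseteq> {j, n - j}" by auto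
  then have "card {d. d < n \<and> min d (n - d) = j} \<le> card {j, n - j}" by (intro card_mono) auto
  also have "\<dots> \<le> 2" by (simp add: card_insert_if)
  finally show "fold_weight n j \<le> 2" by (simp add: fold_weight_def)
qed (simp add: fold_weight_def)

lemma cos_angle_fold:
  assumes "d < n"
  shows "cos (angle n (min d (n - d)) k) = cos (angle n d k)"
  using assms angle_complement(1)[of n d k] by (simp add: min_def)

lemma sum_fold:
  fixes g :: "nat \<Rightarrow> real"
  assumes n: "n > 0"
  shows "(\<Sum>d<n. g (min d (n - d))) = (\<Sum>j\<le>n div 2. fold_weight n j * g j)"
proof -
  have "(\<Sum>j\<le>n div 2. fold_weight n j * g j) = (\<Sum>j\<le>n div 2. \<Sum>d\<in>{d \<in> {..<n}. min d (n - d) = j}. g (min d (n - d)))"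
    by (intro sum.cong refl) (simp add: fold_weight_def)
  also have "\<dots> = (\<Sum>d<n. g (min d (n - d)))"
    by (rule sum.group) (auto simp: min_def)
  finally show ?thesis by simp
qed

lemma circ_eig_fold:
  assumes n: "n > 0"
  shows "circ_eig x n k = (\<Sum>j\<le>n div 2. fold_weight n j * cos (angle n j k) * x j)"
proof -
  have "circ_eig x n k = (\<Sum>d<n. x (min d (n - d)) * cos (angle n (min d (n - d)) k))"
    unfolding circ_eig_def by (intro sum.cong refl) (simp add: cos_angle_fold)
  then show ?thesis using sum_fold[OF n, of "\<lambda>j. x j * cos (angle n j k)"] by (simp add: mult_ac)
qed

lemma circ_eig_upd:
  assumes n: "n > 0" and j: "j \<le> n div 2"
  shows "circ_eig (x(j := y)) n k = circ_eig x n k + (y - x j) * fold_weight n j * cos (angle n j k)"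
proof -
  have "circ_eig (x(j := y)) n k - circ_eig x n k
      = (\<Sum>i\<le>n div 2. fold_weight n i * cos (angle n i k) * ((x(j := y)) i - x i))"
    unfolding circ_eig_fold[OF n] sum_subtractf[symmetric] by (simp add: right_diff_distrib)
  also have "\<dots> = (\<Sum>i\<in>{j}. fold_weight n i * cos (angle n i k) * ((x(j := y)) i - x i))"
    using j by (intro sum.mono_neutral_right) auto
  finally show ?thesis by (simp add: mult_ac)
qed

text \<open>Bessel's inequality once more, with each independent entry occurring at most twice. It
  will control the mean squared eigenvalue when the frequency varies.\<close>

lemma circ_eig_square_sum_le:
  "(\<Sum>k<n. (circ_eig x n k)\<^sup>2) \<le> 2 * real n * (\<Sum>j\<le>n. (x j)\<^sup>2)"
proof (cases "n > 0")
  case True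
  have "(\<Sum>k<n. (circ_eig x n k)\<^sup>2) \<le> real n * (\<Sum>d<n. (x (min d (n - d)))\<^sup>2)"
    using sum_square_cos_transform_le[where n = n and a = "\<lambda>d. x (min d (n - d))"]
    by (simp add: circ_eig_def angle_def mult_ac)
  moreover have "(\<Sum>d<n. (x (min d (n - d)))\<^sup>2) \<le> 2 * (\<Sum>j\<le>n. (x j)\<^sup>2)"
  proof -
    have "(\<Sum>d<n. (x (min d (n - d)))\<^sup>2) = (\<Sum>j\<le>n div 2. fold_weight n j * (x j)\<^sup>2)"
      by (rule sum_fold[OF True])
    also have "\<dots> \<le> (\<Sum>j\<le>n div 2. 2 * (x j)\<^sup>2)"
      by (intro sum_mono mult_right_mono fold_weight_bounds) auto
    also have "\<dots> \<le> (\<Sum>j\<le>n. 2 * (x j)\<^sup>2)"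
      by (intro sum_mono2) auto
    finally show ?thesis by (simp add: sum_distrib_left)
  qed
  ultimately show ?thesis
    using mult_left_mono[of "\<Sum>d<n. (x (min d (n - d)))\<^sup>2" "2 * (\<Sum>j\<le>n. (x j)\<^sup>2)" "real n"] by (simp add: mult_ac)
qed (simp add: sum_nonneg)

section \<open>Sensitivity of the trigonometric means to a single entry\<close>

text \<open>The real part of the second-order estimate for \<open>cis v\<close>, rotated by
  \<open>cis u\<close>.\<close>

lemma cos_taylor_bound: "\<bar>cos (u + v) - cos u + v * sin u\<bar> \<le> v\<^sup>2 / 2" for u v :: real
proof -
  have "cmod (cis v - (1 + \<i> * v)) \<le> v\<^sup>2 / 2"
    using iexp_approx1[of v 1] by (simp add: cis_conv_exp eval_nat_numeral)
  then have "cmod (cis u * (cis v - (1 + \<i> * v))) \<le> v\<^sup>2 / 2" by (simp add: norm_mult)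
  moreover have "cos (u + v) - cos u + v * sin u = Re (cis u * (cis v - (1 + \<i> * v)))"
    by (simp add: cos_add algebra_simps)
  ultimately show ?thesis using abs_Re_le_cmod[of "cis u * (cis v - (1 + \<i> * v))"] by linarith
qed

text \<open>The phase \<open>\<theta>\<close> treats cosine and sine together: 0 gives the mean of
  the cosines, \<open>pi / 2\<close> that of the sines.\<close>

definition cos_mean :: "real \<Rightarrow> real \<Rightarrow> nat \<Rightarrow> (nat \<Rightarrow> real) \<Rightarrow> real" where
  "cos_mean s \<theta> n x = (\<Sum>k<n. cos (s * (circ_eig x n k / sqrt (real n)) - \<theta>)) / real n"

text \<open>Up to the factor - s w / sqrt n, with w the fold weight of \<open>j\<close>, this is the
  partial derivative of \<open>cos_mean\<close> in the entry \<open>j\<close>. It is also a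
  normalized cosine coefficient of a bounded sequence, so Bessel's inequality applies to it.\<close>

definition sin_mean :: "real \<Rightarrow> real \<Rightarrow> nat \<Rightarrow> nat \<Rightarrow> (nat \<Rightarrow> real) \<Rightarrow> real" where
  "sin_mean s \<theta> n j x = (\<Sum>k<n. sin (s * (circ_eig x n k / sqrt (real n)) - \<theta>) * cos (angle n j k)) / real n"

lemma abs_cos_mean_le: "\<bar>cos_mean s \<theta> n x\<bar> \<le> 1"
proof -
  have "\<bar>\<Sum>k<n. cos (s * (circ_eig x n k / sqrt (real n)) - \<theta>)\<bar> \<le> (\<Sum>k<n. 1)"
    by (rule order_trans[OF sum_abs]) (intro sum_mono, simp)
  then show ?thesis by (simp add: cos_mean_def divide_le_eq)
qed

lemma sin_mean_square_sum_le: "(\<Sum>j<n. (sin_mean s \<theta> n j x)\<^sup>2) \<le> 1"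
proof (cases "n > 0")
  case True
  let ?a = "\<lambda>k. sin (s * (circ_eig x n k / sqrt (real n)) - \<theta>)"
  have "(\<Sum>j<n. (sin_mean s \<theta> n j x)\<^sup>2) = (\<Sum>j<n. (\<Sum>k<n. ?a k * cos (angle n j k))\<^sup>2) / (real n)\<^sup>2"
    unfolding sin_mean_def power_divide sum_divide_distrib[symmetric] ..
  also have "\<dots> \<le> real n * (\<Sum>k<n. (?a k)\<^sup>2) / (real n)\<^sup>2"
    by (intro divide_right_mono sum_square_cos_transform_le) simp
  also have "(\<Sum>k<n. (?a k)\<^sup>2) \<le> (\<Sum>k<n. 1)" by (intro sum_mono) (simp add: abs_square_le_1)
  then have "real n * (\<Sum>k<n. (?a k)\<^sup>2) / (real n)\<^sup>2 \<le> real n * real n / (real n)\<^sup>2"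
    by (intro divide_right_mono mult_left_mono) auto
  finally show ?thesis using True by (simp add: power2_eq_square)
qed simp

lemma sin_mean_square_le: "j < n \<Longrightarrow> (sin_mean s \<theta> n j x)\<^sup>2 \<le> 1"
  using sin_mean_square_sum_le[of s \<theta> n x] member_le_sum[of j "{..<n}" "\<lambda>j. (sin_mean s \<theta> n j x)\<^sup>2"]
  by force

text \<open>Taylor expansion in the entry \<open>j\<close>: the eigenvalue \<open>k\<close> moves
  along a cosine vector, so the linear term is \<open>c * g\<close>, with \<open>c\<close> of order
  n^(-1/2), and the remainder \<open>r\<close> is of order 1 / n. The factor 8 combines (u - v)^2 at
  most 2 u^2 + 2 v^2 with the fold weight bound 2.\<close>

lemma cos_mean_upd_square_le:
  assumes n: "n > 0" and j: "j \<le> n div 2"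
  shows "(cos_mean s \<theta> n x - cos_mean s \<theta> n (x(j := y)))\<^sup>2 \<le> 8 * (s\<^sup>2 + s ^ 4) * ((1 + 8 * y ^ 4) * (1 + 8 * (x j) ^ 4))
    * ((sin_mean s \<theta> n j x)\<^sup>2 / real n + 1 / (real n)\<^sup>2)"
proof -
  define u where "u k = s * (circ_eig x n k / sqrt (real n)) - \<theta>" for k
  define c where "c = s * (y - x j) * fold_weight n j / sqrt (real n)"
  define D where "D = y - x j"
  define g where "g = sin_mean s \<theta> n j x"
  have upd: "s * (circ_eig (x(j := y)) n k / sqrt (real n)) - \<theta> = u k + c * cos (angle n j k)" for k
    unfolding circ_eig_upd[OF n j] u_def c_def by (simp add: algebra_simps add_divide_distrib diff_divide_distrib)
  have wsq: "(fold_weight n j)\<^sup>2 \<le> 4" using power_mono[OF fold_weight_bounds(2,1), of n j 2] by simp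
  have c2: "c\<^sup>2 = s\<^sup>2 * D\<^sup>2 * (fold_weight n j)\<^sup>2 / real n"
    using n by (simp add: c_def D_def power_divide power_mult_distrib)
  have c2_le: "c\<^sup>2 \<le> 4 * s\<^sup>2 * D\<^sup>2 / real n"
    unfolding c2 using mult_left_mono[OF wsq, of "s\<^sup>2 * D\<^sup>2"] by (intro divide_right_mono) (auto simp: mult_ac)
  define r where "r = cos_mean s \<theta> n (x(j := y)) - cos_mean s \<theta> n x + c * g"
  have r: "\<bar>r\<bar> \<le> 2 * s\<^sup>2 * D\<^sup>2 / real n"
  proof -
    have "r = (\<Sum>k<n. cos (u k + c * cos (angle n j k)) - cos (u k) + c * cos (angle n j k) * sin (u k)) / real n"
      unfolding r_def g_def cos_mean_def sin_mean_def upd u_def[symmetric]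
      by (simp add: sum.distrib sum_subtractf sum_distrib_left add_divide_distrib diff_divide_distrib mult_ac)
    also have "\<bar>\<dots>\<bar> \<le> (\<Sum>k<n. c\<^sup>2 / 2) / real n"
      unfolding abs_divide abs_of_nat
    proof (intro divide_right_mono order_trans[OF sum_abs] sum_mono)
      fix k
      have "(c * cos (angle n j k))\<^sup>2 \<le> c\<^sup>2 * 1"
        unfolding power_mult_distrib by (intro mult_left_mono) (auto simp: abs_square_le_1)
      then show "\<bar>cos (u k + c * cos (angle n j k)) - cos (u k) + c * cos (angle n j k) * sin (u k)\<bar> \<le> c\<^sup>2 / 2"
        using cos_taylor_bound[of "u k" "c * cos (angle n j k)"] by linarith
    qed simp
    finally show ?thesis using n c2_le by simp
  qed
  have r2: "r\<^sup>2 \<le> 4 * s ^ 4 * D ^ 4 / (real n)\<^sup>2"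
    using power_mono[OF r, of 2] by (simp add: power_divide power_mult_distrib power_mult[symmetric])
  \<comment> \<open>The weight has to dominate both \<open>D\<^sup>2\<close> and
    \<open>D ^ 4\<close>. It is taken in product form so that its integral factorizes over the old
    and the new value of the entry; the 8 comes from the estimate \<open>D4\<close>.\<close>
  define Z where "Z = (1 + 8 * y ^ 4) * (1 + 8 * (x j) ^ 4)"
  have D4: "D ^ 4 \<le> 8 * y ^ 4 + 8 * (x j) ^ 4"
  proof -
    have "D\<^sup>2 \<le> 2 * y\<^sup>2 + 2 * (x j)\<^sup>2"
      using zero_le_power2[of "y + x j"] by (simp add: D_def power2_eq_square algebra_simps)
    then have "(D\<^sup>2)\<^sup>2 \<le> (2 * y\<^sup>2 + 2 * (x j)\<^sup>2)\<^sup>2" by (intro power_mono) auto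
    also have "\<dots> \<le> 8 * (y\<^sup>2)\<^sup>2 + 8 * ((x j)\<^sup>2)\<^sup>2"
      using zero_le_power2[of "y\<^sup>2 - (x j)\<^sup>2"] by (simp add: power2_eq_square algebra_simps)
    finally show ?thesis by (simp add: power_mult[symmetric])
  qed
  have "1 + 8 * y ^ 4 + 8 * (x j) ^ 4 \<le> Z" by (simp add: Z_def algebra_simps)
  moreover have "D\<^sup>2 \<le> 1 + D ^ 4"
  proof -
    have "2 * D\<^sup>2 \<le> 1 + (D\<^sup>2)\<^sup>2" using zero_le_power2[of "D\<^sup>2 - 1"] by (simp add: power2_eq_square algebra_simps)
    then have "2 * D\<^sup>2 \<le> 1 + D ^ 4" by (simp add: power_mult[symmetric])
    then show ?thesis using zero_le_power2[of D] by linarith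
  qed
  ultimately have DZ: "D\<^sup>2 \<le> Z" "D ^ 4 \<le> Z" using D4 by linarith+
  have "(cos_mean s \<theta> n x - cos_mean s \<theta> n (x(j := y)))\<^sup>2 = (c * g - r)\<^sup>2" by (simp add: r_def power2_commute)
  also have "\<dots> \<le> 2 * (c * g)\<^sup>2 + 2 * r\<^sup>2"
    using zero_le_power2[of "c * g + r"] by (simp add: power2_eq_square algebra_simps)
  also have "\<dots> \<le> 2 * (4 * s\<^sup>2 * D\<^sup>2 / real n * g\<^sup>2) + 2 * (4 * s ^ 4 * D ^ 4 / (real n)\<^sup>2)"
    unfolding power_mult_distrib by (intro add_mono mult_left_mono mult_right_mono r2 c2_le) auto
  also have "\<dots> = (8 * s\<^sup>2 * g\<^sup>2 / real n) * D\<^sup>2 + (8 * s ^ 4 / (real n)\<^sup>2) * D ^ 4" by (simp add: mult_ac)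
  also have "\<dots> \<le> (8 * s\<^sup>2 * g\<^sup>2 / real n) * Z + (8 * s ^ 4 / (real n)\<^sup>2) * Z"
    by (intro add_mono mult_left_mono DZ) auto
  also have "\<dots> = 8 * Z * (s\<^sup>2 * (g\<^sup>2 / real n) + s ^ 4 * (1 / (real n)\<^sup>2))" by (simp add: algebra_simps)
  also have "\<dots> \<le> 8 * Z * ((s\<^sup>2 + s ^ 4) * (g\<^sup>2 / real n) + (s\<^sup>2 + s ^ 4) * (1 / (real n)\<^sup>2))"
    by (intro mult_left_mono add_mono mult_right_mono) (auto simp: Z_def)
  also have "\<dots> = 8 * (s\<^sup>2 + s ^ 4) * Z * (g\<^sup>2 / real n + 1 / (real n)\<^sup>2)" by (simp add: algebra_simps)
  finally show ?thesis by (simp add: Z_def g_def)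
qed

section \<open>Concentration\<close>

locale finite_moments = real_distribution p for p :: "real measure" +
  assumes moments: "\<And>k. integrable p (\<lambda>u. u ^ k)"
begin

text \<open>The part of the weight in \<open>cos_mean_upd_square_le\<close> that belongs to one of
  the two values of the entry.\<close>

definition wt :: "real \<Rightarrow> real" where
  "wt u = 1 + 8 * u ^ 4"

lemma wt_ge_1: "wt u \<ge> 1"
  by (simp add: wt_def)

lemma borel_measurable_p [simp]: "borel_measurable p = borel_measurable borel"
  by (rule measurable_cong_sets) auto

lemma wt_measurable [measurable]: "wt \<in> borel_measurable borel" "wt \<in> borel_measurable p"
  by (simp_all add: wt_def[abs_def])

lemma integrable_wt_power: "integrable p (\<lambda>u. wt u ^ k)"
proof -
  have "wt u ^ k = (\<Sum>i\<le>k. real (k choose i) * 8 ^ (k - i) * u ^ (4 * (k - i)))" for u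
    unfolding wt_def binomial_ring by (simp add: power_mult_distrib power_mult mult.assoc)
  then show ?thesis using moments by simp
qed

definition wt_moment :: "nat \<Rightarrow> real" where
  "wt_moment k = (\<integral>u. wt u ^ k \<partial>p)"

abbreviation prod_law :: "nat \<Rightarrow> (nat \<Rightarrow> real) measure" where
  "prod_law n \<equiv> Pi\<^sub>M {..n div 2} (\<lambda>_. p)"

abbreviation pair_law :: "nat \<Rightarrow> ((nat \<Rightarrow> real) \<times> real) measure" where
  "pair_law n \<equiv> prod_law n \<Otimes>\<^sub>M p"

lemma prob_space_prod_law: "prob_space (prod_law n)"
  by (rule prob_space_PiM) (rule prob_space_axioms)

text \<open>The new value and the old entry \<open>j\<close> are independent with law
  \<open>p\<close>, so the integral of the power is a product of two equal moments.\<close>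

lemma resample_weight:
  assumes j: "j \<le> n div 2"
  shows "integrable (pair_law n) (\<lambda>w. (wt (snd w) * wt (fst w j)) ^ k)"
    and "(\<integral>w. (wt (snd w) * wt (fst w j)) ^ k \<partial>pair_law n) = (wt_moment k)\<^sup>2"
proof -
  interpret K: prob_space "prod_law n" by (rule prob_space_prod_law)
  interpret Kp: pair_prob_space "prod_law n" p ..
  have [measurable]: "(\<lambda>x. x j) \<in> measurable (prod_law n) p"
    using j by (intro measurable_component_singleton) auto
  have comp: "distr (prod_law n) p (\<lambda>x. x j) = p"
    using j by (intro distr_PiM_component) (auto intro: prob_space_axioms)
  have int_j: "integrable (prod_law n) (\<lambda>x. wt (x j) ^ k)"
    using integrable_distr[of "\<lambda>x. x j" "prod_law n" p "\<lambda>u. wt u ^ k"] integrable_wt_power[of k] by (simp add: comp)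
  have val_j: "(\<integral>x. wt (x j) ^ k \<partial>prod_law n) = wt_moment k"
    using integral_distr[of "\<lambda>x. x j" "prod_law n" p "\<lambda>u. wt u ^ k"] by (simp add: comp wt_moment_def)
  have nn: "\<bar>wt y ^ k * wt z ^ k\<bar> = wt y ^ k * wt z ^ k" for y z
    using wt_ge_1[of y] wt_ge_1[of z] by simp
  show int: "integrable (pair_law n) (\<lambda>w. (wt (snd w) * wt (fst w j)) ^ k)"
  proof (rule Kp.Fubini_integrable)
    show "(\<lambda>w. (wt (snd w) * wt (fst w j)) ^ k) \<in> borel_measurable (pair_law n)" by measurable
    show "integrable (prod_law n) (\<lambda>x. \<integral>y. norm ((wt (snd (x, y)) * wt (fst (x, y) j)) ^ k) \<partial>p)"
      using int_j by (simp add: nn power_mult_distrib)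
    show "AE x in prod_law n. integrable p (\<lambda>y. (wt (snd (x, y)) * wt (fst (x, y) j)) ^ k)"
      by (simp add: power_mult_distrib integrable_wt_power)
  qed
  have "(\<integral>w. (wt (snd w) * wt (fst w j)) ^ k \<partial>pair_law n)
      = (\<integral>x. \<integral>y. (wt (snd (x, y)) * wt (fst (x, y) j)) ^ k \<partial>p \<partial>prod_law n)"
    by (rule Kp.integral_fst'[OF int, symmetric])
  also have "\<dots> = (wt_moment k)\<^sup>2"
    by (simp add: power_mult_distrib val_j wt_moment_def[symmetric] power2_eq_square)
  finally show "(\<integral>w. (wt (snd w) * wt (fst w j)) ^ k \<partial>pair_law n) = (wt_moment k)\<^sup>2" .
qed

lemma circ_eig_measurable:
  assumes "n > 0"
  shows "(\<lambda>x. circ_eig x n k) \<in> borel_measurable (prod_law n)"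
proof -
  have "(\<lambda>x. x j) \<in> borel_measurable (prod_law n)" if "j \<le> n div 2" for j
    using measurable_component_singleton[of j "{..n div 2}" "\<lambda>_. p"] that
    by (simp add: measurable_cong_sets[OF refl, of p borel])
  then show ?thesis unfolding circ_eig_fold[OF assms] by (intro borel_measurable_sum borel_measurable_times) auto
qed

lemma cos_mean_measurable:
  assumes "n > 0"
  shows "cos_mean s \<theta> n \<in> borel_measurable (prod_law n)"
proof -
  note [measurable] = circ_eig_measurable[OF assms]
  show ?thesis unfolding cos_mean_def[abs_def] by measurable
qed

lemma sin_mean_measurable:
  assumes "n > 0"
  shows "sin_mean s \<theta> n j \<in> borel_measurable (prod_law n)"
proof -
  note [measurable] = circ_eig_measurable[OF assms]
  show ?thesis unfolding sin_mean_def[abs_def] by measurable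
qed

text \<open>The weights \<open>Z\<close> below have no uniform bound; splitting them at a level \<open>L\<close> by
  \<open>Z \<le> L + Z ^ 9 / L ^ 8\<close> preserves the gain from Bessel's inequality on the first part.\<close>

lemma resample_sum_le:
  fixes G :: "(nat \<Rightarrow> real) \<Rightarrow> real" and n r :: nat and s \<theta> :: real
  assumes n: "n > 0" and L: "L > 0" and G [measurable]: "G \<in> borel_measurable (prod_law n)"
    and G_bd: "\<And>x. 0 \<le> G x" "\<And>x. G x \<le> 4"
  defines "V j w \<equiv> G (fst w) * (wt (snd w) * wt (fst w j)) ^ r
    * ((sin_mean s \<theta> n j (fst w))\<^sup>2 / real n + 1 / (real n)\<^sup>2)"
  shows "j \<le> n div 2 \<Longrightarrow> integrable (pair_law n) (V j)"
    and "(\<Sum>j\<le>n div 2. \<integral>w. V j w \<partial>pair_law n)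
      \<le> 2 * L / real n * (\<integral>x. G x \<partial>prod_law n) + 8 * (wt_moment (9 * r))\<^sup>2 / L ^ 8"
proof -
  interpret K: prob_space "prod_law n" by (rule prob_space_prod_law)
  interpret Kp: pair_prob_space "prod_law n" p ..
  define J where "J = {..n div 2}"
  have J: "finite J" "J \<subseteq> {..<n}" using n by (auto simp: J_def)
  have cardJ: "real (card J) \<le> real n" using card_mono[OF _ J(2)] by simp
  define Z where "Z j w = (wt (snd w) * wt (fst w j)) ^ r" for j and w :: "(nat \<Rightarrow> real) \<times> real"
  define g where "g j w = (sin_mean s \<theta> n j (fst w))\<^sup>2" for j and w :: "(nat \<Rightarrow> real) \<times> real"
  have Z1: "Z j w \<ge> 1" for j w
  proof -
    have "1 * 1 \<le> wt (snd w) * wt (fst w j)"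
      using wt_ge_1[of "snd w"] by (intro mult_mono wt_ge_1) auto
    then show ?thesis unfolding Z_def by (intro one_le_power) simp
  qed
  have g: "0 \<le> g j w" "g j w \<le> 1" if "j \<in> J" for j w
    using sin_mean_square_le[of j n] that J by (auto simp: g_def)
  have gsum: "(\<Sum>j\<in>J. g j w) \<le> 1" for w
  proof -
    have "(\<Sum>j\<in>J. g j w) \<le> (\<Sum>j<n. g j w)" using J by (intro sum_mono2) (auto simp: g_def)
    also have "\<dots> \<le> 1" unfolding g_def by (rule sin_mean_square_sum_le)
    finally show ?thesis .
  qed
  have Z9: "Z j w ^ 9 = (wt (snd w) * wt (fst w j)) ^ (9 * r)" for j w
    by (simp add: Z_def power_mult[symmetric] mult.commute)
  have split: "Z j w \<le> L + Z j w ^ 9 / L ^ 8" for j w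
  proof (cases "Z j w \<le> L")
    case True
    have "0 \<le> Z j w ^ 9 / L ^ 8" using L Z1[of j w] by simp
    then show ?thesis using True by linarith
  next
    case False
    then have "L ^ 8 \<le> Z j w ^ 8" using L by (intro power_mono) auto
    then have "Z j w * L ^ 8 \<le> Z j w * Z j w ^ 8" using Z1[of j w] by (intro mult_left_mono) auto
    then have "Z j w \<le> Z j w ^ 9 / L ^ 8" using L by (simp add: le_divide_eq power_Suc[symmetric] del: power_Suc)
    then show ?thesis using L by linarith
  qed
  have V_eq: "V j w = G (fst w) * Z j w * (g j w / real n + 1 / (real n)\<^sup>2)" for j w
    by (simp add: V_def Z_def g_def)
  \<comment> \<open>The cut version of \<open>V\<close>. In the tail part the bound 4 on
    \<open>G\<close> and the bound \<open>2 / n\<close> on the bracket give the constant 8.\<close>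
  define U where "U j w = L * G (fst w) * (g j w / real n + 1 / (real n)\<^sup>2) + 8 / (real n * L ^ 8) * Z j w ^ 9" for j w
  have V0: "0 \<le> V j w" if "j \<in> J" for j w
    unfolding V_eq using G_bd(1)[of "fst w"] Z1[of j w] g[OF that, of w] by simp
  have VU: "V j w \<le> U j w" if "j \<in> J" for j w
  proof -
    define c where "c = g j w / real n + 1 / (real n)\<^sup>2"
    have c: "0 \<le> c" using g[OF that, of w] by (simp add: c_def)
    have "1 / (real n)\<^sup>2 \<le> 1 / real n" using n by (simp add: power2_eq_square divide_simps)
    then have "c \<le> 2 / real n"
      using divide_right_mono[OF g(2)[OF that, of w], of "real n"] by (simp add: c_def)
    have "V j w = G (fst w) * c * Z j w" by (simp add: V_eq c_def)
    also have "\<dots> \<le> G (fst w) * c * (L + Z j w ^ 9 / L ^ 8)"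
      using split c G_bd by (intro mult_left_mono) auto
    also have "\<dots> = L * G (fst w) * c + G (fst w) * c * (Z j w ^ 9 / L ^ 8)" by (simp add: algebra_simps)
    also have "G (fst w) * c * (Z j w ^ 9 / L ^ 8) \<le> 4 * (2 / real n) * (Z j w ^ 9 / L ^ 8)"
      using c \<open>c \<le> 2 / real n\<close> G_bd Z1[of j w] L by (intro mult_right_mono mult_mono) auto
    also have "\<dots> = 8 / (real n * L ^ 8) * Z j w ^ 9" by simp
    finally show ?thesis by (simp add: U_def c_def)
  qed
  have meas_j [measurable]: "(\<lambda>x. x j) \<in> measurable (prod_law n) p" if "j \<in> J" for j
    using that by (intro measurable_component_singleton) (auto simp: J_def)
  note [measurable] = sin_mean_measurable[OF n]
  have int_Z9: "integrable (pair_law n) (\<lambda>w. Z j w ^ 9)" if "j \<in> J" for j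
    unfolding Z9 using that by (intro resample_weight) (simp add: J_def)
  have int_Gc: "integrable (pair_law n) (\<lambda>w. L * G (fst w) * (g j w / real n + 1 / (real n)\<^sup>2))" if j: "j \<in> J" for j
  proof (rule Kp.integrable_const_bound[of _ "L * 4 * (1 / real n + 1 / (real n)\<^sup>2)"])
    show "(\<lambda>w. L * G (fst w) * (g j w / real n + 1 / (real n)\<^sup>2)) \<in> borel_measurable (pair_law n)"
      unfolding g_def by measurable
    have "norm (L * G (fst w) * (g j w / real n + 1 / (real n)\<^sup>2)) \<le> L * 4 * (1 / real n + 1 / (real n)\<^sup>2)" for w
    proof -
      have "0 \<le> L * G (fst w) * (g j w / real n + 1 / (real n)\<^sup>2)"
        using L G_bd g[OF j] by simp
      moreover have "L * G (fst w) * (g j w / real n + 1 / (real n)\<^sup>2) \<le> L * 4 * (1 / real n + 1 / (real n)\<^sup>2)"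
        using L G_bd g[OF j] by (intro mult_mono mult_left_mono add_mono divide_right_mono) auto
      ultimately show ?thesis by simp
    qed
    then show "AE w in pair_law n. norm (L * G (fst w) * (g j w / real n + 1 / (real n)\<^sup>2)) \<le> L * 4 * (1 / real n + 1 / (real n)\<^sup>2)"
      by simp
  qed
  have int_U: "integrable (pair_law n) (U j)" if "j \<in> J" for j
    unfolding U_def[abs_def] using int_Gc[OF that] int_Z9[OF that] by simp
  have int_V: "integrable (pair_law n) (V j)" if j: "j \<in> J" for j
  proof (rule Bochner_Integration.integrable_bound[OF int_U[OF j]])
    show "V j \<in> borel_measurable (pair_law n)"
      unfolding V_def[abs_def] using j by measurable
    show "AE w in pair_law n. norm (V j w) \<le> norm (U j w)"
    proof (rule AE_I2)
      fix w
      show "norm (V j w) \<le> norm (U j w)"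
        using V0[OF j, of w] VU[OF j, of w] by simp
    qed
  qed
  then show "j \<le> n div 2 \<Longrightarrow> integrable (pair_law n) (V j)" by (simp add: J_def)
  have int_G: "integrable (prod_law n) G"
    using G_bd by (intro K.integrable_const_bound[of _ 4]) auto
  have G_fst: "integrable (pair_law n) (\<lambda>w. G (fst w))" 
    using G_bd by (intro Kp.integrable_const_bound[of _ 4]) auto
  have G_fst_val: "(\<integral>w. G (fst w) \<partial>pair_law n) = (\<integral>x. G x \<partial>prod_law n)"
    using Kp.integral_fst'[OF G_fst] prob_space by simp
  have "(\<Sum>j\<in>J. \<integral>w. V j w \<partial>pair_law n) \<le> (\<Sum>j\<in>J. \<integral>w. U j w \<partial>pair_law n)"
    using VU int_U int_V by (intro sum_mono integral_mono) auto
  also have "\<dots> = (\<Sum>j\<in>J. (\<integral>w. L * G (fst w) * (g j w / real n + 1 / (real n)\<^sup>2) \<partial>pair_law n)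
      + 8 / (real n * L ^ 8) * (wt_moment (9 * r))\<^sup>2)"
  proof (rule sum.cong[OF refl])
    fix j assume j: "j \<in> J"
    have "(\<integral>w. Z j w ^ 9 \<partial>pair_law n) = (wt_moment (9 * r))\<^sup>2"
      unfolding Z9 using j by (intro resample_weight) (simp add: J_def)
    then show "(\<integral>w. U j w \<partial>pair_law n) = (\<integral>w. L * G (fst w) * (g j w / real n + 1 / (real n)\<^sup>2) \<partial>pair_law n)
      + 8 / (real n * L ^ 8) * (wt_moment (9 * r))\<^sup>2"
      unfolding U_def[abs_def] using int_Gc[OF j] int_Z9[OF j]
      by (subst Bochner_Integration.integral_add) auto
  qed
  also have "\<dots> = (\<Sum>j\<in>J. \<integral>w. L * G (fst w) * (g j w / real n + 1 / (real n)\<^sup>2) \<partial>pair_law n)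
      + real (card J) * (8 / (real n * L ^ 8) * (wt_moment (9 * r))\<^sup>2)"
    by (simp only: sum.distrib sum_constant)
  also have "\<dots> \<le> 2 * L / real n * (\<integral>x. G x \<partial>prod_law n) + 8 * (wt_moment (9 * r))\<^sup>2 / L ^ 8"
  proof (rule add_mono)
    \<comment> \<open>With the random weight replaced by the constant \<open>L\<close>, the sum can
      be taken inside the integral and Bessel's inequality applies pointwise.\<close>
    have "(\<Sum>j\<in>J. \<integral>w. L * G (fst w) * (g j w / real n + 1 / (real n)\<^sup>2) \<partial>pair_law n)
        = (\<integral>w. (\<Sum>j\<in>J. L * G (fst w) * (g j w / real n + 1 / (real n)\<^sup>2)) \<partial>pair_law n)"
      using int_Gc by (intro Bochner_Integration.integral_sum[symmetric])
    also have "\<dots> \<le> (\<integral>w. 2 * L / real n * G (fst w) \<partial>pair_law n)"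
    proof (rule integral_mono)
      show "integrable (pair_law n) (\<lambda>w. \<Sum>j\<in>J. L * G (fst w) * (g j w / real n + 1 / (real n)\<^sup>2))"
        using int_Gc by (intro Bochner_Integration.integrable_sum)
      show "integrable (pair_law n) (\<lambda>w. 2 * L / real n * G (fst w))"
        using G_fst by simp
      fix w
      have "(\<Sum>j\<in>J. g j w / real n + 1 / (real n)\<^sup>2) = (\<Sum>j\<in>J. g j w) / real n + real (card J) / (real n)\<^sup>2"
        by (simp add: sum.distrib sum_divide_distrib)
      also have "\<dots> \<le> 1 / real n + real n / (real n)\<^sup>2"
        using gsum cardJ by (intro add_mono divide_right_mono) auto
      also have "\<dots> = 2 / real n" using n by (simp add: power2_eq_square)
      finally have "L * G (fst w) * (\<Sum>j\<in>J. g j w / real n + 1 / (real n)\<^sup>2) \<le> L * G (fst w) * (2 / real n)"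
        using L G_bd by (intro mult_left_mono) auto
      then show "(\<Sum>j\<in>J. L * G (fst w) * (g j w / real n + 1 / (real n)\<^sup>2)) \<le> 2 * L / real n * G (fst w)"
        by (simp add: sum_distrib_left mult_ac)
    qed
    also have "\<dots> = 2 * L / real n * (\<integral>x. G x \<partial>prod_law n)" using G_fst_val by simp
    finally show "(\<Sum>j\<in>J. \<integral>w. L * G (fst w) * (g j w / real n + 1 / (real n)\<^sup>2) \<partial>pair_law n)
        \<le> 2 * L / real n * (\<integral>x. G x \<partial>prod_law n)" .
    have "real (card J) * (8 / (real n * L ^ 8) * (wt_moment (9 * r))\<^sup>2) \<le> real n * (8 / (real n * L ^ 8) * (wt_moment (9 * r))\<^sup>2)"
      using cardJ L by (intro mult_right_mono) auto
    then show "real (card J) * (8 / (real n * L ^ 8) * (wt_moment (9 * r))\<^sup>2) \<le> 8 * (wt_moment (9 * r))\<^sup>2 / L ^ 8"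
      using n by simp
  qed
  finally show "(\<Sum>j\<le>n div 2. \<integral>w. V j w \<partial>pair_law n)
      \<le> 2 * L / real n * (\<integral>x. G x \<partial>prod_law n) + 8 * (wt_moment (9 * r))\<^sup>2 / L ^ 8"
    by (simp only: J_def)
qed

text \<open>With L = n^(1/4) the tails are O(n^(-2)) and the main terms carry the factor L / n =
  n^(-3/4). This bounds the second moment of \<open>f\<close> by a multiple of n^(-3/4). The fourth
  moment is then bounded by the square of the second moment, by n^(-3/4) times the second moment,
  and by a term from fourth powers of increments that has an additional 1 / n; all are
  O(n^(-3/2)).\<close>

lemma cos_mean_fourth_moment:
  obtains C where "\<And>n \<theta>. n > 0 \<Longrightarrow>
    (\<integral>x. (cos_mean s \<theta> n x - (\<integral>z. cos_mean s \<theta> n z \<partial>prod_law n)) ^ 4 \<partial>prod_law n) \<le> C * real n powr (- 3 / 2)"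
proof -
  define T where "T = 8 * (s\<^sup>2 + s ^ 4)"
  \<comment> \<open>The tail of \<open>resample_sum_le\<close> involves
    \<open>wt_moment (9 * r)\<close>; the exponents \<open>r = 1\<close> and \<open>r = 2\<close>
    occur below.\<close>
  define C where "C = (wt_moment 9)\<^sup>2 + (wt_moment 18)\<^sup>2"
  have T: "T \<ge> 0" and C: "C \<ge> 0" by (simp_all add: T_def C_def)
  define D where "D = T * (1 + 4 * C)"
  have D: "D \<ge> 0" using T C by (simp add: D_def)
  have "(\<integral>x. (cos_mean s \<theta> n x - (\<integral>z. cos_mean s \<theta> n z \<partial>prod_law n)) ^ 4 \<partial>prod_law n)
    \<le> (D\<^sup>2 + 4 * T * (2 * D + 8 * C) + 2 * T\<^sup>2 * (2 + 8 * C)) * real n powr (- 3 / 2)" if n: "n > 0" for n \<theta>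
  proof -
    interpret K: prob_space "prod_law n" by (rule prob_space_prod_law)
    interpret Kp: pair_prob_space "prod_law n" p ..
    let ?P = "prod_law n" and ?W = "(pair_law n)"
    define h where "h = cos_mean s \<theta> n"
    define f where "f x = h x - (\<integral>z. h z \<partial>?P)" for x
    define \<Delta> where "\<Delta> j w = f (fst w) - f ((fst w)(j := snd w))" for j and w :: "(nat \<Rightarrow> real) \<times> real"
    define V where "V G r j w = G (fst w) * (wt (snd w) * wt (fst w j)) ^ r
      * ((sin_mean s \<theta> n j (fst w))\<^sup>2 / real n + 1 / (real n)\<^sup>2)" for G :: "(nat \<Rightarrow> real) \<Rightarrow> real" and r j w
    define L where "L = real n powr (1 / 4)"
    have n1: "real n \<ge> 1" using n by simp
    have L: "L > 0" using n by (simp add: L_def)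
    have L8: "L ^ 8 = (real n)\<^sup>2"
      using n by (simp add: L_def powr_power powr_numeral)
    have Ln: "L / real n = real n powr (- 3 / 4)"
      using n powr_diff[of "real n" "1/4" 1] by (simp add: L_def)
    have pw: "1 / (real n)\<^sup>2 \<le> real n powr a" if "-2 \<le> a" for a
    proof -
      have "1 / (real n)\<^sup>2 = real n powr (-2)" using n by (simp add: powr_minus powr_numeral inverse_eq_divide)
      also have "\<dots> \<le> real n powr a" using n1 that by (rule powr_mono[rotated])
      finally show ?thesis .
    qed
    have h_meas [measurable]: "h \<in> borel_measurable ?P" unfolding h_def by (rule cos_mean_measurable[OF n])
    have h_bd: "\<bar>h x\<bar> \<le> 1" for x by (simp add: h_def abs_cos_mean_le)
    have h_int: "integrable ?P h" using h_bd by (intro K.integrable_bounded[of _ 1]) auto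
    have Eh: "\<bar>\<integral>z. h z \<partial>?P\<bar> \<le> 1" using h_bd by (intro K.abs_integral_le_bound) auto
    have f_meas [measurable]: "f \<in> borel_measurable ?P" unfolding f_def by measurable
    have f_bd: "\<bar>f x\<bar> \<le> 2" for x using h_bd[of x] Eh unfolding f_def by linarith
    have Ef: "(\<integral>x. f x \<partial>?P) = 0" using h_int by (simp add: f_def K.prob_space)
    have f2_bd: "0 \<le> (f x)\<^sup>2" "(f x)\<^sup>2 \<le> 4" for x
      using power_mono[OF f_bd[of x], of 2] by simp_all
    have \<Delta>_le: "(\<Delta> j w)\<^sup>2 \<le> T * V (\<lambda>_. 1) 1 j w" if "j \<le> n div 2" for j w
      using cos_mean_upd_square_le[OF n that, of s \<theta> "fst w" "snd w"]
      by (simp add: \<Delta>_def f_def h_def V_def T_def wt_def)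
    have V0: "0 \<le> V (\<lambda>_. 1) 1 j w" for j w
      unfolding V_def using wt_ge_1[of "snd w"] wt_ge_1[of "fst w j"] by simp
    have \<Delta>_meas [measurable]: "\<Delta> j \<in> borel_measurable ?W" if "j \<le> n div 2" for j
      unfolding \<Delta>_def[abs_def] using that f_bd
      by (intro measurable_resample[OF prob_space_axioms, where B = 2]) auto
    have \<Delta>_bd: "\<bar>\<Delta> j w\<bar> \<le> 4" for j w
      using f_bd[of "fst w"] f_bd[of "(fst w)(j := snd w)"] unfolding \<Delta>_def by linarith
    have int\<Delta>: "integrable ?W (\<lambda>w. (\<Delta> j w)\<^sup>2)" if j: "j \<le> n div 2" for j
    proof -
      have "(\<Delta> j w)\<^sup>2 \<le> 16" for w using power_mono[OF \<Delta>_bd[of j w], of 2] by simp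
      then show ?thesis using \<Delta>_meas[OF j] by (intro Kp.integrable_bounded[of _ 16]) auto
    qed
    have int\<Delta>4: "integrable ?W (\<lambda>w. 4 * (f (fst w))\<^sup>2 * (\<Delta> j w)\<^sup>2 + (\<Delta> j w) ^ 4)" if j: "j \<le> n div 2" for j
    proof (rule Kp.integrable_bounded)
      show "(\<lambda>w. 4 * (f (fst w))\<^sup>2 * (\<Delta> j w)\<^sup>2 + (\<Delta> j w) ^ 4) \<in> borel_measurable ?W"
        using \<Delta>_meas[OF j] by measurable
      fix w
      have "(f (fst w))\<^sup>2 * (\<Delta> j w)\<^sup>2 \<le> 4 * 16"
        using f2_bd[of "fst w"] power_mono[OF \<Delta>_bd[of j w], of 2] by (intro mult_mono) auto
      moreover have "(\<Delta> j w) ^ 4 \<le> 256" using power_mono[OF \<Delta>_bd[of j w], of 4] by simp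
      ultimately have "4 * (f (fst w))\<^sup>2 * (\<Delta> j w)\<^sup>2 + (\<Delta> j w) ^ 4 \<le> 512" by linarith
      moreover have "0 \<le> 4 * (f (fst w))\<^sup>2 * (\<Delta> j w)\<^sup>2 + (\<Delta> j w) ^ 4" by simp
      ultimately show "\<bar>4 * (f (fst w))\<^sup>2 * (\<Delta> j w)\<^sup>2 + (\<Delta> j w) ^ 4\<bar> \<le> 512" by (simp only: abs_of_nonneg)
    qed
    have rs: "(\<Sum>j\<le>n div 2. \<integral>w. V G r j w \<partial>?W) \<le> 2 * (L / real n) * (\<integral>x. G x \<partial>?P) + 8 * (wt_moment (9 * r))\<^sup>2 / (real n)\<^sup>2"
      and V_int: "\<And>j. j \<le> n div 2 \<Longrightarrow> integrable ?W (V G r j)"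
      if "G \<in> borel_measurable ?P" "\<And>x. 0 \<le> G x" "\<And>x. G x \<le> 4" for G r
      using resample_sum_le[OF n L that, where r = r and s = s and \<theta> = \<theta>] unfolding V_def L8[symmetric] by (simp_all add: V_def[abs_def])
    have m9: "(wt_moment (9 * 1))\<^sup>2 \<le> C" and m18: "(wt_moment (9 * 2))\<^sup>2 \<le> C" by (simp_all add: C_def)
    have tail: "8 * (wt_moment (9 * r))\<^sup>2 / (real n)\<^sup>2 \<le> 8 * C * (1 / (real n)\<^sup>2)" if "(wt_moment (9 * r))\<^sup>2 \<le> C" for r
      using that by (simp add: divide_right_mono)
    have Ef2: "(\<integral>x. (f x)\<^sup>2 \<partial>?P) \<le> D * real n powr (- 3 / 4)"
    proof -
      have "(\<integral>x. (f x)\<^sup>2 \<partial>?P) \<le> (\<Sum>j\<le>n div 2. \<integral>w. (\<Delta> j w)\<^sup>2 \<partial>?W) / 2"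
        using efron_stein_pair[OF prob_space_axioms, of "{..n div 2}" f 2] f_bd Ef by (simp add: \<Delta>_def)
      also have "\<dots> \<le> (\<Sum>j\<le>n div 2. \<integral>w. T * V (\<lambda>_. 1) 1 j w \<partial>?W) / 2"
        using \<Delta>_le int\<Delta> V_int[of "\<lambda>_. 1"] by (intro divide_right_mono sum_mono integral_mono) auto
      also have "\<dots> = T / 2 * (\<Sum>j\<le>n div 2. \<integral>w. V (\<lambda>_. 1) 1 j w \<partial>?W)"
        by (simp add: sum_distrib_left[symmetric])
      also have "\<dots> \<le> T / 2 * (2 * real n powr (- 3 / 4) + 8 * C * real n powr (- 3 / 4))"
        using T C rs[of "\<lambda>_. 1" 1] tail[OF m9] mult_left_mono[OF pw[of "- 3 / 4"], of "8 * C"]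
        by (intro mult_left_mono) (simp_all add: K.prob_space Ln)
      also have "\<dots> = D * real n powr (- 3 / 4)" by (simp add: D_def algebra_simps)
      finally show ?thesis .
    qed
    have "(\<integral>x. (f x) ^ 4 \<partial>?P) \<le> (\<integral>x. (f x)\<^sup>2 \<partial>?P)\<^sup>2
        + (\<Sum>j\<le>n div 2. \<integral>w. 4 * (f (fst w))\<^sup>2 * (\<Delta> j w)\<^sup>2 + (\<Delta> j w) ^ 4 \<partial>?W)"
      using efron_stein_fourth[OF prob_space_axioms, of "{..n div 2}" f 2] f_bd by (simp add: \<Delta>_def)
    also have "(\<Sum>j\<le>n div 2. \<integral>w. 4 * (f (fst w))\<^sup>2 * (\<Delta> j w)\<^sup>2 + (\<Delta> j w) ^ 4 \<partial>?W)
        \<le> (\<Sum>j\<le>n div 2. \<integral>w. 4 * T * V (\<lambda>x. (f x)\<^sup>2) 1 j w + 2 * T\<^sup>2 / real n * V (\<lambda>_. 1) 2 j w \<partial>?W)"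
    proof (intro sum_mono integral_mono)
      fix j assume "j \<in> {..n div 2}"
      then have j: "j \<le> n div 2" by simp
      show "integrable ?W (\<lambda>w. 4 * (f (fst w))\<^sup>2 * (\<Delta> j w)\<^sup>2 + (\<Delta> j w) ^ 4)" by (rule int\<Delta>4[OF j])
      show "integrable ?W (\<lambda>w. 4 * T * V (\<lambda>x. (f x)\<^sup>2) 1 j w + 2 * T\<^sup>2 / real n * V (\<lambda>_. 1) 2 j w)"
        using V_int[of "\<lambda>x. (f x)\<^sup>2" j 1] V_int[of "\<lambda>_. 1" j 2] f2_bd j by simp
      fix w :: "(nat \<Rightarrow> real) \<times> real"
      define c where "c = (sin_mean s \<theta> n j (fst w))\<^sup>2 / real n + 1 / (real n)\<^sup>2"
      define Z where "Z = wt (snd w) * wt (fst w j)"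
      have c: "0 \<le> c" by (simp add: c_def)
      have "j < n" using j n by (meson div_less_dividend le_less_trans less_2_cases_iff one_less_numeral_iff semiring_norm(76))
      then have "(sin_mean s \<theta> n j (fst w))\<^sup>2 \<le> 1" by (rule sin_mean_square_le)
      moreover have "1 / (real n)\<^sup>2 \<le> 1 / real n" using n by (simp add: power2_eq_square divide_simps)
      ultimately have c2: "c \<le> 2 / real n"
        using divide_right_mono[of "(sin_mean s \<theta> n j (fst w))\<^sup>2" 1 "real n"] by (simp add: c_def)
      have "(\<Delta> j w)\<^sup>2 \<le> T * (Z * c)" using \<Delta>_le[OF j, of w] by (simp add: V_def Z_def c_def)
      then have a: "4 * (f (fst w))\<^sup>2 * (\<Delta> j w)\<^sup>2 \<le> 4 * (f (fst w))\<^sup>2 * (T * (Z * c))"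
        by (intro mult_left_mono) auto
      \<comment> \<open>One of the two factors \<open>c\<close> is given up for
        \<open>2 / n\<close>; the rest is exactly the summand \<open>V\<close> with weight exponent
        2.\<close>
      have "((\<Delta> j w)\<^sup>2)\<^sup>2 \<le> (T * (Z * c))\<^sup>2"
        using \<open>(\<Delta> j w)\<^sup>2 \<le> T * (Z * c)\<close> by (intro power_mono) auto
      also have "\<dots> = T\<^sup>2 * Z\<^sup>2 * c * c" by (simp add: power2_eq_square mult_ac)
      also have "\<dots> \<le> T\<^sup>2 * Z\<^sup>2 * c * (2 / real n)" using c c2 by (intro mult_left_mono) auto
      finally have b: "(\<Delta> j w) ^ 4 \<le> 2 * T\<^sup>2 / real n * (Z\<^sup>2 * c)" by (simp add: power_mult[symmetric] mult_ac)
      show "4 * (f (fst w))\<^sup>2 * (\<Delta> j w)\<^sup>2 + (\<Delta> j w) ^ 4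
          \<le> 4 * T * V (\<lambda>x. (f x)\<^sup>2) 1 j w + 2 * T\<^sup>2 / real n * V (\<lambda>_. 1) 2 j w"
        using add_mono[OF a b] by (simp add: V_def Z_def c_def mult_ac)
    qed
    also have "\<dots> = 4 * T * (\<Sum>j\<le>n div 2. \<integral>w. V (\<lambda>x. (f x)\<^sup>2) 1 j w \<partial>?W)
        + 2 * T\<^sup>2 / real n * (\<Sum>j\<le>n div 2. \<integral>w. V (\<lambda>_. 1) 2 j w \<partial>?W)"
      using V_int[of "\<lambda>x. (f x)\<^sup>2" _ 1] V_int[of "\<lambda>_. 1" _ 2] f2_bd
      by (simp add: sum.distrib sum_distrib_left)
    also have "4 * T * (\<Sum>j\<le>n div 2. \<integral>w. V (\<lambda>x. (f x)\<^sup>2) 1 j w \<partial>?W) \<le> 4 * T * ((2 * D + 8 * C) * real n powr (- 3 / 2))"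
    proof (rule mult_left_mono)
      have "(\<Sum>j\<le>n div 2. \<integral>w. V (\<lambda>x. (f x)\<^sup>2) 1 j w \<partial>?W)
          \<le> 2 * (L / real n) * (\<integral>x. (f x)\<^sup>2 \<partial>?P) + 8 * (wt_moment (9 * 1))\<^sup>2 / (real n)\<^sup>2"
        using f2_bd by (intro rs) auto
      also have "2 * (L / real n) * (\<integral>x. (f x)\<^sup>2 \<partial>?P) \<le> 2 * (L / real n) * (D * real n powr (- 3 / 4))"
        using Ef2 L by (intro mult_left_mono) auto
      also have "\<dots> = 2 * D * real n powr (- 3 / 2)"
        unfolding Ln using powr_add[of "real n" "- 3 / 4" "- 3 / 4"] by simp
      also have "8 * (wt_moment (9 * 1))\<^sup>2 / (real n)\<^sup>2 \<le> 8 * C * real n powr (- 3 / 2)"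
        using tail[OF m9] mult_left_mono[OF pw[of "- 3 / 2"], of "8 * C"] C by linarith
      finally show "(\<Sum>j\<le>n div 2. \<integral>w. V (\<lambda>x. (f x)\<^sup>2) 1 j w \<partial>?W) \<le> (2 * D + 8 * C) * real n powr (- 3 / 2)"
        by (simp add: algebra_simps)
    qed (use T in simp)
    also have "2 * T\<^sup>2 / real n * (\<Sum>j\<le>n div 2. \<integral>w. V (\<lambda>_. 1) 2 j w \<partial>?W) \<le> 2 * T\<^sup>2 * ((2 + 8 * C) * real n powr (- 3 / 2))"
    proof -
      have "(\<Sum>j\<le>n div 2. \<integral>w. V (\<lambda>_. 1) 2 j w \<partial>?W) \<le> 2 * (L / real n) + 8 * C * (1 / (real n)\<^sup>2)"
        using rs[of "\<lambda>_. 1" 2] tail[OF m18] by (simp add: K.prob_space)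
      also have "\<dots> \<le> 2 * real n powr (- 1 / 2) + 8 * C * real n powr (- 1 / 2)"
        using pw[of "- 1 / 2"] C n1 unfolding Ln by (intro add_mono mult_left_mono powr_mono) auto
      finally have "2 * T\<^sup>2 / real n * (\<Sum>j\<le>n div 2. \<integral>w. V (\<lambda>_. 1) 2 j w \<partial>?W)
          \<le> 2 * T\<^sup>2 / real n * (2 * real n powr (- 1 / 2) + 8 * C * real n powr (- 1 / 2))"
        by (intro mult_left_mono) auto
      also have "\<dots> = 2 * T\<^sup>2 * ((2 + 8 * C) * (real n powr (- 1 / 2) / real n))"
        by (simp add: algebra_simps add_divide_distrib)
      also have "real n powr (- 1 / 2) / real n = real n powr (- 3 / 2)"
        using n powr_diff[of "real n" "- 1 / 2" 1] by simp
      finally show ?thesis .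
    qed
    also have "(\<integral>x. (f x)\<^sup>2 \<partial>?P)\<^sup>2 \<le> (D * real n powr (- 3 / 4))\<^sup>2"
      using Ef2 f2_bd by (intro power_mono Bochner_Integration.integral_nonneg) auto
    also have "\<dots> = D\<^sup>2 * real n powr (- 3 / 2)"
      using powr_add[of "real n" "- 3 / 4" "- 3 / 4"] by (simp add: power2_eq_square mult_ac)
    finally have "(\<integral>x. (f x) ^ 4 \<partial>?P) \<le> D\<^sup>2 * real n powr (- 3 / 2)
        + (4 * T * ((2 * D + 8 * C) * real n powr (- 3 / 2)) + 2 * T\<^sup>2 * ((2 + 8 * C) * real n powr (- 3 / 2)))" by simp
    then show ?thesis by (simp add: f_def h_def algebra_simps)
  qed
  then show ?thesis by (rule that)
qed

end

section \<open>Expectations\<close>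

lemma fold_weight_eq_2:
  assumes "0 < j" "j < n div 2"
  shows "fold_weight n j = 2"
proof -
  have "{d. d < n \<and> min d (n - d) = j} = {j, n - j}"
    using assms by (auto simp: min_def)
  moreover have "j \<noteq> n - j" using assms by auto
  ultimately show ?thesis by (simp add: fold_weight_def)
qed

text \<open>The sum is the variance of the normalized eigenvalue \<open>k\<close> for standardized
  entries. With w the fold weight, w^2 = 2 w - w (2 - w): the first part gives \<open>n\<close> by
  orthogonality of cosines, the second lives on the end points 0 and \<open>n div 2\<close>. If
  \<open>n\<close> divides \<open>2 * k\<close>, all cosines are 1 or -1 and the variance is near 2
  instead.\<close>

lemma fold_weight_cos_square_sum:
  assumes k: "k < n" "\<not> n dvd 2 * k"
  shows "\<bar>(\<Sum>j\<le>n div 2. (fold_weight n j * cos (angle n j k) / sqrt (real n))\<^sup>2) - 1\<bar> \<le> 2 / real n"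
proof -
  have n: "n > 0" using k by simp
  define e where "e j = fold_weight n j * (2 - fold_weight n j)" for j
  define c where "c j = (cos (angle n j k))\<^sup>2" for j
  have c: "0 \<le> c j" "c j \<le> 1" for j by (auto simp: c_def abs_square_le_1)
  have e: "0 \<le> e j" "e j \<le> 1" for j
  proof -
    show "0 \<le> e j" using fold_weight_bounds[of n j] by (simp add: e_def)
    \<comment> \<open>Indeed \<open>e j\<close> is 1 minus the square of
      \<open>fold_weight n j - 1\<close>.\<close>
    show "e j \<le> 1" using zero_le_power2[of "fold_weight n j - 1"] by (simp add: e_def power2_eq_square algebra_simps)
  qed
  have "(\<Sum>j\<le>n div 2. fold_weight n j * c j) = (\<Sum>d<n. c (min d (n - d)))"
    by (rule sum_fold[OF n, symmetric])
  also have "\<dots> = (\<Sum>d<n. cos (angle n d k) * cos (angle n d k))"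
    by (intro sum.cong refl) (simp add: c_def cos_angle_fold power2_eq_square)
  also have "\<dots> = real n / 2"
    using k by (simp add: sum_cos_mult_cos mult_2)
  finally have s1: "(\<Sum>j\<le>n div 2. fold_weight n j * c j) = real n / 2" .
  have s2: "0 \<le> (\<Sum>j\<le>n div 2. e j * c j)" by (intro sum_nonneg mult_nonneg_nonneg e c)
  have "(\<Sum>j\<le>n div 2. e j * c j) = (\<Sum>j\<in>{0, n div 2}. e j * c j)"
    by (intro sum.mono_neutral_right) (auto simp: e_def intro!: fold_weight_eq_2)
  also have "\<dots> \<le> (\<Sum>j\<in>{0, n div 2}. 1)"
    by (intro sum_mono mult_le_one e c)
  also have "\<dots> \<le> 2" by (simp add: card_insert_if)
  finally have s3: "(\<Sum>j\<le>n div 2. e j * c j) \<le> 2" .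
  have "(\<Sum>j\<le>n div 2. (fold_weight n j * cos (angle n j k) / sqrt (real n))\<^sup>2)
      = (\<Sum>j\<le>n div 2. 2 * (fold_weight n j * c j) - e j * c j) / real n"
    unfolding sum_divide_distrib
    by (intro sum.cong refl) (simp add: power_divide power_mult_distrib c_def e_def power2_eq_square algebra_simps)
  also have "\<dots> = (real n - (\<Sum>j\<le>n div 2. e j * c j)) / real n"
    by (simp only: sum_subtractf sum_distrib_left[symmetric] s1) simp
  finally have "(\<Sum>j\<le>n div 2. (fold_weight n j * cos (angle n j k) / sqrt (real n))\<^sup>2) - 1 = - ((\<Sum>j\<le>n div 2. e j * c j) / real n)"
    using n by (simp add: diff_divide_distrib)
  then show ?thesis using s2 s3 by (simp add: divide_right_mono)
qed

section \<open>Gaussian approximation of characteristic functions\<close>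

text \<open>The upper bound inverts the quadratic lower bound for \<open>exp v\<close>, using (1 - v
  + v^2 / 2) (1 + v + v^2 / 2) = 1 + v^4 / 4.\<close>

lemma exp_minus_taylor_bound:
  fixes v :: real
  assumes "v \<ge> 0"
  shows "\<bar>exp (- v) - (1 - v)\<bar> \<le> v\<^sup>2 / 2"
proof -
  have "1 + v + v\<^sup>2 / 2 \<le> exp v" using exp_lower_Taylor_quadratic[OF assms] .
  moreover have "0 < 1 + v + v\<^sup>2 / 2" using assms by (simp add: add_pos_nonneg)
  ultimately have "exp (- v) \<le> 1 / (1 + v + v\<^sup>2 / 2)"
    by (simp add: exp_minus inverse_eq_divide frac_le)
  also have "1 / (1 + v + v\<^sup>2 / 2) \<le> 1 - v + v\<^sup>2 / 2"
  proof -
    have "(1 - v + v\<^sup>2 / 2) * (1 + v + v\<^sup>2 / 2) = 1 + (v\<^sup>2)\<^sup>2 / 4"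
      by (simp add: power2_eq_square field_simps)
    then have "1 \<le> (1 - v + v\<^sup>2 / 2) * (1 + v + v\<^sup>2 / 2)" by simp
    then show ?thesis using \<open>0 < 1 + v + v\<^sup>2 / 2\<close> by (simp add: pos_divide_le_eq)
  qed
  finally show ?thesis using exp_ge_add_one_self[of "- v"] by simp
qed

lemma abs_exp_minus_diff_le:
  fixes a b :: real
  assumes "0 \<le> a" "0 \<le> b"
  shows "\<bar>exp (- a) - exp (- b)\<bar> \<le> \<bar>a - b\<bar>"
proof -
  have *: "exp (- a) - exp (- b) \<le> b - a" if "0 \<le> a" "a \<le> b" for a b :: real
  proof -
    have "exp (- a) - exp (- b) = exp (- a) * (1 - exp (- (b - a)))" by (simp add: algebra_simps exp_add[symmetric])
    also have "\<dots> \<le> 1 * (b - a)"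
    proof (rule mult_mono)
      show "1 - exp (- (b - a)) \<le> b - a" using exp_ge_add_one_self[of "- (b - a)"] by linarith
    qed (use that in auto)
    finally show ?thesis by simp
  qed
  show ?thesis
  proof (cases "a \<le> b")
    case True
    then show ?thesis using *[of a b] assms by simp
  next
    case False
    then show ?thesis using *[of b a] assms by simp
  qed
qed

lemma cos_mean_add:
  "complex_of_real (cos_mean s 0 n x) + \<i> * complex_of_real (cos_mean s (pi / 2) n x)
    = (\<Sum>k<n. iexp (s * (circ_eig x n k / sqrt (real n)))) / real n"
proof -
  have "iexp y = complex_of_real (cos y) + \<i> * complex_of_real (sin y)" for y
    by (simp add: exp_Euler cos_of_real sin_of_real)
  then show ?thesis
    by (simp only: sum.distrib) (simp add: cos_mean_def cos_diff sum_distrib_left add_divide_distrib)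
qed

locale standardized_moments = finite_moments +
  assumes mean: "expectation (\<lambda>u. u) = 0"
    and var: "variance (\<lambda>u. u) = 1"
begin

lemma integral_iexp_circ_eig:
  assumes n: "n > 0"
  shows "(CLINT x|prod_law n. iexp (s * (circ_eig x n k / sqrt (real n))))
    = (\<Prod>j\<le>n div 2. char p (s * (fold_weight n j * cos (angle n j k) / sqrt (real n))))"
proof -
  interpret product_sigma_finite "\<lambda>_ :: nat. p" by standard
  define a where "a j = fold_weight n j * cos (angle n j k) / sqrt (real n)" for j
  have "iexp (s * (circ_eig x n k / sqrt (real n))) = (\<Prod>j\<le>n div 2. iexp ((s * a j) * x j))" for x
  proof -
    have "s * (circ_eig x n k / sqrt (real n)) = (\<Sum>j\<le>n div 2. (s * a j) * x j)"
      unfolding circ_eig_fold[OF n] a_def sum_divide_distrib sum_distrib_left by (simp add: mult_ac)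
    then show ?thesis by (simp add: exp_sum[symmetric] sum_distrib_left)
  qed
  then have "(CLINT x|prod_law n. iexp (s * (circ_eig x n k / sqrt (real n))))
      = (CLINT x|prod_law n. (\<Prod>j\<le>n div 2. iexp ((s * a j) * x j)))" by simp
  also have "\<dots> = (\<Prod>j\<le>n div 2. CLINT u|p. iexp ((s * a j) * u))"
    by (rule product_integral_prod) (auto intro!: integrable_iexp)
  finally show ?thesis by (simp add: char_def a_def)
qed

text \<open>Both functions are compared with 1 - u^2 / 2: the third moment controls the error for
  \<open>char p\<close>, and \<open>u ^ 4\<close> the one for the exponential.\<close>

lemma char_gaussian_bound:
  "cmod (char p u - exp (- (u\<^sup>2 / 2))) \<le> expectation (\<lambda>v. \<bar>v\<bar> ^ 3) * \<bar>u\<bar> ^ 3 + u ^ 4"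
proof -
  have int3: "integrable p (\<lambda>v. \<bar>v\<bar> ^ 3)" using integrable_abs[OF moments[of 3]] by (simp add: power_abs)
  have "cmod (char p u - (1 - u\<^sup>2 * 1 / 2)) \<le> (u\<^sup>2 / 6) * expectation (\<lambda>x. min (6 * x\<^sup>2) (\<bar>u\<bar> * \<bar>x\<bar> ^ 3))"
    using moments[of 1] moments[of 2] mean var by (intro char_approx3) auto
  also have "\<dots> \<le> (u\<^sup>2 / 6) * expectation (\<lambda>x. \<bar>u\<bar> * \<bar>x\<bar> ^ 3)"
  proof (intro mult_left_mono integral_mono)
    show "integrable p (\<lambda>x. min (6 * x\<^sup>2) (\<bar>u\<bar> * \<bar>x\<bar> ^ 3))"
      using moments[of 2] int3 by (intro integrable_min) auto
  qed (use int3 in auto)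
  also have "\<dots> = \<bar>u\<bar> ^ 3 * expectation (\<lambda>x. \<bar>x\<bar> ^ 3) / 6"
  proof -
    have "u\<^sup>2 * \<bar>u\<bar> = \<bar>u\<bar> ^ 3" by (simp add: power3_eq_cube power2_eq_square)
    then show ?thesis by (simp add: mult.assoc[symmetric])
  qed
  also have "\<dots> \<le> \<bar>u\<bar> ^ 3 * expectation (\<lambda>x. \<bar>x\<bar> ^ 3)" by simp
  finally have 1: "cmod (char p u - (1 - u\<^sup>2 / 2)) \<le> \<bar>u\<bar> ^ 3 * expectation (\<lambda>x. \<bar>x\<bar> ^ 3)" by simp
  have "cmod (complex_of_real (1 - u\<^sup>2 / 2) - complex_of_real (exp (- (u\<^sup>2 / 2)))) = \<bar>exp (- (u\<^sup>2 / 2)) - (1 - u\<^sup>2 / 2)\<bar>"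
    by (simp only: of_real_diff[symmetric] norm_of_real abs_minus_commute)
  also have "\<dots> \<le> (u\<^sup>2 / 2)\<^sup>2 / 2" by (rule exp_minus_taylor_bound) simp
  also have "\<dots> \<le> u ^ 4" by (simp add: power_divide power_mult[symmetric])
  finally have 2: "cmod (complex_of_real (1 - u\<^sup>2 / 2) - complex_of_real (exp (- (u\<^sup>2 / 2)))) \<le> u ^ 4" .
  have "char p u - exp (- (u\<^sup>2 / 2)) = (char p u - (1 - u\<^sup>2 / 2)) + (complex_of_real (1 - u\<^sup>2 / 2) - complex_of_real (exp (- (u\<^sup>2 / 2))))"
    by (simp add: exp_of_real[symmetric])
  then show ?thesis using norm_triangle_mono[OF 1 2] by (simp add: mult.commute)
qed

text \<open>The product of characteristic functions is replaced factor by factor by Gaussians: at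
  most \<open>n\<close> factors, each with argument O(n^(-1/2)) and so with error O(n^(-3/2)). The
  resulting Gaussian has variance parameter \<open>\<sigma>\<close>, which is within 2 / n of
  1.\<close>

lemma integral_iexp_circ_eig_bound:
  assumes k: "k < n" "\<not> n dvd 2 * k"
  shows "cmod ((CLINT x|prod_law n. iexp (s * (circ_eig x n k / sqrt (real n)))) - exp (- (s\<^sup>2 / 2)))
    \<le> (8 * expectation (\<lambda>v. \<bar>v\<bar> ^ 3) * \<bar>s\<bar> ^ 3 + 16 * s ^ 4 + s\<^sup>2) / sqrt (real n)"
proof -
  have n: "n > 0" using k by simp
  define m3 where "m3 = expectation (\<lambda>v. \<bar>v\<bar> ^ 3)"
  have m3: "m3 \<ge> 0" by (simp add: m3_def)
  define a where "a j = fold_weight n j * cos (angle n j k) / sqrt (real n)" for j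
  define \<sigma> where "\<sigma> = (\<Sum>j\<le>n div 2. (a j)\<^sup>2)"
  have sq: "sqrt (real n) \<ge> 1" using n by simp
  have nsq: "real n = sqrt (real n) ^ 2" by simp
  have inv_le: "1 / real n \<le> 1 / sqrt (real n)"
    using n sq by (intro divide_left_mono) (auto intro!: real_le_lsqrt simp: power2_eq_square)
  have a_le: "\<bar>a j\<bar> \<le> 2 / sqrt (real n)" for j
  proof -
    have "\<bar>fold_weight n j * cos (angle n j k)\<bar> \<le> 2 * 1"
      unfolding abs_mult using fold_weight_bounds[of n j] by (intro mult_mono) auto
    then show ?thesis by (simp add: a_def abs_divide divide_right_mono)
  qed
  have term_le: "cmod (char p (s * a j) - exp (- ((s * a j)\<^sup>2 / 2))) \<le> (8 * m3 * \<bar>s\<bar> ^ 3 + 16 * s ^ 4) / (real n * sqrt (real n))" for j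
  proof -
    have "cmod (char p (s * a j) - exp (- ((s * a j)\<^sup>2 / 2))) \<le> m3 * \<bar>s * a j\<bar> ^ 3 + (s * a j) ^ 4"
      unfolding m3_def by (rule char_gaussian_bound)
    also have "\<dots> \<le> m3 * (\<bar>s\<bar> ^ 3 * (8 / (real n * sqrt (real n)))) + s ^ 4 * (16 / (real n * sqrt (real n)))"
    proof (intro add_mono mult_left_mono m3)
      have "\<bar>s * a j\<bar> ^ 3 \<le> \<bar>s\<bar> ^ 3 * (2 / sqrt (real n)) ^ 3"
        unfolding abs_mult power_mult_distrib by (intro mult_left_mono power_mono a_le) auto
      also have "(2 / sqrt (real n)) ^ 3 = 8 / (real n * sqrt (real n))"
        by (simp add: power_divide power3_eq_cube)
      finally show "\<bar>s * a j\<bar> ^ 3 \<le> \<bar>s\<bar> ^ 3 * (8 / (real n * sqrt (real n)))" .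
      have "(s * a j) ^ 4 \<le> s ^ 4 * (2 / sqrt (real n)) ^ 4"
        using power_mono[OF a_le[of j], of 4] unfolding power_mult_distrib by (intro mult_left_mono) auto
      also have "(2 / sqrt (real n)) ^ 4 = 16 / (real n * real n)"
        by (simp add: power_divide power4_eq_xxxx mult.assoc)
      also have "s ^ 4 * (16 / (real n * real n)) \<le> s ^ 4 * (16 / (real n * sqrt (real n)))"
      proof -
        have "sqrt (real n) \<le> real n" using n by (intro real_le_lsqrt) (auto simp: power2_eq_square)
        then have "16 / (real n * real n) \<le> 16 / (real n * sqrt (real n))"
          using n by (intro divide_left_mono mult_left_mono) auto
        then show ?thesis by (intro mult_left_mono) auto
      qed
      finally show "(s * a j) ^ 4 \<le> s ^ 4 * (16 / (real n * sqrt (real n)))" .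
    qed
    finally show ?thesis by (simp add: add_divide_distrib mult_ac)
  qed
  have "cmod ((\<Prod>j\<le>n div 2. char p (s * a j)) - (\<Prod>j\<le>n div 2. complex_of_real (exp (- ((s * a j)\<^sup>2 / 2)))))
      \<le> (\<Sum>j\<le>n div 2. cmod (char p (s * a j) - complex_of_real (exp (- ((s * a j)\<^sup>2 / 2)))))"
    by (rule norm_prod_diff) (auto simp: cmod_char_le_1)
  also have "\<dots> \<le> (\<Sum>j\<le>n div 2. (8 * m3 * \<bar>s\<bar> ^ 3 + 16 * s ^ 4) / (real n * sqrt (real n)))"
    using term_le by (intro sum_mono) (simp add: exp_of_real)
  also have "\<dots> = real (n div 2 + 1) * ((8 * m3 * \<bar>s\<bar> ^ 3 + 16 * s ^ 4) / (real n * sqrt (real n)))" by simp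
  also have "\<dots> \<le> real n * ((8 * m3 * \<bar>s\<bar> ^ 3 + 16 * s ^ 4) / (real n * sqrt (real n)))"
  proof (rule mult_right_mono)
    have "n div 2 + 1 \<le> n" using n by presburger
    then show "real (n div 2 + 1) \<le> real n" by (rule of_nat_mono)
  qed (use m3 in simp)
  also have "\<dots> = (8 * m3 * \<bar>s\<bar> ^ 3 + 16 * s ^ 4) / sqrt (real n)" using n by simp
  finally have 1: "cmod ((\<Prod>j\<le>n div 2. char p (s * a j)) - (\<Prod>j\<le>n div 2. complex_of_real (exp (- ((s * a j)\<^sup>2 / 2)))))
      \<le> (8 * m3 * \<bar>s\<bar> ^ 3 + 16 * s ^ 4) / sqrt (real n)" .
  have "(\<Prod>j\<le>n div 2. exp (- ((s * a j)\<^sup>2 / 2))) = exp (- (s\<^sup>2 * \<sigma> / 2))"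
    unfolding \<sigma>_def exp_sum[OF finite_atMost, symmetric]
    by (simp add: sum_negf sum_distrib_left sum_divide_distrib power_mult_distrib)
  then have prod_eq: "(\<Prod>j\<le>n div 2. complex_of_real (exp (- ((s * a j)\<^sup>2 / 2)))) = complex_of_real (exp (- (s\<^sup>2 * \<sigma> / 2)))"
    by (metis of_real_prod)
  have "cmod (complex_of_real (exp (- (s\<^sup>2 * \<sigma> / 2))) - complex_of_real (exp (- (s\<^sup>2 / 2)))) = \<bar>exp (- (s\<^sup>2 * \<sigma> / 2)) - exp (- (s\<^sup>2 / 2))\<bar>"
    by (simp only: of_real_diff[symmetric] norm_of_real)
  also have "\<dots> \<le> \<bar>s\<^sup>2 * \<sigma> / 2 - s\<^sup>2 / 2\<bar>"
    by (rule abs_exp_minus_diff_le) (auto simp: \<sigma>_def sum_nonneg)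
  also have "\<dots> = s\<^sup>2 / 2 * \<bar>\<sigma> - 1\<bar>"
  proof -
    have "s\<^sup>2 * \<sigma> / 2 - s\<^sup>2 / 2 = s\<^sup>2 / 2 * (\<sigma> - 1)" by (simp add: algebra_simps)
    then show ?thesis by (simp only: abs_mult) simp
  qed
  also have "\<dots> \<le> s\<^sup>2 / 2 * (2 / real n)"
    using fold_weight_cos_square_sum[OF k] by (intro mult_left_mono) (simp_all add: \<sigma>_def a_def)
  also have "\<dots> \<le> s\<^sup>2 / sqrt (real n)" using mult_left_mono[OF inv_le, of "s\<^sup>2"] by simp
  finally have 2: "cmod (complex_of_real (exp (- (s\<^sup>2 * \<sigma> / 2))) - complex_of_real (exp (- (s\<^sup>2 / 2)))) \<le> s\<^sup>2 / sqrt (real n)" .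
  have "cmod ((\<Prod>j\<le>n div 2. char p (s * a j)) - complex_of_real (exp (- (s\<^sup>2 / 2))))
      \<le> (8 * m3 * \<bar>s\<bar> ^ 3 + 16 * s ^ 4) / sqrt (real n) + s\<^sup>2 / sqrt (real n)"
    using norm_triangle_mono[OF 1 2] by (simp add: prod_eq)
  then show ?thesis
    unfolding integral_iexp_circ_eig[OF n] a_def[symmetric] m3_def[symmetric]
    by (simp add: exp_of_real add_divide_distrib)
qed

text \<open>The indices with \<open>n\<close> dividing \<open>2 * k\<close> lie in
  \<open>{0, n div 2}\<close>. They are estimated trivially by 2 each, which costs
  \<open>4 / n\<close> in the mean.\<close>

lemma tendsto_mean_iexp:
  "(\<lambda>n. (CLINT x|prod_law n. (\<Sum>k<n. iexp (s * (circ_eig x n k / sqrt (real n)))) / real n)) \<longlonglongrightarrow> exp (- (s\<^sup>2 / 2))"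
proof -
  define K where "K = 8 * expectation (\<lambda>v. \<bar>v\<bar> ^ 3) * \<bar>s\<bar> ^ 3 + 16 * s ^ 4 + s\<^sup>2"
  have K: "K \<ge> 0" by (simp add: K_def)
  have bound: "cmod ((CLINT x|prod_law n. (\<Sum>k<n. iexp (s * (circ_eig x n k / sqrt (real n)))) / real n) - exp (- (s\<^sup>2 / 2)))
      \<le> K / sqrt (real n) + 4 / real n" if n: "n > 0" for n
  proof -
    interpret Q: prob_space "prod_law n" by (rule prob_space_prod_law)
    define E where "E k = (CLINT x|prod_law n. iexp (s * (circ_eig x n k / sqrt (real n))))" for k
    define g where "g = complex_of_real (exp (- (s\<^sup>2 / 2)))"
    note [measurable] = circ_eig_measurable[OF n]
    have int: "integrable (prod_law n) (\<lambda>x. iexp (s * (circ_eig x n k / sqrt (real n))))" for k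
      by (rule Q.integrable_iexp) auto
    have "(CLINT x|prod_law n. (\<Sum>k<n. iexp (s * (circ_eig x n k / sqrt (real n)))) / real n) = (\<Sum>k<n. E k) / real n"
      unfolding E_def using int by (simp add: Bochner_Integration.integral_sum)
    also have "\<dots> - g = (\<Sum>k<n. E k - g) / real n"
      using n by (simp add: sum_subtractf diff_divide_distrib)
    finally have eq: "(CLINT x|prod_law n. (\<Sum>k<n. iexp (s * (circ_eig x n k / sqrt (real n)))) / real n) - g = (\<Sum>k<n. E k - g) / real n" .
    have E1: "cmod (E k - g) \<le> 2" for k
    proof -
      have "cmod (E k) \<le> (\<integral>x. cmod (iexp (s * (circ_eig x n k / sqrt (real n)))) \<partial>prod_law n)"
        unfolding E_def by (rule integral_norm_bound)
      also have "\<dots> = 1" using Q.prob_space by simp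
      finally have "cmod (E k) \<le> 1" .
      moreover have "cmod g \<le> 1" by (simp add: g_def)
      ultimately show ?thesis using norm_triangle_ineq4[of "E k" g] by linarith
    qed
    have "cmod (\<Sum>k<n. E k - g) \<le> (\<Sum>k<n. K / sqrt (real n) + (if k \<in> {0, n div 2} then 2 else 0))"
    proof (rule order_trans[OF norm_sum], intro sum_mono)
      fix k assume "k \<in> {..<n}"
      then have k: "k < n" by simp
      show "cmod (E k - g) \<le> K / sqrt (real n) + (if k \<in> {0, n div 2} then 2 else 0)"
      proof (cases "n dvd 2 * k")
        case True
        then obtain q where q: "2 * k = n * q" by auto
        then have "n * q < n * 2" using k by linarith
        then have "q < 2" by simp
        then have "k \<in> {0, n div 2}" using q by (auto simp: less_2_cases_iff)
        moreover have "0 \<le> K / sqrt (real n)" using K by simp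
        ultimately show ?thesis using E1[of k] by (simp only: if_True)
      next
        case False
        then show ?thesis
          using integral_iexp_circ_eig_bound[OF k False, of s] by (auto simp: E_def g_def K_def exp_of_real)
      qed
    qed
    also have "\<dots> = real n * (K / sqrt (real n)) + (\<Sum>k\<in>{..<n} \<inter> {0, n div 2}. 2)"
      unfolding sum.distrib sum.inter_restrict[OF finite_lessThan, symmetric] by simp
    also have "(\<Sum>k\<in>{..<n} \<inter> {0, n div 2}. 2) \<le> (\<Sum>k\<in>{0, n div 2}. 2 :: real)"
      by (intro sum_mono2) auto
    also have "\<dots> \<le> 4" by (simp add: card_insert_if)
    finally have "cmod (\<Sum>k<n. E k - g) / real n \<le> (real n * (K / sqrt (real n)) + 4) / real n"
      by (intro divide_right_mono) auto
    then show ?thesis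
      using n eq by (simp add: g_def norm_divide add_divide_distrib exp_of_real)
  qed
  have "(\<lambda>n. K / sqrt (real n) + 4 / real n) \<longlonglongrightarrow> 0 + 0"
  proof (intro tendsto_add)
    show "(\<lambda>n. K / sqrt (real n)) \<longlonglongrightarrow> 0"
      by (intro tendsto_divide_0[OF tendsto_const] filterlim_at_top_imp_at_infinity
          filterlim_compose[OF sqrt_at_top filterlim_real_sequentially])
    show "(\<lambda>n. 4 / real n) \<longlonglongrightarrow> 0" by (rule lim_const_over_n)
  qed
  then have "(\<lambda>n. K / sqrt (real n) + 4 / real n) \<longlonglongrightarrow> 0" by simp
  then have "(\<lambda>n. (CLINT x|prod_law n. (\<Sum>k<n. iexp (s * (circ_eig x n k / sqrt (real n)))) / real n) - exp (- (s\<^sup>2 / 2))) \<longlonglongrightarrow> 0"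
    by (rule Lim_null_comparison[rotated]) (use bound in \<open>auto intro!: eventually_mono[OF eventually_gt_at_top[of 0]]\<close>)
  then show ?thesis by (simp add: LIM_zero_iff)
qed

lemma tendsto_mean_cos_mean:
  "(\<lambda>n. \<integral>x. cos_mean s 0 n x \<partial>prod_law n) \<longlonglongrightarrow> exp (- (s\<^sup>2 / 2))"
  "(\<lambda>n. \<integral>x. cos_mean s (pi / 2) n x \<partial>prod_law n) \<longlonglongrightarrow> 0"
proof -
  have eq: "(CLINT x|prod_law n. (\<Sum>k<n. iexp (s * (circ_eig x n k / sqrt (real n)))) / real n)
      = complex_of_real (\<integral>x. cos_mean s 0 n x \<partial>prod_law n) + \<i> * complex_of_real (\<integral>x. cos_mean s (pi / 2) n x \<partial>prod_law n)"
    if n: "n > 0" for n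
  proof -
    interpret Q: prob_space "prod_law n" by (rule prob_space_prod_law)
    have int: "integrable (prod_law n) (cos_mean s \<theta> n)" for \<theta>
      using cos_mean_measurable[OF n] abs_cos_mean_le by (rule Q.integrable_bounded)
    show ?thesis
      unfolding cos_mean_add[symmetric] using int by simp
  qed
  have lim: "(\<lambda>n. complex_of_real (\<integral>x. cos_mean s 0 n x \<partial>prod_law n) + \<i> * complex_of_real (\<integral>x. cos_mean s (pi / 2) n x \<partial>prod_law n))
      \<longlonglongrightarrow> complex_of_real (exp (- (s\<^sup>2 / 2)))"
  proof (rule Lim_transform_eventually)
    show "(\<lambda>n. (CLINT x|prod_law n. (\<Sum>k<n. iexp (s * (circ_eig x n k / sqrt (real n)))) / real n)) \<longlonglongrightarrow> complex_of_real (exp (- (s\<^sup>2 / 2)))"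
      using tendsto_mean_iexp[of s] by (simp add: exp_of_real)
  qed (use eq in \<open>auto intro!: eventually_mono[OF eventually_gt_at_top[of 0]]\<close>)
  show "(\<lambda>n. \<integral>x. cos_mean s 0 n x \<partial>prod_law n) \<longlonglongrightarrow> exp (- (s\<^sup>2 / 2))"
    using tendsto_Re[OF lim] by simp
  show "(\<lambda>n. \<integral>x. cos_mean s (pi / 2) n x \<partial>prod_law n) \<longlonglongrightarrow> 0"
    using tendsto_Im[OF lim] by simp
qed

end

section \<open>Almost sure convergence\<close>

text \<open>The series of the \<open>f n\<close> has finite integral, so it converges almost
  everywhere and its terms tend to 0.\<close>

lemma AE_tendsto_0_of_summable_integral:
  fixes f :: "nat \<Rightarrow> 'a \<Rightarrow> real"
  assumes int: "\<And>n. integrable M (f n)" and nonneg: "\<And>n \<omega>. 0 \<le> f n \<omega>"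
    and sum: "summable (\<lambda>n. \<integral>\<omega>. f n \<omega> \<partial>M)"
  shows "AE \<omega> in M. (\<lambda>n. f n \<omega>) \<longlonglongrightarrow> 0"
proof -
  have [measurable]: "f n \<in> borel_measurable M" for n using int[of n] by auto
  have "(\<integral>\<^sup>+\<omega>. (\<Sum>n. ennreal (f n \<omega>)) \<partial>M) = (\<Sum>n. \<integral>\<^sup>+\<omega>. ennreal (f n \<omega>) \<partial>M)"
    by (rule nn_integral_suminf) measurable
  also have "\<dots> = (\<Sum>n. ennreal (\<integral>\<omega>. f n \<omega> \<partial>M))"
    using int nonneg by (intro suminf_cong nn_integral_eq_integral) auto
  also have "\<dots> = ennreal (\<Sum>n. \<integral>\<omega>. f n \<omega> \<partial>M)"
    using sum nonneg by (intro suminf_ennreal2) auto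
  finally have "(\<integral>\<^sup>+\<omega>. (\<Sum>n. ennreal (f n \<omega>)) \<partial>M) \<noteq> \<infinity>" by simp
  then have "AE \<omega> in M. (\<Sum>n. ennreal (f n \<omega>)) \<noteq> \<infinity>"
    by (intro nn_integral_PInf_AE) measurable
  then show ?thesis
  proof eventually_elim
    case (elim \<omega>)
    then have "summable (\<lambda>n. f n \<omega>)" using nonneg by (intro summable_suminf_not_top) auto
    then show ?case by (rule summable_LIMSEQ_zero)
  qed
qed

section \<open>Uniformity in the frequency\<close>

lemma abs_cos_diff_le: "\<bar>cos a - cos b\<bar> \<le> \<bar>a - b\<bar>" for a b :: real
proof -
  have "cmod (cis (a - b) - 1) \<le> \<bar>a - b\<bar>"
    using iexp_approx1[of "a - b" 0] by (simp add: cis_conv_exp)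
  then have "cmod (cis b * (cis (a - b) - 1)) \<le> \<bar>a - b\<bar>" by (simp add: norm_mult)
  moreover have "cis b * (cis (a - b) - 1) = cis a - cis b" by (simp add: right_diff_distrib cis_mult)
  ultimately show ?thesis using abs_Re_le_cmod[of "cis a - cis b"] by simp
qed

text \<open>The mean of \<open>\<bar>y k\<bar>\<close> is a Lipschitz constant. It is at most 1 plus
  the mean of the squares, which \<open>circ_eig_square_sum_le\<close> bounds by
  \<open>2 * B\<close>.\<close>

lemma cos_mean_lipschitz:
  assumes n: "n > 0" and B: "(\<Sum>j\<le>n. (x j)\<^sup>2) \<le> B * real n"
  shows "\<bar>cos_mean s \<theta> n x - cos_mean r \<theta> n x\<bar> \<le> (1 + 2 * B) * \<bar>s - r\<bar>"
proof -
  define y where "y k = circ_eig x n k / sqrt (real n)" for k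
  have "(\<Sum>k<n. (y k)\<^sup>2) = (\<Sum>k<n. (circ_eig x n k)\<^sup>2) / real n"
    by (simp add: y_def power_divide sum_divide_distrib)
  also have "\<dots> \<le> 2 * real n * (\<Sum>j\<le>n. (x j)\<^sup>2) / real n"
    by (intro divide_right_mono circ_eig_square_sum_le) simp
  also have "\<dots> = 2 * (\<Sum>j\<le>n. (x j)\<^sup>2)" using n by simp
  finally have y2: "(\<Sum>k<n. (y k)\<^sup>2) \<le> 2 * (B * real n)" using B by simp
  have "cos_mean s \<theta> n x - cos_mean r \<theta> n x = (\<Sum>k<n. cos (s * y k - \<theta>) - cos (r * y k - \<theta>)) / real n"
    by (simp add: cos_mean_def y_def sum_subtractf diff_divide_distrib)
  also have "\<bar>\<dots>\<bar> \<le> (\<Sum>k<n. \<bar>s - r\<bar> * (1 + (y k)\<^sup>2)) / real n"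
    unfolding abs_divide abs_of_nat
  proof (intro divide_right_mono order_trans[OF sum_abs] sum_mono)
    fix k
    have "\<bar>cos (s * y k - \<theta>) - cos (r * y k - \<theta>)\<bar> \<le> \<bar>(s - r) * y k\<bar>"
      using abs_cos_diff_le[of "s * y k - \<theta>" "r * y k - \<theta>"] by (simp add: left_diff_distrib)
    also have "\<dots> \<le> \<bar>s - r\<bar> * (1 + (y k)\<^sup>2)"
    proof -
      have "2 * \<bar>y k\<bar> \<le> 1 + (y k)\<^sup>2"
        using zero_le_power2[of "\<bar>y k\<bar> - 1"] by (simp add: power2_diff)
      then have "\<bar>y k\<bar> \<le> 1 + (y k)\<^sup>2" by linarith
      then show ?thesis unfolding abs_mult by (intro mult_left_mono) auto
    qed
    finally show "\<bar>cos (s * y k - \<theta>) - cos (r * y k - \<theta>)\<bar> \<le> \<bar>s - r\<bar> * (1 + (y k)\<^sup>2)" .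
  qed simp
  also have "(\<Sum>k<n. \<bar>s - r\<bar> * (1 + (y k)\<^sup>2)) / real n = \<bar>s - r\<bar> * ((real n + (\<Sum>k<n. (y k)\<^sup>2)) / real n)"
    by (simp add: sum_distrib_left[symmetric] sum.distrib)
  also have "\<dots> \<le> \<bar>s - r\<bar> * ((real n + 2 * (B * real n)) / real n)"
    using y2 by (intro mult_left_mono divide_right_mono) auto
  also have "\<dots> = (1 + 2 * B) * \<bar>s - r\<bar>" using n by (simp add: field_simps)
  finally show ?thesis .
qed

text \<open>A Lipschitz constant independent of \<open>n\<close> carries convergence from the
  rationals to every point of continuity of the limit; a countable set of frequencies therefore
  suffices.\<close>

lemma tendsto_lipschitz_rational:
  fixes f :: "nat \<Rightarrow> real \<Rightarrow> real"
  assumes lip: "\<And>n s r. n > 0 \<Longrightarrow> \<bar>f n s - f n r\<bar> \<le> K * \<bar>s - r\<bar>"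
    and rat: "\<And>r. r \<in> \<rat> \<Longrightarrow> (\<lambda>n. f n r) \<longlonglongrightarrow> g r" and g: "isCont g s"
  shows "(\<lambda>n. f n s) \<longlonglongrightarrow> g s"
proof (rule LIMSEQ_I)
  fix \<epsilon> :: real assume \<epsilon>: "\<epsilon> > 0"
  have K: "K \<ge> 0" using lip[of 1 1 0] by simp
  obtain \<delta> where \<delta>: "\<delta> > 0" "\<And>r. \<bar>r - s\<bar> < \<delta> \<Longrightarrow> \<bar>g r - g s\<bar> < \<epsilon> / 3"
    using g \<epsilon> unfolding continuous_at_eps_delta dist_real_def by (metis divide_pos_pos zero_less_numeral)
  define \<eta> where "\<eta> = min \<delta> (\<epsilon> / (3 * (K + 1)))"
  have "\<eta> > 0" using \<delta> \<epsilon> K by (simp add: \<eta>_def)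
  then obtain r where r: "r \<in> \<rat>" "s < r" "r < s + \<eta>" using Rats_dense_in_real[of s "s + \<eta>"] by auto
  have "K * \<bar>s - r\<bar> \<le> K * (\<epsilon> / (3 * (K + 1)))"
    using r K by (intro mult_left_mono) (auto simp: \<eta>_def)
  also have "\<dots> \<le> \<epsilon> / 3"
  proof -
    have "K / (K + 1) \<le> 1" using K by simp
    then have "\<epsilon> / 3 * (K / (K + 1)) \<le> \<epsilon> / 3 * 1" using \<epsilon> by (intro mult_left_mono) auto
    then show ?thesis by (simp add: mult_ac)
  qed
  finally have Kr: "K * \<bar>s - r\<bar> \<le> \<epsilon> / 3" .
  have gr: "\<bar>g r - g s\<bar> < \<epsilon> / 3" using r by (intro \<delta>) (auto simp: \<eta>_def)
  obtain N where N: "\<And>n. n \<ge> N \<Longrightarrow> \<bar>f n r - g r\<bar> < \<epsilon> / 3"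
    using LIMSEQ_D[OF rat[OF r(1)], of "\<epsilon> / 3"] \<epsilon> by auto
  show "\<exists>N. \<forall>n\<ge>N. norm (f n s - g s) < \<epsilon>"
  proof (intro exI[of _ "Suc N"] allI impI)
    fix n assume n: "n \<ge> Suc N"
    have "\<bar>f n s - f n r\<bar> \<le> \<epsilon> / 3" using lip[of n s r] Kr n by linarith
    moreover have "\<bar>f n r - g r\<bar> < \<epsilon> / 3" using N[of n] n by simp
    ultimately show "norm (f n s - g s) < \<epsilon>" using gr unfolding real_norm_def by linarith
  qed
qed

section \<open>Convergence along a given independent sequence\<close>

context standardized_moments
begin

text \<open>Passage from the sample space to \<open>prod_law n\<close>. Points of the product space
  are extensional on \<open>{..n div 2}\<close>, whereas a sample sequence has all indices;
  \<open>res\<close> says that \<open>F\<close> looks only at the common coordinates.\<close>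

lemma
  assumes M: "prob_space M" and X: "iid_sequence M p X"
    and F: "F \<in> borel_measurable (prod_law n)" and res: "\<And>y. F (restrict y {..n div 2}) = F y"
  shows iid_measurable: "(\<lambda>\<omega>. F (\<lambda>k. X k \<omega>)) \<in> borel_measurable M"
    and iid_integral: "(\<integral>\<omega>. (F (\<lambda>k. X k \<omega>) :: real) \<partial>M) = (\<integral>x. F x \<partial>prod_law n)"
proof -
  interpret M: prob_space M by fact
  let ?J = "{..n div 2}"
  have indep: "M.indep_vars (\<lambda>_. borel) X ?J"
    using X unfolding iid_sequence_def by (blast intro: M.indep_vars_subset)
  have law: "distr M borel (X k) = p" for k using X by (simp add: iid_sequence_def)
  have rv [measurable]: "X k \<in> borel_measurable M" for k
    using X by (simp add: iid_sequence_def M.indep_vars_def)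
  have sets: "sets (Pi\<^sub>M ?J (\<lambda>_. borel)) = sets (prod_law n)"
    by (intro sets_PiM_cong) auto
  have eq: "distr M (Pi\<^sub>M ?J (\<lambda>_. borel)) (\<lambda>\<omega>. \<lambda>i\<in>?J. X i \<omega>) = prod_law n"
    using indep by (subst (asm) M.indep_vars_iff_distr_eq_PiM) (auto simp: law)
  have m: "(\<lambda>\<omega>. \<lambda>i\<in>?J. X i \<omega>) \<in> measurable M (Pi\<^sub>M ?J (\<lambda>_. borel))"
    by (intro measurable_restrict) measurable
  have F': "F \<in> borel_measurable (Pi\<^sub>M ?J (\<lambda>_. borel))"
    using F by (simp add: measurable_cong_sets[OF sets refl])
  have FX: "F (\<lambda>i\<in>?J. X i \<omega>) = F (\<lambda>k. X k \<omega>)" for \<omega> by (rule res)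
  show "(\<lambda>\<omega>. F (\<lambda>k. X k \<omega>)) \<in> borel_measurable M"
    using measurable_compose[OF m F'] by (simp add: FX)
  show "(\<integral>\<omega>. F (\<lambda>k. X k \<omega>) \<partial>M) = (\<integral>x. F x \<partial>prod_law n)"
    unfolding eq[symmetric] by (subst integral_distr[OF m F']) (simp add: FX)
qed

lemma cos_mean_restrict: "n > 0 \<Longrightarrow> cos_mean s \<theta> n (restrict y {..n div 2}) = cos_mean s \<theta> n y"
  by (simp add: cos_mean_def circ_eig_fold)

text \<open>The fourth central moments are summable because 3 / 2 > 1. The index is shifted by
  \<open>Suc\<close> since the estimates are for positive \<open>n\<close>.\<close>

lemma AE_cos_mean_centered:
  assumes M: "prob_space M" and X: "iid_sequence M p X"
  shows "AE \<omega> in M. (\<lambda>n. cos_mean s \<theta> n (\<lambda>k. X k \<omega>) - (\<integral>x. cos_mean s \<theta> n x \<partial>prod_law n)) \<longlonglongrightarrow> 0"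
proof -
  interpret M: prob_space M by fact
  define f where "f n x = (cos_mean s \<theta> n x - (\<integral>x. cos_mean s \<theta> n x \<partial>prod_law n)) ^ 4" for n x
  obtain C where C: "\<And>n. n > 0 \<Longrightarrow> (\<integral>x. f n x \<partial>prod_law n) \<le> C * real n powr (- 3 / 2)"
    using cos_mean_fourth_moment[of s] unfolding f_def by metis
  have meas: "f n \<in> borel_measurable (prod_law n)" if "n > 0" for n
    unfolding f_def using cos_mean_measurable[OF that, of s \<theta>] by measurable
  have res: "f n (restrict y {..n div 2}) = f n y" if "n > 0" for n y
    using cos_mean_restrict[OF that] by (simp add: f_def)
  have bd: "\<bar>f n x\<bar> \<le> 2 ^ 4" if "n > 0" for n x
  proof -
    interpret Q: prob_space "prod_law n" by (rule prob_space_prod_law)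
    have "\<bar>\<integral>x. cos_mean s \<theta> n x \<partial>prod_law n\<bar> \<le> 1"
      using cos_mean_measurable[OF that] abs_cos_mean_le by (rule Q.abs_integral_le_bound)
    then have "\<bar>cos_mean s \<theta> n x - (\<integral>x. cos_mean s \<theta> n x \<partial>prod_law n)\<bar> \<le> 2"
      using abs_cos_mean_le[of s \<theta> n x] by linarith
    from power_mono[OF this, of 4] show ?thesis by (simp add: f_def)
  qed
  have "AE \<omega> in M. (\<lambda>n. f (Suc n) (\<lambda>k. X k \<omega>)) \<longlonglongrightarrow> 0"
  proof (rule AE_tendsto_0_of_summable_integral)
    show "integrable M (\<lambda>\<omega>. f (Suc n) (\<lambda>k. X k \<omega>))" for n
      using bd[of "Suc n"] iid_measurable[OF M X meas res, of "Suc n"] by (intro M.integrable_bounded) auto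
    show "0 \<le> f (Suc n) (\<lambda>k. X k \<omega>)" for n \<omega> by (simp add: f_def)
    show "summable (\<lambda>n. \<integral>\<omega>. f (Suc n) (\<lambda>k. X k \<omega>) \<partial>M)"
    proof (rule summable_comparison_test')
      have "summable (\<lambda>n. real n powr (- 3 / 2))" by (simp add: summable_real_powr_iff)
      then have "summable (\<lambda>n. real (Suc n) powr (- 3 / 2))" by (subst summable_Suc_iff)
      then show "summable (\<lambda>n. C * real (Suc n) powr (- 3 / 2))" by (rule summable_mult)
      fix n :: nat
      have "(\<integral>\<omega>. f (Suc n) (\<lambda>k. X k \<omega>) \<partial>M) = (\<integral>x. f (Suc n) x \<partial>prod_law (Suc n))"
        by (rule iid_integral[OF M X meas res]) auto
      then show "norm (\<integral>\<omega>. f (Suc n) (\<lambda>k. X k \<omega>) \<partial>M) \<le> C * real (Suc n) powr (- 3 / 2)"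
        using C[of "Suc n"] by (simp add: f_def)
    qed
  qed
  then show ?thesis
  proof eventually_elim
    case (elim \<omega>)
    then have "(\<lambda>n. f n (\<lambda>k. X k \<omega>)) \<longlonglongrightarrow> 0" by (rule LIMSEQ_imp_Suc)
    then show ?case unfolding f_def by (subst (asm) power_tendsto_0_iff) auto
  qed
qed

text \<open>A weak substitute for the strong law of large numbers. The centered squares
  \<open>Y\<close> are independent with second moment \<open>v\<close>, so their averages over
  \<open>2 ^ m\<close> terms have second moment v / 2^m, which is summable. Between powers of 2 the
  sums of squares are monotone, at the cost of a factor 2.\<close>

lemma AE_sum_squares_bounded:
  assumes M: "prob_space M" and X: "iid_sequence M p X"
  shows "AE \<omega> in M. \<exists>B. \<forall>n>0. (\<Sum>j\<le>n. (X j \<omega>)\<^sup>2) \<le> B * real n"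
proof -
  interpret M: prob_space M by fact
  have law: "distr M borel (X k) = p" for k using X by (simp add: iid_sequence_def)
  have rv [measurable]: "X k \<in> borel_measurable M" for k
    using X by (simp add: iid_sequence_def M.indep_vars_def)
  have indep: "M.indep_vars (\<lambda>_. borel) X UNIV" using X by (simp add: iid_sequence_def)
  define Y where "Y k \<omega> = (X k \<omega>)\<^sup>2 - 1" for k \<omega>
  have Ymeas [measurable]: "Y k \<in> borel_measurable M" for k unfolding Y_def by measurable
  have indepY: "M.indep_vars (\<lambda>_. borel) Y UNIV"
    unfolding Y_def[abs_def] by (rule M.indep_vars_compose2[OF indep]) auto
  define v where "v = expectation (\<lambda>u. (u\<^sup>2 - 1)\<^sup>2)"
  have i2: "integrable p (\<lambda>u. u\<^sup>2)" by (rule moments)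
  have E2: "expectation (\<lambda>u. u\<^sup>2) = 1" using var mean by simp
  have i4: "integrable p (\<lambda>u. (u\<^sup>2 - 1)\<^sup>2)"
    using moments[of 2] moments[of 4] by (simp add: power2_diff power_mult[symmetric])
  have Yi: "integrable M (Y k)" for k
    using integrable_distr[of "X k" M borel "\<lambda>u. u\<^sup>2 - 1"] i2 by (simp add: law Y_def[abs_def])
  have Y2i: "integrable M (\<lambda>\<omega>. (Y k \<omega>)\<^sup>2)" for k
    using integrable_distr[of "X k" M borel "\<lambda>u. (u\<^sup>2 - 1)\<^sup>2"] i4 by (simp add: law Y_def[abs_def])
  have EY: "(\<integral>\<omega>. Y k \<omega> \<partial>M) = 0" for k
    using integral_distr[of "X k" M borel "\<lambda>u. u\<^sup>2 - 1"] i2 E2 prob_space by (simp add: law Y_def[abs_def])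
  have EY2: "(\<integral>\<omega>. (Y k \<omega>)\<^sup>2 \<partial>M) = v" for k
    using integral_distr[of "X k" M borel "\<lambda>u. (u\<^sup>2 - 1)\<^sup>2"] by (simp add: law Y_def[abs_def] v_def)
  have S: "integrable M (\<lambda>\<omega>. (\<Sum>j<N. Y j \<omega>)\<^sup>2) \<and> (\<integral>\<omega>. (\<Sum>j<N. Y j \<omega>)\<^sup>2 \<partial>M) = real N * v" for N
  proof (induction N)
    case (Suc N)
    let ?S = "\<lambda>\<omega>. \<Sum>j<N. Y j \<omega>"
    have ind: "M.indep_var borel (Y N) borel ?S"
      using M.indep_vars_subset[OF indepY] by (intro M.indep_vars_sum) auto
    have Si: "integrable M ?S" using Yi by auto
    have prod: "integrable M (\<lambda>\<omega>. Y N \<omega> * ?S \<omega>)" "(\<integral>\<omega>. Y N \<omega> * ?S \<omega> \<partial>M) = 0"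
      using M.indep_var_integrable[OF ind Yi Si] M.indep_var_lebesgue_integral[OF ind Yi Si] by (simp_all add: EY)
    have sq: "(\<Sum>j<Suc N. Y j \<omega>)\<^sup>2 = (?S \<omega>)\<^sup>2 + (Y N \<omega>)\<^sup>2 + 2 * (Y N \<omega> * ?S \<omega>)" for \<omega>
      by (simp add: power2_sum)
    show ?case unfolding sq
      using Suc prod Y2i[of N] by (simp add: EY2 algebra_simps)
  qed simp
  have "AE \<omega> in M. (\<lambda>m. ((\<Sum>j<2 ^ m. Y j \<omega>) / 2 ^ m)\<^sup>2) \<longlonglongrightarrow> 0"
  proof (rule AE_tendsto_0_of_summable_integral)
    show "integrable M (\<lambda>\<omega>. ((\<Sum>j<2 ^ m. Y j \<omega>) / 2 ^ m)\<^sup>2)" for m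
      using S by (simp add: power_divide)
    have "(\<integral>\<omega>. ((\<Sum>j<2 ^ m. Y j \<omega>) / 2 ^ m)\<^sup>2 \<partial>M) = v * (1 / 2) ^ m" for m
      using S[of "2 ^ m"] by (simp add: power_divide power2_eq_square)
    then show "summable (\<lambda>m. \<integral>\<omega>. ((\<Sum>j<2 ^ m. Y j \<omega>) / 2 ^ m)\<^sup>2 \<partial>M)"
      by (simp add: summable_geometric summable_mult)
  qed simp
  then show ?thesis
  proof eventually_elim
    case (elim \<omega>)
    then have "(\<lambda>m. (\<Sum>j<2 ^ m. Y j \<omega>) / 2 ^ m) \<longlonglongrightarrow> 0" by (subst (asm) power_tendsto_0_iff) auto
    then have "Bseq (\<lambda>m. (\<Sum>j<2 ^ m. Y j \<omega>) / 2 ^ m)" by (intro convergent_imp_Bseq convergentI)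
    then obtain K where "\<And>m. norm ((\<Sum>j<2 ^ m. Y j \<omega>) / 2 ^ m) \<le> K" unfolding Bseq_def by blast
    then have K: "\<bar>(\<Sum>j<2 ^ m. Y j \<omega>) / 2 ^ m\<bar> \<le> K" for m by (simp only: real_norm_def)
    have K0: "K \<ge> 0" using K[of 0] by linarith
    have "(\<Sum>j\<le>n. (X j \<omega>)\<^sup>2) \<le> (2 * (K + 1)) * real n" if n: "n > 0" for n
    proof -
      obtain m :: nat where m: "2 ^ m \<le> n" "n < 2 ^ (m + 1)"
        using ex_power_ivl1[of 2 n] n by auto
      have "(\<Sum>j\<le>n. (X j \<omega>)\<^sup>2) \<le> (\<Sum>j<2 ^ (m + 1). (X j \<omega>)\<^sup>2)"
        using m(2) by (intro sum_mono2) auto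
      also have "\<dots> = (\<Sum>j<2 ^ (m + 1). Y j \<omega>) + 2 ^ (m + 1)"
        by (simp add: Y_def sum_subtractf)
      also have "\<dots> \<le> (K + 1) * 2 ^ (m + 1)"
      proof -
        have "(\<Sum>j<2 ^ (m + 1). Y j \<omega>) / 2 ^ (m + 1) \<le> K" using K[of "m + 1"] by linarith
        then show ?thesis by (simp add: field_simps)
      qed
      also have "\<dots> = (2 * (K + 1)) * 2 ^ m" by simp
      also have "\<dots> \<le> (2 * (K + 1)) * real n"
      proof (rule mult_left_mono)
        have "real (2 ^ m) \<le> real n" using m(1) by (rule of_nat_mono)
        then show "2 ^ m \<le> real n" by simp
      qed (use K0 in simp)
      finally show ?thesis .
    qed
    then show ?case by blast
  qed
qed

text \<open>Countably many null sets are discarded for the rational frequencies. Off these, and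
  where the sums of squares are bounded, the Lipschitz constant \<open>1 + 2 * B\<close> depends on
  the sample point but not on \<open>n\<close> or the frequency.\<close>

lemma AE_tendsto_cos_mean:
  assumes M: "prob_space M" and X: "iid_sequence M p X"
  shows "AE \<omega> in M. \<forall>s. (\<lambda>n. cos_mean s 0 n (\<lambda>k. X k \<omega>)) \<longlonglongrightarrow> exp (- (s\<^sup>2 / 2))
    \<and> (\<lambda>n. cos_mean s (pi / 2) n (\<lambda>k. X k \<omega>)) \<longlonglongrightarrow> 0"
proof -
  interpret M: prob_space M by fact
  have cnt: "countable (\<rat> :: real set)" by (rule countable_rat)
  have "AE \<omega> in M. \<forall>r\<in>\<rat>. (\<lambda>n. cos_mean r 0 n (\<lambda>k. X k \<omega>)) \<longlonglongrightarrow> exp (- (r\<^sup>2 / 2))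
    \<and> (\<lambda>n. cos_mean r (pi / 2) n (\<lambda>k. X k \<omega>)) \<longlonglongrightarrow> 0"
  proof (subst AE_ball_countable[OF cnt], intro ballI)
    fix r :: real
    show "AE \<omega> in M. (\<lambda>n. cos_mean r 0 n (\<lambda>k. X k \<omega>)) \<longlonglongrightarrow> exp (- (r\<^sup>2 / 2))
      \<and> (\<lambda>n. cos_mean r (pi / 2) n (\<lambda>k. X k \<omega>)) \<longlonglongrightarrow> 0"
      using AE_cos_mean_centered[OF M X, of r 0] AE_cos_mean_centered[OF M X, of r "pi / 2"]
    proof eventually_elim
      case (elim \<omega>)
      show ?case
        using tendsto_add[OF elim(1) tendsto_mean_cos_mean(1)[of r]]
          tendsto_add[OF elim(2) tendsto_mean_cos_mean(2)[of r]] by simp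
    qed
  qed
  then show ?thesis using AE_sum_squares_bounded[OF M X]
  proof eventually_elim
    case (elim \<omega>)
    from elim(2) obtain B where B: "\<And>n. n > 0 \<Longrightarrow> (\<Sum>j\<le>n. (X j \<omega>)\<^sup>2) \<le> B * real n" by blast
    have lip: "\<bar>cos_mean s \<theta> n (\<lambda>k. X k \<omega>) - cos_mean r \<theta> n (\<lambda>k. X k \<omega>)\<bar> \<le> (1 + 2 * B) * \<bar>s - r\<bar>"
      if "n > 0" for s \<theta> n r
      by (rule cos_mean_lipschitz[OF that B[OF that]])
    show ?case
    proof (intro allI conjI)
      fix s :: real
      show "(\<lambda>n. cos_mean s 0 n (\<lambda>k. X k \<omega>)) \<longlonglongrightarrow> exp (- (s\<^sup>2 / 2))"
        by (rule tendsto_lipschitz_rational[where g = "\<lambda>s. exp (- (s\<^sup>2 / 2))", OF lip]) (use elim(1) in auto)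
      show "(\<lambda>n. cos_mean s (pi / 2) n (\<lambda>k. X k \<omega>)) \<longlonglongrightarrow> 0"
        by (rule tendsto_lipschitz_rational[where g = "\<lambda>s. 0", OF lip]) (use elim(1) in auto)
    qed
  qed
qed

end

section \<open>From trigonometric means to spectral distributions\<close>

definition circ_esd :: "(nat \<Rightarrow> real) \<Rightarrow> nat \<Rightarrow> real \<Rightarrow> real" where
  "circ_esd x n t = real (card {k. k < n \<and> circ_eig x n k / sqrt (real n) \<le> t}) / real n"

text \<open>The empirical law of the normalized eigenvalues is the image of the uniform law on the
  indices, and by \<open>cos_mean_add\<close> its characteristic function is assembled from the two
  means; Levy's continuity theorem applies.\<close>

lemma tendsto_circ_esd:
  assumes c: "\<And>s. (\<lambda>n. cos_mean s 0 n x) \<longlonglongrightarrow> exp (- (s\<^sup>2 / 2))"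
    and s: "\<And>s. (\<lambda>n. cos_mean s (pi / 2) n x) \<longlonglongrightarrow> 0"
    and cont: "isCont (cdf std_normal_distribution) t"
  shows "(\<lambda>n. circ_esd x n t) \<longlonglongrightarrow> cdf std_normal_distribution t"
proof -
  \<comment> \<open>\<open>Suc n\<close> avoids the uniform law on the empty set.\<close>
  define \<mu> where "\<mu> n = distr (measure_pmf (pmf_of_set {..<Suc n})) borel (\<lambda>k. circ_eig x (Suc n) k / sqrt (real (Suc n)))" for n
  have \<mu>: "real_distribution (\<mu> n)" for n
    unfolding \<mu>_def by (rule prob_space.real_distribution_distr[OF prob_space_measure_pmf]) simp
  have ne: "{..<Suc n} \<noteq> {}" for n by auto
  have pmf_integral: "(\<integral>k. g k \<partial>measure_pmf (pmf_of_set {..<Suc n})) = (\<Sum>k<Suc n. g k) / real (Suc n)" for g :: "nat \<Rightarrow> complex" and n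
  proof -
    have "(\<integral>k. g k \<partial>measure_pmf (pmf_of_set {..<Suc n})) = (\<Sum>k<Suc n. pmf (pmf_of_set {..<Suc n}) k *\<^sub>R g k)"
      by (rule integral_measure_pmf) (simp_all add: set_pmf_of_set[OF ne])
    also have "\<dots> = (\<Sum>k<Suc n. g k / real (Suc n))"
      by (intro sum.cong refl) (simp add: pmf_of_set[OF ne] scaleR_conv_of_real divide_inverse mult.commute)
    finally show ?thesis by (simp only: sum_divide_distrib)
  qed
  have char_\<mu>: "char (\<mu> n) s = (\<Sum>k<Suc n. iexp (s * (circ_eig x (Suc n) k / sqrt (real (Suc n))))) / real (Suc n)" for n s
    unfolding char_def \<mu>_def
    by (subst integral_distr) (simp_all only: pmf_integral, simp_all)
  have "weak_conv_m \<mu> std_normal_distribution"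
  proof (rule levy_continuity[OF \<mu> real_dist_normal_dist])
    fix s
    have "(\<lambda>n. complex_of_real (cos_mean s 0 n x) + \<i> * complex_of_real (cos_mean s (pi / 2) n x))
      \<longlonglongrightarrow> complex_of_real (exp (- (s\<^sup>2 / 2))) + \<i> * complex_of_real 0"
      by (intro tendsto_intros c s)
    then have "(\<lambda>n. complex_of_real (cos_mean s 0 (Suc n) x) + \<i> * complex_of_real (cos_mean s (pi / 2) (Suc n) x))
      \<longlonglongrightarrow> complex_of_real (exp (- (s\<^sup>2 / 2))) + \<i> * complex_of_real 0"
      by (rule LIMSEQ_Suc)
    then show "(\<lambda>n. char (\<mu> n) s) \<longlonglongrightarrow> char std_normal_distribution s"
      unfolding cos_mean_add char_\<mu> char_std_normal_distribution by simp
  qed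
  then have "(\<lambda>n. cdf (\<mu> n) t) \<longlonglongrightarrow> cdf std_normal_distribution t"
    using cont by (simp add: weak_conv_m_def weak_conv_def)
  moreover have "cdf (\<mu> n) t = circ_esd x (Suc n) t" for n
  proof -
    have "cdf (\<mu> n) t = measure (measure_pmf (pmf_of_set {..<Suc n})) {k. circ_eig x (Suc n) k / sqrt (real (Suc n)) \<le> t}"
      unfolding cdf_def \<mu>_def by (subst measure_distr) (auto intro!: arg_cong[of _ _ "measure _"])
    also have "\<dots> = circ_esd x (Suc n) t"
      by (subst measure_pmf_of_set[OF ne]) (auto simp: circ_esd_def Int_def intro!: arg_cong[of _ _ card])
    finally show ?thesis .
  qed
  ultimately have "(\<lambda>n. circ_esd x (Suc n) t) \<longlonglongrightarrow> cdf std_normal_distribution t" by simp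
  then show ?thesis by (rule LIMSEQ_imp_Suc)
qed

lemma isCont_cdf_std_normal: "isCont (cdf std_normal_distribution) t"
proof -
  interpret real_distribution std_normal_distribution by (rule real_dist_normal_dist)
  have "emeasure std_normal_distribution {t} = (\<integral>\<^sup>+x. ennreal (std_normal_density x) * indicator {t} x \<partial>lborel)"
    by (subst emeasure_density) auto
  also have "\<dots> = (\<integral>\<^sup>+x. 0 \<partial>(lborel :: real measure))"
  proof (rule nn_integral_cong_AE)
    show "AE x in lborel. ennreal (std_normal_density x) * indicator {t} x = 0"
      using AE_lborel_singleton[of t] by eventually_elim simp
  qed
  also have "\<dots> = 0" by simp
  finally show ?thesis by (simp add: isCont_cdf measure_def)
qed

text \<open>Squeezing by monotonicity between the points t - \<delta>/2 and t + \<delta>/2. It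
  serves the palindromic ensemble: the normalizations by the square roots of \<open>n + 1\<close>
  and of \<open>n\<close> differ, which makes the threshold for the circulant vary with
  \<open>n\<close>.\<close>

lemma tendsto_mono_varying_point:
  fixes G :: "nat \<Rightarrow> real \<Rightarrow> real"
  assumes mono: "\<And>n. mono (G n)" and lim: "\<And>u. (\<lambda>n. G n u) \<longlonglongrightarrow> F u"
    and F: "isCont F t" and u: "u \<longlonglongrightarrow> t"
  shows "(\<lambda>n. G n (u n)) \<longlonglongrightarrow> F t"
proof (rule LIMSEQ_I)
  fix \<epsilon> :: real assume \<epsilon>: "\<epsilon> > 0"
  obtain \<delta> where \<delta>: "\<delta> > 0" "\<And>r. \<bar>r - t\<bar> < \<delta> \<Longrightarrow> \<bar>F r - F t\<bar> < \<epsilon> / 2"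
    using F \<epsilon> unfolding continuous_at_eps_delta dist_real_def by (metis divide_pos_pos zero_less_numeral)
  obtain N1 where N1: "\<And>n. n \<ge> N1 \<Longrightarrow> \<bar>u n - t\<bar> < \<delta> / 2" using LIMSEQ_D[OF u, of "\<delta> / 2"] \<delta> by auto
  obtain N2 where N2: "\<And>n. n \<ge> N2 \<Longrightarrow> \<bar>G n (t - \<delta> / 2) - F (t - \<delta> / 2)\<bar> < \<epsilon> / 2"
    using LIMSEQ_D[OF lim, of "\<epsilon> / 2"] \<epsilon> by auto
  obtain N3 where N3: "\<And>n. n \<ge> N3 \<Longrightarrow> \<bar>G n (t + \<delta> / 2) - F (t + \<delta> / 2)\<bar> < \<epsilon> / 2"
    using LIMSEQ_D[OF lim, of "\<epsilon> / 2"] \<epsilon> by auto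
  have F1: "\<bar>F (t - \<delta> / 2) - F t\<bar> < \<epsilon> / 2" and F2: "\<bar>F (t + \<delta> / 2) - F t\<bar> < \<epsilon> / 2"
    by (rule \<delta>(2), use \<delta>(1) in simp)+
  show "\<exists>N. \<forall>n\<ge>N. norm (G n (u n) - F t) < \<epsilon>"
  proof (intro exI[of _ "max N1 (max N2 N3)"] allI impI)
    fix n assume n: "n \<ge> max N1 (max N2 N3)"
    have "\<bar>u n - t\<bar> < \<delta> / 2" using n by (intro N1) simp
    then have "t - \<delta> / 2 \<le> u n" "u n \<le> t + \<delta> / 2" by linarith+
    then have "G n (t - \<delta> / 2) \<le> G n (u n)" "G n (u n) \<le> G n (t + \<delta> / 2)"
      using monoD[OF mono] by auto
    moreover have "\<bar>G n (t - \<delta> / 2) - F (t - \<delta> / 2)\<bar> < \<epsilon> / 2" using n by (intro N2) simp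
    moreover have "\<bar>G n (t + \<delta> / 2) - F (t + \<delta> / 2)\<bar> < \<epsilon> / 2" using n by (intro N3) simp
    ultimately show "norm (G n (u n) - F t) < \<epsilon>"
      using F1 F2 unfolding real_norm_def by linarith
  qed
qed

text \<open>Almost sure convergence implies the other two modes by dominated convergence, applied to
  indicators for convergence in probability and to bounded continuous functions for convergence in
  distribution.\<close>

lemma limiting_spectral_distributionI:
  assumes M: "prob_space M" and \<nu>: "real_distribution \<nu>"
    and meas: "\<And>n t. (\<lambda>\<omega>. empirical_spectral_distribution (B n \<omega>) t) \<in> borel_measurable M"
    and lim: "AE \<omega> in M. weak_conv (\<lambda>n. empirical_spectral_distribution (B n \<omega>)) (cdf \<nu>)"
  shows "limiting_spectral_distribution M B (cdf \<nu>)"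
proof -
  interpret M: prob_space M by fact
  have lim_t: "AE \<omega> in M. (\<lambda>n. empirical_spectral_distribution (B n \<omega>) t) \<longlonglongrightarrow> cdf \<nu> t" if "isCont (cdf \<nu>) t" for t
    using lim that by (auto simp: weak_conv_def)
  have "converges_in_probability_to_const M (\<lambda>n \<omega>. empirical_spectral_distribution (B n \<omega>) t) (cdf \<nu> t)"
    if t: "isCont (cdf \<nu>) t" for t
    unfolding converges_in_probability_to_const_def
  proof (intro conjI allI impI meas)
    fix \<epsilon> :: real assume \<epsilon>: "\<epsilon> > 0"
    let ?Y = "\<lambda>n \<omega>. empirical_spectral_distribution (B n \<omega>) t"
    let ?A = "\<lambda>n. {\<omega> \<in> space M. \<bar>?Y n \<omega> - cdf \<nu> t\<bar> > \<epsilon>}"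
    note [measurable] = meas[of _ t]
    have "(\<lambda>n. \<integral>\<omega>. indicator (?A n) \<omega> \<partial>M) \<longlonglongrightarrow> (\<integral>\<omega>. (0 :: real) \<partial>M)"
    proof (rule integral_dominated_convergence[where w = "\<lambda>_. 1"])
      show "AE \<omega> in M. (\<lambda>n. indicator (?A n) \<omega> :: real) \<longlonglongrightarrow> 0"
        using lim_t[OF t]
      proof eventually_elim
        case (elim \<omega>)
        have "eventually (\<lambda>n. dist (?Y n \<omega>) (cdf \<nu> t) < \<epsilon>) sequentially" using elim \<epsilon> by (rule tendstoD)
        then have "eventually (\<lambda>n. indicator (?A n) \<omega> = (0 :: real)) sequentially"
          by eventually_elim (auto simp: dist_real_def)
        then show ?case by (rule tendsto_eventually)
      qed
    qed (auto simp: indicator_def)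
    then show "(\<lambda>n. measure M (?A n)) \<longlonglongrightarrow> 0"
      by simp
  qed
  moreover have "converges_in_distribution_to_const M (\<lambda>n \<omega>. empirical_spectral_distribution (B n \<omega>) t) (cdf \<nu> t)"
    if t: "isCont (cdf \<nu>) t" for t
    unfolding converges_in_distribution_to_const_def
  proof (intro conjI allI meas integral_bdd_continuous_conv_imp_weak_conv)
    fix f :: "real \<Rightarrow> real" assume f: "\<And>x. isCont f x" "\<And>x. \<bar>f x\<bar> \<le> 1"
    let ?Y = "\<lambda>n \<omega>. empirical_spectral_distribution (B n \<omega>) t"
    note [measurable] = meas[of _ t]
    have [measurable]: "f \<in> borel_measurable borel"
      using f(1) by (intro borel_measurable_continuous_onI continuous_at_imp_continuous_on) auto
    have "(\<lambda>n. \<integral>\<omega>. f (?Y n \<omega>) \<partial>M) \<longlonglongrightarrow> (\<integral>\<omega>. f (cdf \<nu> t) \<partial>M)"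
    proof (rule integral_dominated_convergence[where w = "\<lambda>_. 1"])
      show "AE \<omega> in M. (\<lambda>n. f (?Y n \<omega>)) \<longlonglongrightarrow> f (cdf \<nu> t)"
        using lim_t[OF t] by eventually_elim (rule isCont_tendsto_compose[OF f(1)])
    qed (use f(2) in auto)
    then show "(\<lambda>n. integral\<^sup>L (distr M borel (?Y n)) f) \<longlonglongrightarrow> integral\<^sup>L (return borel (cdf \<nu> t)) f"
      by (simp add: integral_distr integral_return M.prob_space)
  next
    show "real_distribution (distr M borel (\<lambda>\<omega>. empirical_spectral_distribution (B n \<omega>) t))" for n
      using meas by (rule M.real_distribution_distr)
    show "real_distribution (return borel (cdf \<nu> t))"
      by (intro real_distribution.intro prob_space_return real_distribution_axioms.intro) auto
  qed
  ultimately show ?thesis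
    unfolding limiting_spectral_distribution_def using \<nu> lim by blast
qed

theorem theorem4p4:
  fixes M :: "'a measure" and p :: "real measure" and b x :: "nat \<Rightarrow> 'a \<Rightarrow> real"
  assumes "real_distribution p"
    and "\<And>k::nat. integrable p (\<lambda>u. u ^ k)"
    and "prob_space.expectation p (\<lambda>u. u) = 0"
    and "prob_space.variance p (\<lambda>u. u) = 1"
    and "prob_space M"
    and "iid_sequence M p b"
    and "iid_sequence M p x"
  shows "\<exists>F. limiting_spectral_distribution M
               (\<lambda>m \<omega>. (1 / sqrt (real (2 * m))) \<cdot>\<^sub>m palindromic_toeplitz (\<lambda>k. b k \<omega>) (2 * m)) F
           \<and> limiting_spectral_distribution M
               (\<lambda>N \<omega>. symmetric_toeplitz (\<lambda>k. x k \<omega>) N) F"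
proof (intro exI conjI)
  interpret real_distribution p by fact
  interpret standardized_moments p by standard (use assms in auto)
  let ?F = "cdf std_normal_distribution"
  interpret M: prob_space M by fact
  have rv: "X k \<in> borel_measurable M" if "iid_sequence M p X" for X k
    using that by (simp add: iid_sequence_def M.indep_vars_def)
  have lim: "AE \<omega> in M. \<forall>t. (\<lambda>n. circ_esd (\<lambda>k. X k \<omega>) n t) \<longlonglongrightarrow> ?F t" if "iid_sequence M p X" for X
    using AE_tendsto_cos_mean[OF assms(5) that]
    by eventually_elim (auto intro!: tendsto_circ_esd isCont_cdf_std_normal)
  show "limiting_spectral_distribution M (\<lambda>N \<omega>. symmetric_toeplitz (\<lambda>k. x k \<omega>) N) ?F"
  proof (rule limiting_spectral_distributionI[OF assms(5) real_dist_normal_dist])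
    have car: "symmetric_toeplitz (\<lambda>k. x k \<omega>) N \<in> carrier_mat N N" for N \<omega>
      by (simp add: symmetric_toeplitz_eq_circulant)
    show "(\<lambda>\<omega>. empirical_spectral_distribution (symmetric_toeplitz (\<lambda>k. x k \<omega>) N) t) \<in> borel_measurable M" for N t
    proof (rule borel_measurable_empirical_spectral_distribution[OF car])
      show "symmetric_toeplitz (\<lambda>k. x k \<omega>) N $$ (i, j) = symmetric_toeplitz (\<lambda>k. x k \<omega>) N $$ (j, i)"
        if "i < N" "j < N" for \<omega> i j
        using that by (simp add: symmetric_toeplitz_def Let_def abs_minus_commute)
      show "(\<lambda>\<omega>. symmetric_toeplitz (\<lambda>k. x k \<omega>) N $$ (i, j)) \<in> borel_measurable M" if "i < N" "j < N" for i j
        using that rv[OF assms(7)] by (simp add: symmetric_toeplitz_def Let_def)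
    qed
    have esd: "empirical_spectral_distribution (symmetric_toeplitz X N) t = circ_esd X N t" if "N > 0" for X N t
    proof -
      have "real (size (filter_mset (\<lambda>\<mu>. \<mu> \<le> t) (proots (char_poly (symmetric_toeplitz X N))))) = real (card {k. k < N \<and> circ_eig X N k / sqrt (real N) \<le> t})"
        unfolding symmetric_toeplitz_eq_circulant size_filter_proots_sym_circulant[OF that] circ_eig_scale by simp
      then show ?thesis by (simp add: empirical_spectral_distribution_def circ_esd_def symmetric_toeplitz_def)
    qed
    show "AE \<omega> in M. weak_conv (\<lambda>N. empirical_spectral_distribution (symmetric_toeplitz (\<lambda>k. x k \<omega>) N)) ?F"
      using lim[OF assms(7)]
    proof eventually_elim
      case (elim \<omega>)
      show ?case unfolding weak_conv_def
      proof (intro allI impI)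
        fix t
        show "(\<lambda>N. empirical_spectral_distribution (symmetric_toeplitz (\<lambda>k. x k \<omega>) N) t) \<longlonglongrightarrow> ?F t"
          by (rule Lim_transform_eventually[OF elim[rule_format, of t]])
             (use esd in \<open>auto intro!: eventually_mono[OF eventually_gt_at_top[of 0]]\<close>)
      qed
    qed
  qed
  let ?A = "\<lambda>m \<omega>. (1 / sqrt (real (2 * m))) \<cdot>\<^sub>m palindromic_toeplitz (\<lambda>k. b k \<omega>) (2 * m)"
  show "limiting_spectral_distribution M ?A ?F"
  proof (rule limiting_spectral_distributionI[OF assms(5) real_dist_normal_dist])
    have car: "?A m \<omega> \<in> carrier_mat (2 * m) (2 * m)" for m \<omega>
      by (simp add: palindromic_toeplitz_def)
    show "(\<lambda>\<omega>. empirical_spectral_distribution (?A m \<omega>) t) \<in> borel_measurable M" for m t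
    proof (rule borel_measurable_empirical_spectral_distribution[OF car])
      fix i j assume ij: "i < 2 * m" "j < 2 * m"
      show "?A m \<omega> $$ (i, j)
        = ?A m \<omega> $$ (j, i)" for \<omega>
        using ij by (simp add: palindromic_toeplitz_def Let_def abs_minus_commute)
      show "(\<lambda>\<omega>. ?A m \<omega> $$ (i, j)) \<in> borel_measurable M"
        using ij rv[OF assms(6)] by (simp add: palindromic_toeplitz_def Let_def)
    qed
    show "AE \<omega> in M. weak_conv (\<lambda>m. empirical_spectral_distribution (?A m \<omega>)) ?F"
      using lim[OF assms(6)]
    proof eventually_elim
      case (elim \<omega>)
      define X where "X k = b k \<omega>" for k
      define E where "E m t = empirical_spectral_distribution ((1 / sqrt (real (2 * m))) \<cdot>\<^sub>m palindromic_toeplitz X (2 * m)) t" for m t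
      \<comment> \<open>The shift discards the empty matrix at index 0. Index \<open>Suc m\<close>
        has order \<open>n + 1\<close> with \<open>n = 2 * m + 1\<close>, so only circulants of odd
        order are compared.\<close>
      have "(\<lambda>m. E (Suc m) t) \<longlonglongrightarrow> ?F t" for t
      proof -
        \<comment> \<open>The palindromic spectrum is divided by sqrt (n + 1), the circulant one by
          sqrt n; the threshold \<open>t\<close> for the former is this threshold for the
          latter.\<close>
        define u where "u m = t * sqrt (1 + 1 / real (2 * m + 1))" for m
        have "filterlim (\<lambda>m. 2 * m + 1) sequentially sequentially"
          by (rule filterlim_subseq) (auto simp: strict_mono_def)
        then have sub: "(\<lambda>m. f (2 * m + 1)) \<longlonglongrightarrow> L" if "f \<longlonglongrightarrow> L" for f and L :: real
          using that by (rule filterlim_compose[rotated])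
        have inv: "(\<lambda>m. 1 / real (2 * m + 1)) \<longlonglongrightarrow> 0" by (rule sub[OF lim_1_over_n])
        then have "u \<longlonglongrightarrow> t * sqrt (1 + 0)" unfolding u_def by (intro tendsto_intros)
        then have u: "u \<longlonglongrightarrow> t" by simp
        have "(\<lambda>m. circ_esd X (2 * m + 1) (u m)) \<longlonglongrightarrow> ?F t"
        proof (rule tendsto_mono_varying_point[OF _ _ isCont_cdf_std_normal u])
          show "mono (circ_esd X (2 * m + 1))" for m
            unfolding circ_esd_def by (intro monoI divide_right_mono of_nat_mono card_mono) auto
          show "(\<lambda>m. circ_esd X (2 * m + 1) v) \<longlonglongrightarrow> ?F v" for v
            using sub[OF elim[rule_format, of v]] by (simp add: X_def[abs_def])
        qed
        moreover have "(\<lambda>m. circ_esd X (2 * m + 1) (u m) - E (Suc m) t) \<longlonglongrightarrow> 0"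
        proof (rule Lim_null_comparison)
          show "(\<lambda>m. 4 * (1 / real (2 * m + 1))) \<longlonglongrightarrow> 0"
            using tendsto_mult[OF tendsto_const inv, of 4] by simp
          show "\<forall>\<^sub>F m in sequentially. norm (circ_esd X (2 * m + 1) (u m) - E (Suc m) t) \<le> 4 * (1 / real (2 * m + 1))"
          proof (intro always_eventually allI)
            fix m :: nat
            define n where "n = 2 * m + 1"
            have n: "n > 0" "2 * Suc m = Suc n" by (simp_all add: n_def)
            define c where "c = card {k. k < n \<and> circ_eig X n k / sqrt (real n) \<le> u m}"
            define e where "e = size (filter_mset (\<lambda>\<mu>. \<mu> \<le> t) (proots (char_poly ((1 / sqrt (real (Suc n))) \<cdot>\<^sub>m palindromic_toeplitz X (Suc n)))))"
            have um: "u m = t * (sqrt (real (Suc n)) / sqrt (real n))"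
            proof -
              have "1 + 1 / real n = real (Suc n) / real n" using n by (simp add: field_simps)
              then show ?thesis by (simp only: u_def n_def[symmetric] real_sqrt_divide)
            qed
            have iff: "1 / sqrt (real (Suc n)) * y \<le> t \<longleftrightarrow> y / sqrt (real n) \<le> u m" for y
              using n unfolding um by (simp add: field_simps)
            have "\<bar>real e - real c\<bar> \<le> 3"
              using size_filter_proots_palindromic[OF n(1), of t "\<lambda>k. 1 / sqrt (real (Suc n)) * X k"]
              unfolding smult_palindromic_toeplitz[symmetric] circ_eig_scale iff e_def c_def .
            moreover have "real c \<le> real n"
              using card_mono[of "{..<n}" "{k. k < n \<and> circ_eig X n k / sqrt (real n) \<le> u m}"] by (auto simp: c_def)
            \<comment> \<open>The counts are also divided by different sizes. Besides
              \<open>3 * n\<close> from the count comparison this leaves \<open>real c\<close>, at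
              most \<open>n\<close>, whence the constant 4.\<close>
            ultimately have "\<bar>real c * real (Suc n) - real e * real n\<bar> \<le> 4 * real (Suc n)"
            proof -
              assume a: "\<bar>real e - real c\<bar> \<le> 3" "real c \<le> real n"
              have "real c * real (Suc n) - real e * real n = (real c - real e) * real n + real c" by (simp add: algebra_simps)
              moreover have "\<bar>(real c - real e) * real n\<bar> \<le> 3 * real n"
                unfolding abs_mult using a by (intro mult_mono) auto
              ultimately show ?thesis using a by auto
            qed
            then have "\<bar>(real c * real (Suc n) - real e * real n) / (real n * real (Suc n))\<bar> \<le> 4 * real (Suc n) / (real n * real (Suc n))"
              unfolding abs_divide by (simp add: divide_right_mono)
            also have "(real c * real (Suc n) - real e * real n) / (real n * real (Suc n)) = real c / real n - real e / real (Suc n)"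
              using n(1) by (simp add: diff_frac_eq)
            also have "4 * real (Suc n) / (real n * real (Suc n)) = 4 * (1 / real n)" using n(1) by (simp del: of_nat_Suc)
            finally show "norm (circ_esd X (2 * m + 1) (u m) - E (Suc m) t) \<le> 4 * (1 / real (2 * m + 1))"
              unfolding E_def empirical_spectral_distribution_def circ_esd_def n(2) n_def[symmetric] c_def[symmetric] e_def[symmetric]
              by (simp add: palindromic_toeplitz_def)
          qed
        qed
        ultimately have "(\<lambda>m. circ_esd X (2 * m + 1) (u m) - (circ_esd X (2 * m + 1) (u m) - E (Suc m) t)) \<longlonglongrightarrow> ?F t - 0"
          by (rule tendsto_diff)
        then show ?thesis by simp
      qed
      then have "(\<lambda>m. E m t) \<longlonglongrightarrow> ?F t" for t by (rule LIMSEQ_imp_Suc)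
      then show ?case by (simp add: weak_conv_def E_def X_def[abs_def])
    qed
  qed
qed

end
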